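(* Let $\mathfrak S$ be a refined $G$-semimatroid. Then the poset $\overline{\mathcal I_{\mathfrak S}}$ is $CM(\delta_{\mathfrak S})$, i.e. it is Cohen--Macaulay in characteristic $0$ and in every characteristic that does not divide $\delta_{\mathfrak S}$.
   Context: Semimatroids. A simplicial complex on a (possibly infinite) set $S$ is a family of finite subsets of $S$ closed under taking subsets and containing all singletons. A semimatroid is a triple $\mathscr S=(S,\mathcal K,\rho)$ with $S$ a (possibly infinite) set, $\mathcal K$ a nonempty finite-dimensional simplicial complex on $S$ and $\rho:\mathcal K\to\mathbb N$ such that for all $X,Y\in\mathcal K$: (R1) $0\leq\rho(X)\leq|X|$; (R2) $X\subseteq Y$ implies $\rho(X)\leq\rho(Y)$; (R3) if $X\cup Y\in\mathcal K$ then $\rho(X)+\rho(Y)\geq\rho(X\cup Y)+\rho(X\cap Y)$; (CR1) if $\rho(X)=\rho(X\cap Y)$ then $X\cup Y\in\mathcal K$; (CR2) if $\rho(X)<\rho(Y)$ then $X\cup\{y\}\in\mathcal K$ for some $y\in Y\setminus X$. The rank $\rho(\mathscr S)$ is the maximum of $\rho$. The poset of independent sets is $\mathcal I(\mathscr S)=\{I\in\mathcal K\mid\rho(I)=|I|\}$ ordered by inclusion. $G$-semimatroids. A $G$-semimatroid $\mathfrak S$ is an action of a group $G$ on $S$ by permutations preserving $\mathcal K$ and $\rho$, with finitely many orbits on $\mathcal K$. It is translative if for all $s\in S$, $g\in G$: $\{s,gs\}\in\mathcal K$ implies $gs=s$. It is refined if it is translative, $G$ is a free abelian group and there is $k\in\mathbb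 N$ such that for every $x\in\mathcal K$, $\operatorname{stab}_G(x)$ is a direct summand of $G$ of rank $k(\rho(\mathscr S)-\rho(x))$. $\mathcal I_{\mathfrak S}=\mathcal I(\mathscr S)/G$ is the set of orbits ordered by $Gx\leq Gy$ iff $gx\subseteq y$ for some $g\in G$ (a finite poset). $\overline{\mathcal I_{\mathfrak S}}$ denotes it with its minimal element $G\emptyset$ removed. The number $\delta_{\mathfrak S}$. Let $E_{\mathfrak S}=S/G$. For $\alpha=\{s_1,\dots,s_k\}\in\mathcal K$ put $\operatorname{Supp}(G\alpha)=\{Gs_1,\dots,Gs_k\}\subseteq E_{\mathfrak S}$, and $\operatorname{Supp}(\mathcal I_{\mathfrak S})=\{\operatorname{Supp}(GI)\mid I\in\mathcal I(\mathscr S)\}$. For $X\in\operatorname{Supp}(\mathcal K/G)$, $\operatorname{stab}_G(X)$ denotes $\operatorname{stab}_G(\alpha)=\bigcap_{s\in\alpha}\operatorname{stab}_G(s)$ for any $\alpha\in\mathcal K$ with $\operatorname{Supp}(G\alpha)=X$ (independent of the choice). For $X=\{x_1,\dots,x_k\}\in\operatorname{Supp}(\mathcal I_{\mathfrak S})$ let $G^{(X)}=G/\operatorname{stab}_G(X)$, $H_i^{(X)}=\operatorname{stab}_{G^{(X)}}(X\setminus\{x_i\})=\operatorname{stab}_G(X\setminus\{x_i\})/\operatorname{stab}_G(X)$, $H^{(X)}=\bigoplus_{i=1}^kH^{(X)}_i\subseteq G^{(X)}$ (a subgroup of finite index), and $\delta_{\mathfrak S}(X)=[G^{(X)}:H^{(X)}]$.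 Then $\delta_{\mathfrak S}=\operatorname{lcm}\{\delta_{\mathfrak S}(X)\mid X\in\operatorname{Supp}(\mathcal I_{\mathfrak S})\}$. Cohen--Macaulayness. A finite-length poset is Cohen--Macaulay over a field $F$ (in characteristic $\operatorname{char}F$) if its order complex $\Delta$ satisfies $\widetilde H_i(\operatorname{lk}(\sigma);F)=0$ for every face $\sigma\in\Delta$ (including $\emptyset$) and every $i<\dim\operatorname{lk}(\sigma)$. It is $CM(m)$ if it is Cohen--Macaulay over every field whose characteristic is $0$ or does not divide $m$. *)

theory Defs
  imports "HOL-Algebra.Group_Action" "HOL-Algebra.Free_Abelian_Groups"
begin

definition simplicial_complex :: "'s set \<Rightarrow> 's set set \<Rightarrow> bool" where
  "simplicial_complex S K \<longleftrightarrow>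
     (\<forall>X\<in>K. finite X \<and> X \<subseteq> S) \<and>
     (\<forall>X\<in>K. \<forall>Y. Y \<subseteq> X \<longrightarrow> Y \<in> K) \<and>
     (\<forall>s\<in>S. {s} \<in> K)"

locale semimatroid =
  fixes S :: "'s set" and K :: "'s set set" and \<rho> :: "'s set \<Rightarrow> nat"
  assumes complex: "simplicial_complex S K"
    and nonempty: "K \<noteq> {}"
    and finite_dimensional: "\<exists>d. \<forall>X\<in>K. card X \<le> d"
    and R1: "X \<in> K \<Longrightarrow> \<rho> X \<le> card X"
    and R2: "X \<in> K \<Longrightarrow> Y \<in> K \<Longrightarrow> X \<subseteq> Y \<Longrightarrow> \<rho> X \<le> \<rho> Y"
    and R3: "X \<in> K \<Longrightarrow> Y \<in> K \<Longrightarrow> X \<union> Y \<in> K \<Longrightarrow> \<rho> (X \<union> Y) + \<rho> (X \<inter> Y) \<le> \<rho> X + \<rho> Y"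
    and CR1: "X \<in> K \<Longrightarrow> Y \<in> K \<Longrightarrow> \<rho> X = \<rho> (X \<inter> Y) \<Longrightarrow> X \<union> Y \<in> K"
    and CR2: "X \<in> K \<Longrightarrow> Y \<in> K \<Longrightarrow> \<rho> X < \<rho> Y \<Longrightarrow> \<exists>y\<in>Y - X. X \<union> {y} \<in> K"

text \<open>The maximum is over a bounded set of naturals, since \<^term>\<open>\<rho> X \<le> card X\<close> and
  \<^term>\<open>K\<close> is finite-dimensional.\<close>
definition semimatroid_rank :: "'s set set \<Rightarrow> ('s set \<Rightarrow> nat) \<Rightarrow> nat" where
  "semimatroid_rank K \<rho> = Max (\<rho> ` K)"

definition independent_sets :: "'s set set \<Rightarrow> ('s set \<Rightarrow> nat) \<Rightarrow> 's set set" where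
  "independent_sets K \<rho> = {I \<in> K. \<rho> I = card I}"

abbreviation set_action :: "('g \<Rightarrow> 's \<Rightarrow> 's) \<Rightarrow> 'g \<Rightarrow> 's set \<Rightarrow> 's set" where
  "set_action \<phi> g X \<equiv> \<phi> g ` X"

locale G_semimatroid = group_action G S \<phi> + semimatroid S K \<rho>
  for G (structure) and S :: "'s set" and K and \<rho> and \<phi> +
  assumes action_complex: "g \<in> carrier G \<Longrightarrow> X \<in> K \<Longrightarrow> set_action \<phi> g X \<in> K"
    and action_rank: "g \<in> carrier G \<Longrightarrow> X \<in> K \<Longrightarrow> \<rho> (set_action \<phi> g X) = \<rho> X"
    and finite_orbits: "finite (orbits G K (set_action \<phi>))"

locale translative_G_semimatroid = G_semimatroid +
  assumes translative: "s \<in> S \<Longrightarrow> g \<in> carrier G \<Longrightarrow> {s, \<phi> g s} \<in> K \<Longrightarrow> \<phi> g s = s"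

text \<open>In the translative case this is also the stabilizer for the action on \<^term>\<open>K\<close>,
  see \<open>pointwise_eq_setwise_stabilizer\<close> below.\<close>
definition pointwise_stabilizer ::
    "('g, 'm) monoid_scheme \<Rightarrow> ('g \<Rightarrow> 's \<Rightarrow> 's) \<Rightarrow> 's set \<Rightarrow> 'g set" where
  "pointwise_stabilizer G \<phi> X = carrier G \<inter> (\<Inter>s\<in>X. stabilizer G \<phi> s)"

text \<open>A basis of a free abelian group is a subset of it, so bases in the type of the group
  elements suffice.\<close>
definition free_abelian :: "('g, 'm) monoid_scheme \<Rightarrow> bool" where
  "free_abelian G \<longleftrightarrow> (\<exists>B :: 'g set. G \<cong> free_Abelian_group B)"

definition direct_summand :: "('g, 'm) monoid_scheme \<Rightarrow> 'g set \<Rightarrow> bool" where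
  "direct_summand G H \<longleftrightarrow> subgroup H G \<and>
     (\<exists>B. subgroup B G \<and> H \<inter> B = {\<one>\<^bsub>G\<^esub>} \<and> H <#>\<^bsub>G\<^esub> B = carrier G)"

definition has_free_rank :: "('g, 'm) monoid_scheme \<Rightarrow> nat \<Rightarrow> bool" where
  "has_free_rank G n \<longleftrightarrow> G \<cong> free_Abelian_group {..<n}"

locale refined_G_semimatroid = translative_G_semimatroid +
  assumes free: "free_abelian G"
    and stabilizers: "\<exists>k. \<forall>X\<in>K. direct_summand G (pointwise_stabilizer G \<phi> X) \<and>
          has_free_rank (subgroup_generated G (pointwise_stabilizer G \<phi> X))
            (k * (semimatroid_rank K \<rho> - \<rho> X))"

definition independent_orbits ::
    "('g, 'm) monoid_scheme \<Rightarrow> 's set set \<Rightarrow> ('s set \<Rightarrow> nat) \<Rightarrow> ('g \<Rightarrow> 's \<Rightarrow> 's) \<Rightarrow> 's set set set" where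
  "independent_orbits G K \<rho> \<phi> = orbits G (independent_sets K \<rho>) (set_action \<phi>)"

definition reduced_independent_orbits ::
    "('g, 'm) monoid_scheme \<Rightarrow> 's set set \<Rightarrow> ('s set \<Rightarrow> nat) \<Rightarrow> ('g \<Rightarrow> 's \<Rightarrow> 's) \<Rightarrow> 's set set set" where
  "reduced_independent_orbits G K \<rho> \<phi> =
     independent_orbits G K \<rho> \<phi> - {orbit G (set_action \<phi>) {}}"

text \<open>Meant for sets \<open>P\<close> of orbits, where \<open>x \<in> A\<close> says that \<open>A\<close> is the orbit of \<open>x\<close>.\<close>
definition orbit_order ::
    "('g, 'm) monoid_scheme \<Rightarrow> ('g \<Rightarrow> 's \<Rightarrow> 's) \<Rightarrow> 's set set set \<Rightarrow> 's set set rel" where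
  "orbit_order G \<phi> P = {(A, B). A \<in> P \<and> B \<in> P \<and>
     (\<exists>x\<in>A. \<exists>y\<in>B. \<exists>g\<in>carrier G. set_action \<phi> g x \<subseteq> y)}"

text \<open>\<open>Supp (G \<alpha>)\<close>, computed from a representative \<open>\<alpha>\<close> of the orbit.\<close>
definition Supp :: "('g, 'm) monoid_scheme \<Rightarrow> ('g \<Rightarrow> 's \<Rightarrow> 's) \<Rightarrow> 's set \<Rightarrow> 's set set" where
  "Supp G \<phi> \<alpha> = orbit G \<phi> ` \<alpha>"

text \<open>Independent of the representative when \<open>G\<close> is abelian, see \<open>support_stabilizer_eq\<close> below.\<close>
definition support_stabilizer ::
    "('g, 'm) monoid_scheme \<Rightarrow> 's set set \<Rightarrow> ('g \<Rightarrow> 's \<Rightarrow> 's) \<Rightarrow> 's set set \<Rightarrow> 'g set" where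
  "support_stabilizer G K \<phi> X = pointwise_stabilizer G \<phi> (SOME \<alpha>. \<alpha> \<in> K \<and> Supp G \<phi> \<alpha> = X)"

definition support_quotient ::
    "('g, 'm) monoid_scheme \<Rightarrow> 's set set \<Rightarrow> ('g \<Rightarrow> 's \<Rightarrow> 's) \<Rightarrow> 's set set \<Rightarrow> 'g set monoid" where
  "support_quotient G K \<phi> X = G Mod support_stabilizer G K \<phi> X"

text \<open>The subgroup \<open>stab (X - {x}) / stab X\<close> of the quotient group.\<close>
definition support_factor ::
    "('g, 'm) monoid_scheme \<Rightarrow> 's set set \<Rightarrow> ('g \<Rightarrow> 's \<Rightarrow> 's) \<Rightarrow> 's set set \<Rightarrow> 's set \<Rightarrow> 'g set set" where
  "support_factor G K \<phi> X x =
     (\<lambda>h. support_stabilizer G K \<phi> X #>\<^bsub>G\<^esub> h) ` support_stabilizer G K \<phi> (X - {x})"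

text \<open>The internal sum of the factors. It is direct: if a product of elements \<open>h x\<close> of
  \<open>stab (X - {x})\<close> lies in \<open>stab X\<close>, then each \<open>h x\<close> also fixes \<open>x\<close>.\<close>
definition support_sum ::
    "('g, 'm) monoid_scheme \<Rightarrow> 's set set \<Rightarrow> ('g \<Rightarrow> 's \<Rightarrow> 's) \<Rightarrow> 's set set \<Rightarrow> 'g set set" where
  "support_sum G K \<phi> X =
     generate (support_quotient G K \<phi> X) (\<Union>x\<in>X. support_factor G K \<phi> X x)"

definition delta_support ::
    "('g, 'm) monoid_scheme \<Rightarrow> 's set set \<Rightarrow> ('g \<Rightarrow> 's \<Rightarrow> 's) \<Rightarrow> 's set set \<Rightarrow> nat" where
  "delta_support G K \<phi> X = card (rcosets\<^bsub>support_quotient G K \<phi> X\<^esub> (support_sum G K \<phi> X))"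

definition delta ::
    "('g, 'm) monoid_scheme \<Rightarrow> 's set set \<Rightarrow> ('s set \<Rightarrow> nat) \<Rightarrow> ('g \<Rightarrow> 's \<Rightarrow> 's) \<Rightarrow> nat" where
  "delta G K \<rho> \<phi> = Lcm (delta_support G K \<phi> ` Supp G \<phi> ` independent_sets K \<rho>)"

text \<open>Complexes are sets of finite sets that contain the empty face. The relation \<open>r\<close> orders the
  vertices of every face linearly and thereby orients it; \<^term>\<open>i\<close>-chains are supported on
  faces with \<^term>\<open>i + 1\<close> vertices, so the empty face spans the chains of degree \<open>-1\<close>.\<close>

definition simplicial_chain_group :: "'v set set \<Rightarrow> int \<Rightarrow> ('v set \<Rightarrow>\<^sub>0 'k::field) monoid" where
  "simplicial_chain_group \<Delta> i =
     \<lparr>carrier = {c. Poly_Mapping.keys c \<subseteq> {\<sigma> \<in> \<Delta>. int (card \<sigma>) = i + 1}},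
      monoid.mult = (+), one = 0\<rparr>"

text \<open>The face of \<open>v\<^sub>0 < \<dots> < v\<^sub>n\<close> omitting \<open>v\<^sub>j\<close> gets the sign \<open>(-1)^j\<close>.\<close>
definition simplicial_boundary ::
    "'v rel \<Rightarrow> ('v set \<Rightarrow>\<^sub>0 'k) \<Rightarrow> ('v set \<Rightarrow>\<^sub>0 'k::field)" where
  "simplicial_boundary r c = (\<Sum>\<sigma>\<in>Poly_Mapping.keys c. \<Sum>v\<in>\<sigma>.
     Poly_Mapping.single (\<sigma> - {v})
       ((-1) ^ card {u \<in> \<sigma>. u \<noteq> v \<and> (u, v) \<in> r} * Poly_Mapping.lookup c \<sigma>))"

definition simplicial_cycles :: "'v rel \<Rightarrow> 'v set set \<Rightarrow> int \<Rightarrow> ('v set \<Rightarrow>\<^sub>0 'k::field) set" where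
  "simplicial_cycles r \<Delta> i =
     {c \<in> carrier (simplicial_chain_group \<Delta> i). simplicial_boundary r c = 0}"

definition simplicial_boundaries :: "'v rel \<Rightarrow> 'v set set \<Rightarrow> int \<Rightarrow> ('v set \<Rightarrow>\<^sub>0 'k::field) set" where
  "simplicial_boundaries r \<Delta> i =
     simplicial_boundary r ` carrier (simplicial_chain_group \<Delta> (i + 1))"

definition reduced_homology_group ::
    "'v rel \<Rightarrow> 'v set set \<Rightarrow> int \<Rightarrow> ('v set \<Rightarrow>\<^sub>0 'k::field) set monoid" where
  "reduced_homology_group r \<Delta> i =
     subgroup_generated (simplicial_chain_group \<Delta> i) (simplicial_cycles r \<Delta> i)
       Mod simplicial_boundaries r \<Delta> i"

definition order_complex :: "'a set \<Rightarrow> 'a rel \<Rightarrow> 'a set set" where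
  "order_complex P r = {C. finite C \<and> C \<subseteq> P \<and> C \<in> Chains r}"

definition link :: "'v set set \<Rightarrow> 'v set \<Rightarrow> 'v set set" where
  "link \<Delta> \<sigma> = {\<tau> \<in> \<Delta>. \<tau> \<inter> \<sigma> = {} \<and> \<tau> \<union> \<sigma> \<in> \<Delta>}"

text \<open>The dimension of the complex that only has the empty face is \<open>-1\<close>.\<close>
definition complex_dim :: "'v set set \<Rightarrow> int" where
  "complex_dim \<Delta> = Max ((\<lambda>\<sigma>. int (card \<sigma>) - 1) ` \<Delta>)"

definition finite_length_poset :: "'a set \<Rightarrow> 'a rel \<Rightarrow> bool" where
  "finite_length_poset P r \<longleftrightarrow>
     partial_order_on P r \<and> (\<exists>n. \<forall>C\<in>order_complex P r. card C \<le> n)"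

definition cohen_macaulay :: "'k::field itself \<Rightarrow> 'a set \<Rightarrow> 'a rel \<Rightarrow> bool" where
  "cohen_macaulay _ P r \<longleftrightarrow> finite_length_poset P r \<and>
     (\<forall>\<sigma>\<in>order_complex P r. \<forall>i. i < complex_dim (link (order_complex P r) \<sigma>) \<longrightarrow>
        trivial_group
          (reduced_homology_group r (link (order_complex P r) \<sigma>) i :: ('a set \<Rightarrow>\<^sub>0 'k) set monoid))"

lemma (in translative_G_semimatroid) pointwise_eq_setwise_stabilizer:
  assumes "X \<in> K"
  shows "pointwise_stabilizer G \<phi> X = stabilizer G (set_action \<phi>) X"
proof
  show "pointwise_stabilizer G \<phi> X \<subseteq> stabilizer G (set_action \<phi>) X"
    by (force simp: pointwise_stabilizer_def stabilizer_def)
next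
  show "stabilizer G (set_action \<phi>) X \<subseteq> pointwise_stabilizer G \<phi> X"
  proof
    fix g assume "g \<in> stabilizer G (set_action \<phi>) X"
    then have g: "g \<in> carrier G" and gX: "\<phi> g ` X = X"
      by (auto simp: stabilizer_def)
    have "\<phi> g s = s" if "s \<in> X" for s
    proof (rule translative[OF _ g])
      show "s \<in> S"
        using that assms complex by (auto simp: simplicial_complex_def)
      have "{s, \<phi> g s} \<subseteq> X"
        using that gX by auto
      then show "{s, \<phi> g s} \<in> K"
        using assms complex by (auto simp: simplicial_complex_def)
    qed
    then show "g \<in> pointwise_stabilizer G \<phi> X"
      using g by (auto simp: pointwise_stabilizer_def stabilizer_def)
  qed
qed

lemma (in G_semimatroid) stabilizer_orbit_eq:
  assumes comm: "\<And>a b. a \<in> carrier G \<Longrightarrow> b \<in> carrier G \<Longrightarrow> a \<otimes> b = b \<otimes> a"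
    and s: "s \<in> S" and t: "t \<in> S" and st: "orbit G \<phi> s = orbit G \<phi> t"
  shows "stabilizer G \<phi> s \<subseteq> stabilizer G \<phi> t"
proof
  fix g assume "g \<in> stabilizer G \<phi> s"
  then have g: "g \<in> carrier G" and gs: "\<phi> g s = s"
    by (auto simp: stabilizer_def)
  have "t \<in> orbit G \<phi> s"
    unfolding st using t by (rule orbit_refl)
  then obtain h where h: "h \<in> carrier G" and t_eq: "t = \<phi> h s"
    by (auto simp: orbit_def)
  have "\<phi> g t = \<phi> (g \<otimes> h) s"
    using composition_rule[OF s g h] t_eq by simp
  also have "\<dots> = \<phi> (h \<otimes> g) s"
    using comm[OF g h] by simp
  also have "\<dots> = t"
    using composition_rule[OF s h g] gs t_eq by simp
  finally show "g \<in> stabilizer G \<phi> t"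
    using g by (simp add: stabilizer_def)
qed

lemma (in G_semimatroid) pointwise_stabilizer_Supp:
  assumes comm: "\<And>a b. a \<in> carrier G \<Longrightarrow> b \<in> carrier G \<Longrightarrow> a \<otimes> b = b \<otimes> a"
    and "\<alpha> \<in> K" "\<beta> \<in> K" and supp: "Supp G \<phi> \<alpha> = Supp G \<phi> \<beta>"
  shows "pointwise_stabilizer G \<phi> \<alpha> \<subseteq> pointwise_stabilizer G \<phi> \<beta>"
proof
  fix g assume g: "g \<in> pointwise_stabilizer G \<phi> \<alpha>"
  have "g \<in> stabilizer G \<phi> t" if t: "t \<in> \<beta>" for t
  proof -
    have "orbit G \<phi> t \<in> orbit G \<phi> ` \<alpha>"
      using t supp by (auto simp: Supp_def)
    then obtain s where s: "s \<in> \<alpha>" "orbit G \<phi> s = orbit G \<phi> t"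
      by auto
    have "s \<in> S" "t \<in> S"
      using s t assms(2,3) complex by (auto simp: simplicial_complex_def)
    moreover have "g \<in> stabilizer G \<phi> s"
      using g s by (auto simp: pointwise_stabilizer_def)
    ultimately show ?thesis
      using stabilizer_orbit_eq[OF comm] s by blast
  qed
  then show "g \<in> pointwise_stabilizer G \<phi> \<beta>"
    using g by (auto simp: pointwise_stabilizer_def)
qed

lemma (in refined_G_semimatroid) refined_comm:
  assumes "a \<in> carrier G" "b \<in> carrier G"
  shows "a \<otimes> b = b \<otimes> a"
proof -
  obtain B :: "'a set" where "G \<cong> free_Abelian_group B"
    using free by (auto simp: free_abelian_def)
  moreover have "group G"
    using group_hom by (simp add: group_hom_def)
  ultimately have "comm_group G"
    by (meson abelian_free_Abelian_group group.iso_sym comm_group.iso_imp_comm_group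
        group.is_monoid)
  then show ?thesis
    using assms by (simp add: comm_group_def comm_monoid.m_comm)
qed

lemma (in refined_G_semimatroid) support_stabilizer_eq:
  assumes "\<alpha> \<in> K"
  shows "support_stabilizer G K \<phi> (Supp G \<phi> \<alpha>) = pointwise_stabilizer G \<phi> \<alpha>"
proof -
  define \<beta> where "\<beta> = (SOME \<beta>. \<beta> \<in> K \<and> Supp G \<phi> \<beta> = Supp G \<phi> \<alpha>)"
  have \<beta>: "\<beta> \<in> K \<and> Supp G \<phi> \<beta> = Supp G \<phi> \<alpha>"
    unfolding \<beta>_def by (rule someI[where x = \<alpha>]) (simp add: assms)
  have "pointwise_stabilizer G \<phi> \<beta> = pointwise_stabilizer G \<phi> \<alpha>"
    using pointwise_stabilizer_Supp[OF refined_comm] \<beta> assms by (metis subset_antisym)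
  then show ?thesis
    by (simp add: support_stabilizer_def \<beta>_def)
qed

end

theory Submission
  imports Defs "HOL-Algebra.Sylow" "HOL-Algebra.Multiplicative_Group"
begin

text \<open>
  Translativity makes every orbit of independent sets a Boolean cell whose vertices carry distinct
  labels, namely the orbits of elements, and the sets of labels that occur are the independent sets
  of a matroid: an independent set stays independent when an element is replaced by a translate.
  For cells \<open>x\<close> and \<open>y\<close> with label sets \<open>X\<close> and \<open>Y\<close> that share a face with
  label set \<open>X \<inter> Y\<close>, the cells with label set \<open>X \<union> Y\<close> above both are in bijection with
  \<open>stab (X \<inter> Y) / (stab X + stab Y)\<close>. Their number depends only on the labels, and \<open>\<delta>(X \<union> Y)\<close>
  annihilates this finite group, so the number is invertible in the field.

  Acyclicity of the cells above \<open>p\<close> is shown by induction on the available labels. Choose a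
  label \<open>e\<close> of an atom. Cells containing \<open>e\<close> properly above such an atom can be pushed down
  along \<open>x \<mapsto> x - e\<close>, so it remains to glue in the atoms labelled \<open>e\<close> along their links,
  which are acyclic by induction. If \<open>e\<close> is not a coloop, the deletion of \<open>e\<close> is acyclic by
  induction as well. If it is a coloop, every cycle of the deletion bounds: take the cone over the
  deletion and lift its chains by averaging over the joins, which uses invertibility.
  A link of a chain is the join of such an upper part with boundaries of simplices.
\<close>

subsection \<open>Simplicial homology of order complexes\<close>

text \<open>Two cells may have several joins, so there need not be an order preserving way to add
  the label e to the cells of the deletion, which would let one cone them off directly. The average
  over all joins replaces such a choice. It commutes with boundaries only if the weights fit
  together when a chain is extended, and this is the multiplicativity of join numbers in
  \<open>card_joins_mult\<close>. If e is a coloop, the deletion has rank one less, so its own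
  acyclicity misses exactly the top degree that is needed. This is why \<open>bounds A B n\<close>
  lets the filling of a cycle of \<open>A\<close> leave \<open>A\<close>. Gluing is done one vertex
  at a time with explicit fillings, so no exact sequences occur.\<close>

lemma order_complex_subset:
  assumes "\<sigma> \<in> order_complex A r" "\<tau> \<subseteq> \<sigma>"
  shows "\<tau> \<in> order_complex A r"
  using assms unfolding order_complex_def Chains_def by (auto intro: finite_subset)

lemma order_complex_mono: "A \<subseteq> B \<Longrightarrow> order_complex A r \<subseteq> order_complex B r"
  unfolding order_complex_def by auto

lemma order_complex_iff:
  "\<sigma> \<in> order_complex A r \<longleftrightarrow>
     finite \<sigma> \<and> \<sigma> \<subseteq> A \<and> (\<forall>x\<in>\<sigma>. \<forall>y\<in>\<sigma>. (x, y) \<in> r \<or> (y, x) \<in> r)"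
  by (auto simp: order_complex_def Chains_def)

section \<open>Oriented chains on the order complex of a finite poset\<close>

locale finite_order =
  fixes V :: "'a set" and r :: "'a rel" and F :: "'k::field itself"
  assumes finite_V: "finite V" and po: "partial_order_on V r"
begin

lemma refl: "x \<in> V \<Longrightarrow> (x, x) \<in> r"
  using po by (auto simp: partial_order_on_def preorder_on_def refl_on_def)

lemma antisym: "(x, y) \<in> r \<Longrightarrow> (y, x) \<in> r \<Longrightarrow> x = y"
  using po by (auto simp: partial_order_on_def antisym_def)

lemma trans: "(x, y) \<in> r \<Longrightarrow> (y, z) \<in> r \<Longrightarrow> (x, z) \<in> r"
  using po by (meson partial_order_on_def preorder_on_def transE)

abbreviation comparable :: "'a \<Rightarrow> 'a \<Rightarrow> bool" where
  "comparable x y \<equiv> (x, y) \<in> r \<or> (y, x) \<in> r"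

text \<open>The incidence sign of \<tau> in \<open>insert v \<tau>\<close>, computed at the smaller
  face. It is meant for v outside \<tau>, since otherwise v counts itself.\<close>

definition pos_sign :: "'a set \<Rightarrow> 'a \<Rightarrow> 'k" where
  "pos_sign \<tau> v = (-1) ^ card {u \<in> \<tau>. (u, v) \<in> r}"

text \<open>Chains are total functions; finite support is automatic for simplices in the finite set
  \<open>V\<close>. The index counts vertices, so \<open>n\<close> is degree n - 1 and
  \<open>n = 0\<close> the augmentation degree.\<close>

definition chain_on :: "'a set \<Rightarrow> nat \<Rightarrow> ('a set \<Rightarrow> 'k) \<Rightarrow> bool" where
  "chain_on A n c \<longleftrightarrow> (\<forall>\<sigma>. c \<sigma> \<noteq> 0 \<longrightarrow> \<sigma> \<in> order_complex A r \<and> card \<sigma> = n)"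

text \<open>The coefficient of the boundary at \<tau>, gathered from its cofaces. This form needs no
  basis and makes linearity immediate.\<close>

definition bd :: "('a set \<Rightarrow> 'k) \<Rightarrow> 'a set \<Rightarrow> 'k" where
  "bd c \<tau> = (\<Sum>v\<in>V - \<tau>. pos_sign \<tau> v * c (insert v \<tau>))"

text \<open>For \<open>A \<subseteq> B\<close>: the inclusion is zero on reduced homology in degree
  n - 1.\<close>

definition bounds :: "'a set \<Rightarrow> 'a set \<Rightarrow> nat \<Rightarrow> bool" where
  "bounds A B n \<longleftrightarrow>
     (\<forall>z. chain_on A n z \<and> (\<forall>\<tau>. bd z \<tau> = 0) \<longrightarrow> (\<exists>y. chain_on B (Suc n) y \<and> (\<forall>\<tau>. bd y \<tau> = z \<tau>)))"

text \<open>In homological degrees the vanishing range is below d - 1.\<close>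

definition acyclic_below :: "'a set \<Rightarrow> nat \<Rightarrow> bool" where
  "acyclic_below A d \<longleftrightarrow> (\<forall>n<d. bounds A A n)"

text \<open>The sign is chosen so that the boundary of a cone is \<open>u\<close> minus the cone
  over the boundary of \<open>u\<close>, see \<open>bd_cone\<close>.\<close>

definition cone :: "'a \<Rightarrow> ('a set \<Rightarrow> 'k) \<Rightarrow> 'a set \<Rightarrow> 'k" where
  "cone x u \<sigma> = (if x \<in> \<sigma> then pos_sign (\<sigma> - {x}) x * u (\<sigma> - {x}) else 0)"

lemma chain_onD: "chain_on A n c \<Longrightarrow> c \<sigma> \<noteq> 0 \<Longrightarrow> \<sigma> \<in> order_complex A r \<and> card \<sigma> = n"
  unfolding chain_on_def by blast

lemma chain_on_mono: "chain_on A n c \<Longrightarrow> A \<subseteq> B \<Longrightarrow> chain_on B n c"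
  using order_complex_mono unfolding chain_on_def by blast

lemma bounds_mono: "bounds A B n \<Longrightarrow> A' \<subseteq> A \<Longrightarrow> B \<subseteq> B' \<Longrightarrow> bounds A' B' n"
  unfolding bounds_def using chain_on_mono by blast

lemma acyclic_below_mono: "acyclic_below A d \<Longrightarrow> d' \<le> d \<Longrightarrow> acyclic_below A d'"
  unfolding acyclic_below_def by auto

lemma pos_sign_square [simp]: "pos_sign \<tau> v * pos_sign \<tau> v = 1"
  by (simp add: pos_sign_def flip: power_add mult_2)

lemma pos_sign_insert:
  assumes "finite \<tau>" "x \<notin> \<tau>"
  shows "pos_sign (insert x \<tau>) v = (if (x, v) \<in> r then - pos_sign \<tau> v else pos_sign \<tau> v)"
proof -
  have "{u \<in> insert x \<tau>. (u, v) \<in> r} =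
    (if (x, v) \<in> r then insert x {u \<in> \<tau>. (u, v) \<in> r} else {u \<in> \<tau>. (u, v) \<in> r})"
    by auto
  then show ?thesis
    using assms by (simp add: pos_sign_def)
qed

text \<open>By antisymmetry exactly one of x and v precedes the other, so exactly one of the two
  insertions flips a sign.\<close>

lemma pos_sign_swap:
  assumes "finite \<tau>" "x \<notin> \<tau>" "v \<notin> \<tau>" "x \<noteq> v" "comparable x v"
  shows "pos_sign \<tau> v * pos_sign (insert v \<tau>) x = - (pos_sign \<tau> x * pos_sign (insert x \<tau>) v)"
  using assms antisym[of x v] by (auto simp: pos_sign_insert)

lemma pos_sign_swap':
  assumes "finite \<tau>" "x \<notin> \<tau>" "v \<notin> \<tau>" "x \<noteq> v" "comparable x v"
  shows "pos_sign (insert x \<tau>) v * pos_sign (insert v \<tau>) x = - (pos_sign \<tau> x * pos_sign \<tau> v)"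
  using assms antisym[of x v] by (auto simp: pos_sign_insert)

lemma bd_add: "bd (\<lambda>\<sigma>. c \<sigma> + d \<sigma>) \<tau> = bd c \<tau> + bd d \<tau>"
  by (simp add: bd_def algebra_simps sum.distrib)

lemma bd_diff: "bd (\<lambda>\<sigma>. c \<sigma> - d \<sigma>) \<tau> = bd c \<tau> - bd d \<tau>"
  by (simp add: bd_def algebra_simps sum_subtractf)

lemma bd_bd:
  assumes c: "chain_on A n c" and \<tau>: "finite \<tau>"
  shows "bd (bd c) \<tau> = 0"
proof -
  let ?t = "\<lambda>v w. pos_sign \<tau> v * pos_sign (insert v \<tau>) w * c (insert w (insert v \<tau>))"
  let ?W = "V - \<tau>"
  \<comment> \<open>A pair (v, w) adds first v, then w. Pairs with incomparable entries lie in no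
    simplex; those in \<open>?L\<close> cancel against their swaps in \<open>?R\<close>.\<close>
  let ?L = "{(v, w) \<in> ?W \<times> ?W. v \<noteq> w \<and> (v, w) \<in> r}"
  let ?R = "{(v, w) \<in> ?W \<times> ?W. v \<noteq> w \<and> (w, v) \<in> r}"
  let ?N = "{(v, w) \<in> ?W \<times> ?W. v \<noteq> w}"
  have fin: "finite (?W \<times> ?W)"
    using finite_V by simp
  have "bd (bd c) \<tau> = (\<Sum>v\<in>?W. \<Sum>w\<in>V - insert v \<tau>. ?t v w)"
    by (simp add: bd_def sum_distrib_left mult.assoc)
  also have "\<dots> = (\<Sum>(v, w)\<in>Sigma ?W (\<lambda>v. V - insert v \<tau>). ?t v w)"
    using finite_V by (subst sum.Sigma) auto
  also have "Sigma ?W (\<lambda>v. V - insert v \<tau>) = ?N"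
    by auto
  also have "(\<Sum>(v, w)\<in>?N. ?t v w) = (\<Sum>(v, w)\<in>?L \<union> ?R. ?t v w)"
  proof (rule sum.mono_neutral_right)
    show "finite ?N"
      by (rule finite_subset[OF _ fin]) auto
    show "\<forall>i\<in>?N - (?L \<union> ?R). (case i of (v, w) \<Rightarrow> ?t v w) = 0"
    proof
      fix i assume i: "i \<in> ?N - (?L \<union> ?R)"
      obtain v w where vw: "i = (v, w)"
        by force
      then have "\<not> comparable v w"
        using i by auto
      then have "c (insert w (insert v \<tau>)) = 0"
        using chain_onD[OF c, of "insert w (insert v \<tau>)"] by (auto simp: order_complex_iff)
      then show "(case i of (v, w) \<Rightarrow> ?t v w) = 0"
        by (simp add: vw)
    qed
  qed auto
  also have "\<dots> = (\<Sum>(v, w)\<in>?L. ?t v w) + (\<Sum>(v, w)\<in>?R. ?t v w)"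
  proof (rule sum.union_disjoint)
    show "finite ?L"
      by (rule finite_subset[OF _ fin]) auto
    show "finite ?R"
      by (rule finite_subset[OF _ fin]) auto
  qed (use antisym in auto)
  also have "(\<Sum>(v, w)\<in>?R. ?t v w) = (\<Sum>(v, w)\<in>?L. ?t w v)"
    by (rule sum.reindex_bij_witness[where i = prod.swap and j = prod.swap]) auto
  also have "\<dots> = (\<Sum>(v, w)\<in>?L. - ?t v w)"
  proof (rule sum.cong)
    fix p assume "p \<in> ?L"
    then obtain v w where p: "p = (v, w)" "v \<in> V" "w \<in> V" "v \<notin> \<tau>" "w \<notin> \<tau>" "v \<noteq> w" "(v, w) \<in> r"
      by auto
    then have "pos_sign \<tau> w * pos_sign (insert w \<tau>) v = - (pos_sign \<tau> v * pos_sign (insert v \<tau>) w)"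
      using \<tau> by (intro pos_sign_swap) auto
    then show "(case p of (v, w) \<Rightarrow> ?t w v) = (case p of (v, w) \<Rightarrow> - ?t v w)"
      using p by (simp add: insert_commute)
  qed simp
  finally show ?thesis
    by (simp add: sum_negf case_prod_unfold)
qed

lemma bd_cone:
  assumes u: "chain_on A n u" and x: "x \<in> V" "x \<notin> A" and cmp: "\<And>a. a \<in> A \<Longrightarrow> comparable a x"
    and AV: "A \<subseteq> V"
  shows "bd (cone x u) \<tau> = (if x \<in> \<tau> then - (pos_sign (\<tau> - {x}) x * bd u (\<tau> - {x})) else u \<tau>)"
proof (cases "x \<in> \<tau>")
  case False
  have "bd (cone x u) \<tau> = (\<Sum>v\<in>{x}. pos_sign \<tau> v * cone x u (insert v \<tau>))"
    unfolding bd_def using finite_V False x(1) by (intro sum.mono_neutral_right) (auto simp: cone_def)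
  also have "\<dots> = u \<tau>"
    using False by (simp add: cone_def flip: mult.assoc)
  finally show ?thesis
    using False by simp
next
  case True
  define \<rho> where "\<rho> = \<tau> - {x}"
  have \<tau>: "\<tau> = insert x \<rho>" "x \<notin> \<rho>"
    using True by (auto simp: \<rho>_def)
  \<comment> \<open>The sum over \<open>V - \<rho>\<close> has one more vertex than the sum over
    \<open>V - \<tau>\<close>, namely x, and its term vanishes.\<close>
  have x0: "u (insert x \<rho>) = 0"
    using chain_onD[OF u, of "insert x \<rho>"] x(2) by (auto simp: order_complex_iff)
  have "bd (cone x u) \<tau> = (\<Sum>v\<in>V - \<tau>. - (pos_sign \<rho> x * (pos_sign \<rho> v * u (insert v \<rho>))))"
    unfolding bd_def
  proof (rule sum.cong)
    fix v assume v: "v \<in> V - \<tau>"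
    then have vx: "insert v \<tau> - {x} = insert v \<rho>" "v \<noteq> x" "v \<notin> \<rho>"
      using \<tau> by auto
    show "pos_sign \<tau> v * cone x u (insert v \<tau>) = - (pos_sign \<rho> x * (pos_sign \<rho> v * u (insert v \<rho>)))"
    proof (cases "u (insert v \<rho>) = 0")
      case False
      then have "insert v \<rho> \<in> order_complex A r"
        using chain_onD[OF u] by blast
      then have "v \<in> A" "finite \<rho>"
        by (auto simp: order_complex_iff)
      then have "pos_sign (insert x \<rho>) v * pos_sign (insert v \<rho>) x = - (pos_sign \<rho> x * pos_sign \<rho> v)"
        using vx \<tau> cmp[of v] by (intro pos_sign_swap') auto
      then show ?thesis
        using True vx \<tau> by (simp add: cone_def flip: mult.assoc)
    qed (use True vx in \<open>simp add: cone_def\<close>)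
  qed simp
  also have "\<dots> = - (pos_sign \<rho> x * (\<Sum>v\<in>V - \<tau>. pos_sign \<rho> v * u (insert v \<rho>)))"
    by (simp add: sum_negf sum_distrib_left)
  also have "(\<Sum>v\<in>V - \<tau>. pos_sign \<rho> v * u (insert v \<rho>)) = bd u \<rho>"
    unfolding bd_def using finite_V \<tau> x0 by (intro sum.mono_neutral_left) auto
  finally show ?thesis
    using True by (simp add: \<rho>_def)
qed

lemma chain_on_cone:
  assumes u: "chain_on A n u" and x: "x \<in> V" "x \<notin> A" and cmp: "\<And>a. a \<in> A \<Longrightarrow> comparable a x"
    and B: "insert x A \<subseteq> B"
  shows "chain_on B (Suc n) (cone x u)"
  unfolding chain_on_def
proof (intro allI impI)
  fix \<sigma> assume "cone x u \<sigma> \<noteq> 0"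
  then have "x \<in> \<sigma>" "u (\<sigma> - {x}) \<noteq> 0"
    by (auto simp: cone_def split: if_splits)
  then have \<sigma>: "\<sigma> - {x} \<in> order_complex A r" "card (\<sigma> - {x}) = n" "x \<in> \<sigma>"
    using chain_onD[OF u] by auto
  then have "finite \<sigma>"
    by (simp add: order_complex_iff)
  moreover have "comparable a b" if "a \<in> \<sigma>" "b \<in> \<sigma>" for a b
  proof -
    have A: "c = x \<or> c \<in> \<sigma> - {x} \<and> c \<in> A" if "c \<in> \<sigma>" for c
      using \<sigma>(1) that by (auto simp: order_complex_iff)
    have "\<forall>c\<in>\<sigma> - {x}. \<forall>d\<in>\<sigma> - {x}. comparable c d"
      using \<sigma>(1) unfolding order_complex_iff by blast
    then show ?thesis
      using A[OF that(1)] A[OF that(2)] cmp refl[OF x(1)] by blast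
  qed
  moreover have "\<sigma> \<subseteq> B"
    using \<sigma>(1) B unfolding order_complex_iff by blast
  moreover have "card \<sigma> = Suc n"
    using card.remove[OF \<open>finite \<sigma>\<close> \<sigma>(3)] \<sigma>(2) by metis
  ultimately show "\<sigma> \<in> order_complex B r \<and> card \<sigma> = Suc n"
    unfolding order_complex_iff by blast
qed

section \<open>Filling cycles in cones and gluing in single vertices\<close>

lemma bd_remove:
  assumes x: "x \<in> V" "x \<notin> \<tau>"
  shows "bd (\<lambda>\<sigma>. if x \<in> \<sigma> then 0 else z \<sigma>) \<tau> = bd z \<tau> - pos_sign \<tau> x * z (insert x \<tau>)"
proof -
  have "bd z \<tau> = pos_sign \<tau> x * z (insert x \<tau>) + (\<Sum>v\<in>V - \<tau> - {x}. pos_sign \<tau> v * z (insert v \<tau>))"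
    unfolding bd_def using finite_V x by (subst sum.remove[of _ x]) auto
  moreover have "bd (\<lambda>\<sigma>. if x \<in> \<sigma> then 0 else z \<sigma>) \<tau> = (\<Sum>v\<in>V - \<tau> - {x}. pos_sign \<tau> v * z (insert v \<tau>))"
    unfolding bd_def using finite_V x by (intro sum.mono_neutral_cong_right) auto
  ultimately show ?thesis
    by simp
qed

text \<open>Split z into \<open>u\<close>, the part avoiding the apex t, and the part through t. As
  z is a cycle, the latter is minus the cone over the boundary of \<open>u\<close>, so the cone over
  \<open>u\<close> fills z.\<close>

lemma cone_bounds:
  assumes A: "A \<subseteq> V" and t: "t \<in> A" and cmp: "\<And>a. a \<in> A \<Longrightarrow> comparable a t"
  shows "bounds A A n"
  unfolding bounds_def
proof (intro allI impI, elim conjE)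
  fix z assume z: "chain_on A n z" and cyc: "\<forall>\<tau>. bd z \<tau> = 0"
  define u where "u = (\<lambda>\<sigma>. if t \<in> \<sigma> then 0 else z \<sigma>)"
  have u: "chain_on (A - {t}) n u"
    unfolding chain_on_def
  proof (intro allI impI)
    fix \<sigma> assume "u \<sigma> \<noteq> 0"
    then have "t \<notin> \<sigma>" "z \<sigma> \<noteq> 0"
      by (auto simp: u_def split: if_splits)
    then show "\<sigma> \<in> order_complex (A - {t}) r \<and> card \<sigma> = n"
      using chain_onD[OF z, of \<sigma>] by (auto simp: order_complex_iff)
  qed
  have tV: "t \<in> V"
    using A t by auto
  have "bd (cone t u) \<tau> = z \<tau>" for \<tau>
  proof -
    have "bd (cone t u) \<tau> = (if t \<in> \<tau> then - (pos_sign (\<tau> - {t}) t * bd u (\<tau> - {t})) else u \<tau>)"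
      using cmp A tV by (intro bd_cone[OF u]) auto
    moreover have "bd u (\<tau> - {t}) = - (pos_sign (\<tau> - {t}) t * z (insert t (\<tau> - {t})))"
      unfolding u_def using cyc by (subst bd_remove[OF tV]) auto
    ultimately show ?thesis
      by (auto simp: u_def insert_absorb simp flip: mult.assoc)
  qed
  moreover have "chain_on A (Suc n) (cone t u)"
    using cmp A tV t by (intro chain_on_cone[OF u]) auto
  ultimately show "\<exists>y. chain_on A (Suc n) y \<and> (\<forall>\<tau>. bd y \<tau> = z \<tau>)"
    by blast
qed

text \<open>A Mayer-Vietoris argument on chains. The part of z through x is the cone over a cycle
  \<open>w\<close> of the link; fill \<open>w\<close> by \<open>u\<close> in the link. Replacing
  that part by \<open>u\<close> gives a cycle \<open>z'\<close> in \<open>A\<close>, and a filling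
  of \<open>z'\<close> minus the cone over \<open>u\<close> fills z.\<close>

lemma add_vertex_bounds:
  assumes AB: "bounds A B n" and x: "x \<in> B" "x \<notin> A" and sub: "A \<subseteq> B" "B \<subseteq> V"
    and L: "\<And>m. n = Suc m \<Longrightarrow> bounds {a \<in> A. comparable a x} {a \<in> A. comparable a x} m"
  shows "bounds (insert x A) B n"
  unfolding bounds_def
proof (intro allI impI, elim conjE)
  fix z assume z: "chain_on (insert x A) n z" and cyc: "\<forall>\<tau>. bd z \<tau> = 0"
  let ?L = "{a \<in> A. comparable a x}"
  have xV: "x \<in> V"
    using x sub by auto
  define w where "w = (\<lambda>\<tau>. if x \<in> \<tau> then 0 else pos_sign \<tau> x * z (insert x \<tau>))"
  have wL: "\<tau> \<in> order_complex ?L r \<and> n = Suc (card \<tau>)" if "w \<tau> \<noteq> 0" for \<tau>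
  proof -
    have "x \<notin> \<tau>" "z (insert x \<tau>) \<noteq> 0"
      using that by (auto simp: w_def split: if_splits)
    then show ?thesis
      using chain_onD[OF z, of "insert x \<tau>"] by (auto simp: order_complex_iff)
  qed
  have bw: "bd w \<rho> = 0" for \<rho>
  proof (cases "x \<in> \<rho>")
    case True
    then show ?thesis
      by (simp add: bd_def w_def)
  next
    case False
    have "bd w \<rho> = (\<Sum>v\<in>V - insert x \<rho>. - (pos_sign \<rho> x * (pos_sign (insert x \<rho>) v * z (insert v (insert x \<rho>)))))"
      unfolding bd_def
    proof (rule sum.mono_neutral_cong_right)
      show "\<forall>v\<in>V - \<rho> - (V - insert x \<rho>). pos_sign \<rho> v * w (insert v \<rho>) = 0"
        by (auto simp: w_def)
      fix v assume v: "v \<in> V - insert x \<rho>"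
      show "pos_sign \<rho> v * w (insert v \<rho>) = - (pos_sign \<rho> x * (pos_sign (insert x \<rho>) v * z (insert v (insert x \<rho>))))"
      proof (cases "z (insert v (insert x \<rho>)) = 0")
        case True
        then show ?thesis
          by (simp add: w_def insert_commute)
      next
        case nz: False
        then have "insert v (insert x \<rho>) \<in> order_complex (insert x A) r"
          using chain_onD[OF z] by blast
        then have "finite \<rho>" "comparable x v"
          by (auto simp: order_complex_iff)
        then have "pos_sign \<rho> v * pos_sign (insert v \<rho>) x = - (pos_sign \<rho> x * pos_sign (insert x \<rho>) v)"
          using v False by (intro pos_sign_swap) auto
        then show ?thesis
          using v False by (auto simp add: w_def insert_commute simp flip: mult.assoc)
      qed
    qed (use finite_V in auto)
    also have "\<dots> = - (pos_sign \<rho> x * bd z (insert x \<rho>))"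
      by (simp add: bd_def sum_negf sum_distrib_left)
    finally show ?thesis
      using cyc by simp
  qed
  have "\<exists>u. chain_on ?L n u \<and> (\<forall>\<tau>. bd u \<tau> = w \<tau>)"
  \<comment> \<open>For \<open>n = 0\<close> the only simplex is the empty one, so nothing of z runs
    through x.\<close>
  proof (cases n)
    case 0
    then have "w \<tau> = 0" for \<tau>
      using wL by blast
    then show ?thesis
      by (intro exI[of _ "\<lambda>_. 0"]) (simp add: chain_on_def bd_def)
  next
    case (Suc m)
    have "chain_on ?L m w"
      unfolding chain_on_def using wL Suc by auto
    then show ?thesis
      using L[OF Suc] bw Suc unfolding bounds_def by blast
  qed
  then obtain u where u: "chain_on ?L n u" and bu: "\<And>\<tau>. bd u \<tau> = w \<tau>"
    by blast
  define z' where "z' = (\<lambda>\<sigma>. (if x \<in> \<sigma> then 0 else z \<sigma>) + u \<sigma>)"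
  have u0: "u \<sigma> = 0" if "x \<in> \<sigma>" for \<sigma>
    using chain_onD[OF u, of \<sigma>] that x by (auto simp: order_complex_iff)
  have z': "chain_on A n z'"
    unfolding chain_on_def
  proof (intro allI impI)
    fix \<sigma> assume "z' \<sigma> \<noteq> 0"
    then consider "x \<notin> \<sigma>" "z \<sigma> \<noteq> 0" | "u \<sigma> \<noteq> 0"
      unfolding z'_def by (cases "u \<sigma> = 0") (auto split: if_splits)
    then show "\<sigma> \<in> order_complex A r \<and> card \<sigma> = n"
    proof cases
      case 1
      then show ?thesis
        using chain_onD[OF z, of \<sigma>] by (auto simp: order_complex_iff)
    next
      case 2
      then show ?thesis
        using chain_onD[OF u, of \<sigma>] by (auto simp: order_complex_iff)
    qed
  qed
  have "bd z' \<tau> = 0" for \<tau>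
  proof (cases "x \<in> \<tau>")
    case True
    then show ?thesis
      by (simp add: bd_def z'_def u0)
  next
    case False
    have "bd z' \<tau> = bd (\<lambda>\<sigma>. if x \<in> \<sigma> then 0 else z \<sigma>) \<tau> + bd u \<tau>"
      unfolding z'_def by (rule bd_add)
    also have "\<dots> = (bd z \<tau> - pos_sign \<tau> x * z (insert x \<tau>)) + w \<tau>"
      unfolding bu using bd_remove[OF xV False] by simp
    finally show ?thesis
      using cyc False by (simp add: w_def)
  qed
  then obtain y where y: "chain_on B (Suc n) y" and bdy: "\<And>\<tau>. bd y \<tau> = z' \<tau>"
    using AB z' unfolding bounds_def by blast
  have cu: "chain_on B (Suc n) (cone x u)"
    using x sub xV by (intro chain_on_cone[OF u]) auto
  have "bd (\<lambda>\<sigma>. y \<sigma> - cone x u \<sigma>) \<tau> = z \<tau>" for \<tau>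
  proof -
    have "bd (cone x u) \<tau> = (if x \<in> \<tau> then - (pos_sign (\<tau> - {x}) x * bd u (\<tau> - {x})) else u \<tau>)"
      using x sub xV by (intro bd_cone[OF u]) auto
    then show ?thesis
      unfolding bd_diff bdy bu by (auto simp: z'_def u0 w_def insert_absorb simp flip: mult.assoc)
  qed
  moreover have "chain_on B (Suc n) (\<lambda>\<sigma>. y \<sigma> - cone x u \<sigma>)"
    using chain_onD[OF y] chain_onD[OF cu] unfolding chain_on_def by (metis diff_self)
  ultimately show "\<exists>y. chain_on B (Suc n) y \<and> (\<forall>\<tau>. bd y \<tau> = z \<tau>)"
    by blast
qed

text \<open>Incomparable new vertices do not enter each other's links, so each link is the one in
  \<open>A\<close> whatever the order of gluing.\<close>

lemma add_vertices_bounds: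
  assumes "finite X" and "bounds A B n" and "X \<inter> A = {}" "A \<union> X \<subseteq> B" "B \<subseteq> V"
    and "\<And>x y. x \<in> X \<Longrightarrow> y \<in> X \<Longrightarrow> x \<noteq> y \<Longrightarrow> \<not> comparable x y"
    and "\<And>x m. x \<in> X \<Longrightarrow> n = Suc m \<Longrightarrow> bounds {a \<in> A. comparable a x} {a \<in> A. comparable a x} m"
  shows "bounds (A \<union> X) B n"
  using assms
proof (induction X rule: finite_induct)
  case (insert x X)
  have IH: "bounds (A \<union> X) B n"
    using insert.prems by (intro insert.IH) auto
  have eq: "{a \<in> A \<union> X. comparable a x} = {a \<in> A. comparable a x}"
    using insert.hyps insert.prems(5) by fastforce
  have "bounds (insert x (A \<union> X)) B n"
  proof (rule add_vertex_bounds[OF IH])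
    show "bounds {a \<in> A \<union> X. comparable a x} {a \<in> A \<union> X. comparable a x} m" if "n = Suc m" for m
      unfolding eq using insert.prems(6) that by blast
  qed (use insert in auto)
  then show ?case
    by simp
qed simp

text \<open>The vertices of \<open>U\<close> are glued in by decreasing \<open>key\<close>, the
  minimum last. At that moment the link of x is a cone with apex \<open>f x\<close>, so gluing is
  harmless. Taking a cardinality or its negative as \<open>key\<close> decides whether large or
  small cells come first.\<close>

lemma retract_bounds:
  fixes key :: "'a \<Rightarrow> int"
  assumes "finite U" and Q: "bounds Q B n" and "Q \<inter> U = {}" "Q \<union> U \<subseteq> B" "B \<subseteq> V"
    and "\<And>x. x \<in> U \<Longrightarrow> f x \<in> Q \<and> comparable (f x) x"
    and "\<And>x y. x \<in> U \<Longrightarrow> y \<in> Q \<Longrightarrow> comparable y x \<Longrightarrow> comparable y (f x)"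
    and "\<And>x y. x \<in> U \<Longrightarrow> y \<in> U \<Longrightarrow> x \<noteq> y \<Longrightarrow> comparable y x \<Longrightarrow> key x \<le> key y \<Longrightarrow> comparable y (f x)"
  shows "bounds (Q \<union> U) B n"
  using assms(1,3-)
proof (induction "card U" arbitrary: U)
  case 0
  then show ?case
    using Q by simp
next
  case (Suc k)
  then have "U \<noteq> {}" "finite U"
    by auto
  then obtain x where x: "x \<in> U" "\<And>y. y \<in> U \<Longrightarrow> key x \<le> key y"
    using ex_min_if_finite[of "key ` U"] by (metis (no_types, lifting) Suc.prems(1) arg_min_if_finite(1) arg_min_least)
  have U: "U = insert x (U - {x})"
    using x by auto
  have IH: "bounds (Q \<union> (U - {x})) B n"
    using Suc x by (intro Suc.hyps) auto
  let ?L = "{a \<in> Q \<union> (U - {x}). comparable a x}"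
  have fx: "f x \<in> ?L"
    using Suc.prems(5)[of x] x by auto
  have "bounds (insert x (Q \<union> (U - {x}))) B n"
  proof (rule add_vertex_bounds[OF IH])
    show "bounds ?L ?L m" for m
    proof (rule cone_bounds[OF _ fx])
      show "?L \<subseteq> V"
        using Suc.prems by auto
      fix a assume "a \<in> ?L"
      then show "comparable a (f x)"
        using Suc.prems(6)[OF x(1), of a] Suc.prems(7)[OF x(1), of a] x(2) by auto
    qed
  qed (use Suc.prems x in auto)
  then show ?case
    using U by (metis Un_insert_right)
qed

end

subsection \<open>Transfer along weighted order maps\<close>

text \<open>Chains are pulled back along \<open>p\<close>, as in the transfer of a covering. Strict
  monotonicity keeps the size and orientation of simplices. By the weight condition the lifts of a
  coface share out the weight of the given face, which makes the pullback commute with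
  boundaries.\<close>

locale order_transfer = L: finite_order V\<^sub>1 r\<^sub>1 F + R: finite_order V\<^sub>2 r\<^sub>2 F
  for V\<^sub>1 :: "'a set" and r\<^sub>1 and V\<^sub>2 :: "'b set" and r\<^sub>2 and F :: "'k::field itself" +
  fixes A :: "'a set" and B :: "'b set" and p :: "'a \<Rightarrow> 'b" and w :: "'a set \<Rightarrow> 'k"
  assumes subs: "A \<subseteq> V\<^sub>1" "B \<subseteq> V\<^sub>2" and maps: "p ` A \<subseteq> B"
    and mono: "a \<in> A \<Longrightarrow> a' \<in> A \<Longrightarrow> a \<noteq> a' \<Longrightarrow> (a, a') \<in> r\<^sub>1 \<Longrightarrow> (p a, p a') \<in> r\<^sub>2 \<and> p a \<noteq> p a'"
    and weights: "\<tau> \<in> order_complex A r\<^sub>1 \<Longrightarrow> b \<in> B \<Longrightarrow> b \<notin> p ` \<tau> \<Longrightarrow>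
      insert b (p ` \<tau>) \<in> order_complex B r\<^sub>2 \<Longrightarrow>
      (\<Sum>u\<in>{u \<in> A. p u = b \<and> insert u \<tau> \<in> order_complex A r\<^sub>1}. w (insert u \<tau>)) = w \<tau>"
begin

definition lift :: "('b set \<Rightarrow> 'k) \<Rightarrow> 'a set \<Rightarrow> 'k" where
  "lift c \<sigma> = (if \<sigma> \<in> order_complex A r\<^sub>1 then w \<sigma> * c (p ` \<sigma>) else 0)"

lemma inj_on_simplex: "\<sigma> \<in> order_complex A r\<^sub>1 \<Longrightarrow> inj_on p \<sigma>"
  unfolding inj_on_def order_complex_iff by (metis mono subsetD)

lemma sign_lift:
  assumes "insert u \<tau> \<in> order_complex A r\<^sub>1" "u \<notin> \<tau>"
  shows "R.pos_sign (p ` \<tau>) (p u) = L.pos_sign \<tau> u"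
proof -
  have s: "insert u \<tau> \<subseteq> A" "\<And>x. x \<in> \<tau> \<Longrightarrow> (x, u) \<in> r\<^sub>1 \<or> (u, x) \<in> r\<^sub>1"
    using assms by (auto simp: order_complex_iff)
  have "{v \<in> p ` \<tau>. (v, p u) \<in> r\<^sub>2} = p ` {v \<in> \<tau>. (v, u) \<in> r\<^sub>1}"
  proof (intro equalityI subsetI)
    fix y assume "y \<in> {v \<in> p ` \<tau>. (v, p u) \<in> r\<^sub>2}"
    then obtain v where v: "v \<in> \<tau>" "y = p v" "(p v, p u) \<in> r\<^sub>2"
      by auto
    have "(u, v) \<notin> r\<^sub>1"
      using v s assms(2) mono[of u v] R.antisym by blast
    then show "y \<in> p ` {v \<in> \<tau>. (v, u) \<in> r\<^sub>1}"
      using v s by blast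
  next
    fix y assume "y \<in> p ` {v \<in> \<tau>. (v, u) \<in> r\<^sub>1}"
    then show "y \<in> {v \<in> p ` \<tau>. (v, p u) \<in> r\<^sub>2}"
      using s assms(2) mono[of _ u] by blast
  qed
  moreover have "inj_on p {v \<in> \<tau>. (v, u) \<in> r\<^sub>1}"
    by (rule inj_on_subset[OF inj_on_simplex[OF assms(1)]]) auto
  ultimately show ?thesis
    by (simp add: R.pos_sign_def L.pos_sign_def card_image)
qed

lemma bd_lift:
  assumes c: "R.chain_on B n c"
  shows "L.bd (lift c) \<tau> = lift (R.bd c) \<tau>"
proof (cases "\<tau> \<in> order_complex A r\<^sub>1")
  case False
  then have "lift c (insert v \<tau>) = 0" for v
    using order_complex_subset[of "insert v \<tau>" A r\<^sub>1 \<tau>] by (auto simp: lift_def)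
  then show ?thesis
    using False by (simp add: L.bd_def lift_def)
next
  case True
  let ?U = "{u \<in> A. u \<notin> \<tau> \<and> insert u \<tau> \<in> order_complex A r\<^sub>1}"
  let ?f = "\<lambda>b. R.pos_sign (p ` \<tau>) b * c (insert b (p ` \<tau>))"
  have finU: "finite ?U"
    using L.finite_V subs by (auto intro: finite_subset)
  have pU: "p ` ?U \<subseteq> V\<^sub>2 - p ` \<tau>"
  proof
    fix b assume "b \<in> p ` ?U"
    then obtain u where u: "u \<in> ?U" "b = p u"
      by blast
    then have "p u \<notin> p ` \<tau>"
      using inj_on_simplex[of "insert u \<tau>"] by (auto simp: inj_on_def)
    then show "b \<in> V\<^sub>2 - p ` \<tau>"
      using u subs maps by auto
  qed
  have "L.bd (lift c) \<tau> = (\<Sum>u\<in>?U. L.pos_sign \<tau> u * lift c (insert u \<tau>))"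
    unfolding L.bd_def using L.finite_V subs
    by (intro sum.mono_neutral_right) (auto simp: lift_def order_complex_iff)
  also have "\<dots> = (\<Sum>u\<in>?U. w (insert u \<tau>) * ?f (p u))"
    by (intro sum.cong) (auto simp: lift_def sign_lift)
  \<comment> \<open>Group the cofaces of \<tau> by the image of the new vertex; each group is one
    instance of \<open>weights\<close>.\<close>
  also have "\<dots> = (\<Sum>b\<in>V\<^sub>2 - p ` \<tau>. \<Sum>u\<in>{u \<in> ?U. p u = b}. w (insert u \<tau>) * ?f (p u))"
    using sum.group[OF finU _ pU, of "\<lambda>u. w (insert u \<tau>) * ?f (p u)"] R.finite_V by simp
  also have "\<dots> = (\<Sum>b\<in>V\<^sub>2 - p ` \<tau>. w \<tau> * ?f b)"
  proof (rule sum.cong)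
    fix b assume b: "b \<in> V\<^sub>2 - p ` \<tau>"
    have "(\<Sum>u\<in>{u \<in> ?U. p u = b}. w (insert u \<tau>) * ?f (p u)) = (\<Sum>u\<in>{u \<in> ?U. p u = b}. w (insert u \<tau>)) * ?f b"
      by (simp add: sum_distrib_right)
    also have "\<dots> = w \<tau> * ?f b"
    proof (cases "c (insert b (p ` \<tau>)) = 0")
      case False
      then have s: "insert b (p ` \<tau>) \<in> order_complex B r\<^sub>2"
        using R.chain_onD[OF c] by blast
      have "{u \<in> ?U. p u = b} = {u \<in> A. p u = b \<and> insert u \<tau> \<in> order_complex A r\<^sub>1}"
        using b by auto
      moreover have "b \<in> B"
        using s by (simp add: order_complex_iff)
      ultimately show ?thesis
        using weights[OF True _ _ s] b by simp
    qed simp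
    finally show "(\<Sum>u\<in>{u \<in> ?U. p u = b}. w (insert u \<tau>) * ?f (p u)) = w \<tau> * ?f b" .
  qed simp
  also have "\<dots> = lift (R.bd c) \<tau>"
    using True by (simp add: lift_def R.bd_def sum_distrib_left)
  finally show ?thesis .
qed

lemma chain_on_lift:
  assumes "R.chain_on B n c"
  shows "L.chain_on A n (lift c)"
  unfolding L.chain_on_def
proof (intro allI impI)
  fix \<sigma> assume "lift c \<sigma> \<noteq> 0"
  then have "\<sigma> \<in> order_complex A r\<^sub>1" "c (p ` \<sigma>) \<noteq> 0"
    by (auto simp: lift_def split: if_splits)
  then show "\<sigma> \<in> order_complex A r\<^sub>1 \<and> card \<sigma> = n"
    using R.chain_onD[OF assms, of "p ` \<sigma>"] inj_on_simplex[of \<sigma>] by (simp add: card_image)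
qed

end

context finite_order
begin

text \<open>Push a cycle of \<open>Q\<close> forward along the embedding \<open>s\<close>, fill it
  in \<open>B\<close> and lift the filling. Lifting undoes pushing, since no other cell of
  \<open>A\<close> lies over the image of \<open>s\<close> and the weights on \<open>Q\<close> are
  1.\<close>

lemma transfer_bounds:
  fixes V' :: "'b set" and w :: "'a set \<Rightarrow> 'k"
  assumes T: "order_transfer V r V' r' A B p w" and Q: "Q \<subseteq> A"
    and s: "\<And>a. a \<in> A \<Longrightarrow> p a \<in> s ` Q \<Longrightarrow> a \<in> Q" "\<And>a. a \<in> Q \<Longrightarrow> p a = s a" "inj_on s Q"
    and s_iso: "\<And>a b. a \<in> Q \<Longrightarrow> b \<in> Q \<Longrightarrow> (s a, s b) \<in> r' \<longleftrightarrow> (a, b) \<in> r"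
    and w1: "\<And>\<sigma>. \<sigma> \<subseteq> Q \<Longrightarrow> w \<sigma> = 1"
    and B: "finite_order.bounds TYPE('k) V' r' (s ` Q) B n"
  shows "bounds Q A n"
proof -
  interpret T: order_transfer V r V' r' F A B p w
    by (rule T)
  let ?q = "inv_into Q s"
  have q: "?q (s a) = a" if "a \<in> Q" for a
    using that s(3) by simp
  have sB: "s ` Q \<subseteq> V'"
    using T.maps T.subs s(2) Q by force
  have QV: "Q \<subseteq> V"
    using T.subs Q by auto
  \<comment> \<open>Pulling back along the inverse of \<open>s\<close> with weight 1 is pushing
    forward along \<open>s\<close>.\<close>
  interpret S: order_transfer V' r' V r F "s ` Q" Q ?q "\<lambda>_. 1"
  proof (intro order_transfer.intro order_transfer_axioms.intro)
    show "finite_order V' r'" "finite_order V r"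
      by (rule T.R.finite_order_axioms finite_order_axioms)+
    show "s ` Q \<subseteq> V'" "Q \<subseteq> V" "?q ` (s ` Q) \<subseteq> Q"
      using sB QV q by auto
    show "(?q a, ?q b) \<in> r \<and> ?q a \<noteq> ?q b" if "a \<in> s ` Q" "b \<in> s ` Q" "a \<noteq> b" "(a, b) \<in> r'" for a b
      using that s_iso q by auto
    fix \<tau> b assume \<tau>: "\<tau> \<in> order_complex (s ` Q) r'" "b \<in> Q" "b \<notin> ?q ` \<tau>"
      "insert b (?q ` \<tau>) \<in> order_complex Q r"
    have "insert (s b) \<tau> \<in> order_complex (s ` Q) r'"
      unfolding order_complex_iff
    proof (intro conjI ballI)
      show "finite (insert (s b) \<tau>)" "insert (s b) \<tau> \<subseteq> s ` Q"
        using \<tau> by (auto simp: order_complex_iff)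
      fix x y assume xy: "x \<in> insert (s b) \<tau>" "y \<in> insert (s b) \<tau>"
      then have "?q x \<in> insert b (?q ` \<tau>)" "?q y \<in> insert b (?q ` \<tau>)"
        using q \<tau>(2) by auto
      then have "(?q x, ?q y) \<in> r \<or> (?q y, ?q x) \<in> r"
        using \<tau>(4) by (auto simp only: order_complex_iff)
      moreover obtain a c where "x = s a" "y = s c" "a \<in> Q" "c \<in> Q"
      proof -
        have "insert (s b) \<tau> \<subseteq> s ` Q"
          using \<tau>(1,2) by (simp add: order_complex_iff)
        then show thesis
          using xy that by blast
      qed
      ultimately show "(x, y) \<in> r' \<or> (y, x) \<in> r'"
        using q s_iso by simp
    qed
    then have "{u \<in> s ` Q. ?q u = b \<and> insert u \<tau> \<in> order_complex (s ` Q) r'} = {s b}"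
      using q \<tau>(2) by auto
    then show "(\<Sum>u\<in>{u \<in> s ` Q. ?q u = b \<and> insert u \<tau> \<in> order_complex (s ` Q) r'}. (1::'k)) = 1"
      by simp
  qed
  show ?thesis
    unfolding bounds_def
  proof (intro allI impI, elim conjE)
    fix z assume z: "chain_on Q n z" and cyc: "\<forall>\<tau>. bd z \<tau> = 0"
    have "T.R.chain_on (s ` Q) n (S.lift z)"
      by (rule S.chain_on_lift[OF z])
    moreover have "T.R.bd (S.lift z) \<tau> = 0" for \<tau>
      using cyc by (simp add: S.bd_lift[OF z]) (simp add: S.lift_def)
    ultimately obtain y where y: "T.R.chain_on B (Suc n) y" and bdy: "\<And>\<tau>. T.R.bd y \<tau> = S.lift z \<tau>"
      using B unfolding T.R.bounds_def by blast
    have "bd (T.lift y) \<tau> = z \<tau>" for \<tau>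
    proof -
      have "bd (T.lift y) \<tau> = T.lift (S.lift z) \<tau>"
        unfolding T.bd_lift[OF y] by (simp add: T.lift_def bdy)
      also have "\<dots> = z \<tau>"
      proof (cases "\<tau> \<in> order_complex Q r")
        case True
        then have \<tau>: "\<tau> \<in> order_complex A r" "\<tau> \<subseteq> Q"
          using order_complex_mono[OF Q, of r] by (blast, simp add: order_complex_iff)
        have im: "p ` \<tau> = s ` \<tau>"
          using s(2) \<tau>(2) by (intro image_cong) auto
        have "s ` \<tau> \<in> order_complex (s ` Q) r'"
          using True \<tau>(2) unfolding order_complex_iff by (auto simp: s_iso subset_iff)
        moreover have "?q ` (s ` \<tau>) = \<tau>"
          using \<tau>(2) s(3) by simp
        ultimately show ?thesis
          using \<tau> by (simp add: T.lift_def S.lift_def im w1)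
      next
        case False
        then have "z \<tau> = 0"
          using chain_onD[OF z] by blast
        moreover have "T.lift (S.lift z) \<tau> = 0"
        proof (rule ccontr)
          assume "T.lift (S.lift z) \<tau> \<noteq> 0"
          then have \<tau>: "\<tau> \<in> order_complex A r" "p ` \<tau> \<in> order_complex (s ` Q) r'"
            by (auto simp: T.lift_def S.lift_def split: if_splits)
          then have "\<tau> \<subseteq> Q"
            using s(1) by (fastforce simp: order_complex_iff)
          then show False
            using \<tau>(1) False by (auto simp: order_complex_iff)
        qed
        ultimately show ?thesis
          by simp
      qed
      finally show ?thesis .
    qed
    then show "\<exists>y. chain_on A (Suc n) y \<and> (\<forall>\<tau>. bd y \<tau> = z \<tau>)"
      using T.chain_on_lift[OF y] by blast
  qed
qed

end

subsection \<open>Labelled cell complexes\<close>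

text \<open>The poset of a complex of Boolean cells whose vertices are labelled, the labels of a cell
  being distinct. Orbits of independent sets are labelled by their supports.\<close>
locale labelled_cells = finite_order P r F
  for P :: "'a set" and r and F :: "'k::field itself" +
  fixes supp :: "'a \<Rightarrow> 'e set"
  assumes finite_supp: "x \<in> P \<Longrightarrow> finite (supp x)"
    and supp_mono: "(x, y) \<in> r \<Longrightarrow> supp x \<subseteq> supp y"
    and face: "y \<in> P \<Longrightarrow> X \<subseteq> supp y \<Longrightarrow> \<exists>!x. (x, y) \<in> r \<and> supp x = X"
    and exchange: "x \<in> P \<Longrightarrow> y \<in> P \<Longrightarrow> card (supp x) < card (supp y) \<Longrightarrow>
      \<exists>e\<in>supp y - supp x. \<exists>z. (x, z) \<in> r \<and> supp z = insert e (supp x)"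
    and joins_nonzero: "(w, x) \<in> r \<Longrightarrow> (w, y) \<in> r \<Longrightarrow> supp w = supp x \<inter> supp y \<Longrightarrow>
      z \<in> P \<Longrightarrow> supp z = supp x \<union> supp y \<Longrightarrow>
      of_nat (card {c. (x, c) \<in> r \<and> (y, c) \<in> r \<and> supp c = supp x \<union> supp y}) \<noteq> (0::'k)"
    and joins_uniform: "(w, x) \<in> r \<Longrightarrow> (w, y) \<in> r \<Longrightarrow> supp w = supp x \<inter> supp y \<Longrightarrow>
      (w', x') \<in> r \<Longrightarrow> (w', y') \<in> r \<Longrightarrow> supp w' = supp x' \<inter> supp y' \<Longrightarrow>
      supp x = supp x' \<Longrightarrow> supp y = supp y' \<Longrightarrow> z \<in> P \<Longrightarrow> supp z = supp x \<union> supp y \<Longrightarrow>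
      card {c. (x, c) \<in> r \<and> (y, c) \<in> r \<and> supp c = supp x \<union> supp y} =
      card {c. (x', c) \<in> r \<and> (y', c) \<in> r \<and> supp c = supp x' \<union> supp y'}"
begin

section \<open>Faces of a cell and multiplicities of joins\<close>

definition joins :: "'a \<Rightarrow> 'a \<Rightarrow> 'a set" where
  "joins x y = {c. (x, c) \<in> r \<and> (y, c) \<in> r \<and> supp c = supp x \<union> supp y}"

definition res :: "'a \<Rightarrow> 'e set \<Rightarrow> 'a" where
  "res y X = (THE x. (x, y) \<in> r \<and> supp x = X)"

text \<open>Contraction at p and deletion of the labels in \<open>D\<close>, without the bottom
  cell: the induction alternates between these two operations.\<close>

definition upper :: "'a \<Rightarrow> 'e set \<Rightarrow> 'a set" where
  "upper p D = {x. (p, x) \<in> r \<and> x \<noteq> p \<and> supp x \<inter> D = {}}"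

lemma in_P: assumes "(x, y) \<in> r" shows "x \<in> P" "y \<in> P"
  using assms po by (auto simp: partial_order_on_def preorder_on_def refl_on_def)

lemma res:
  assumes "y \<in> P" "X \<subseteq> supp y"
  shows "(res y X, y) \<in> r" "supp (res y X) = X"
  using theI'[OF face[OF assms]] unfolding res_def by auto

lemma res_eq: "(x, y) \<in> r \<Longrightarrow> res y (supp x) = x"
  using face[of y "supp x"] res[of y "supp x"] in_P supp_mono by blast

text \<open>A face of z is determined by its labels. The face of y labelled like x is also a face of
  z, hence equals x.\<close>

lemma le_in_cell:
  assumes "(x, z) \<in> r" "(y, z) \<in> r" "supp x \<subseteq> supp y"
  shows "(x, y) \<in> r"
proof -
  have "(res y (supp x), y) \<in> r" "supp (res y (supp x)) = supp x"
    using res[of y "supp x"] assms in_P by auto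
  then show ?thesis
    using assms res_eq trans by metis
qed

lemma eq_of_supp_eq: "(x, y) \<in> r \<Longrightarrow> supp x = supp y \<Longrightarrow> x = y"
  using le_in_cell[of y y x] refl in_P antisym by blast

lemma upper_subset: "upper p D \<subseteq> P"
  using in_P by (auto simp: upper_def)

text \<open>Repeated exchange against the same b: every new label comes from b and so avoids
  \<open>D\<close>.\<close>

lemma extend:
  assumes "x \<in> P" "b \<in> P" "supp x \<inter> D = {}" "supp b \<inter> D = {}" "card (supp x) \<le> card (supp b)"
  shows "\<exists>y. (x, y) \<in> r \<and> supp y \<inter> D = {} \<and> card (supp y) = card (supp b)"
  using assms
proof (induction "card (supp b) - card (supp x)" arbitrary: x)
  case 0
  then show ?case
    using refl by (intro exI[of _ x]) auto
next
  case (Suc k)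
  then have "card (supp x) < card (supp b)"
    by simp
  then obtain e z where e: "e \<in> supp b - supp x" and z: "(x, z) \<in> r" "supp z = insert e (supp x)"
    using exchange[OF Suc.prems(1,2)] by blast
  then have "card (supp z) = Suc (card (supp x))"
    using finite_supp[OF Suc.prems(1)] by simp
  then have "k = card (supp b) - card (supp z)" "card (supp z) \<le> card (supp b)"
    using Suc.hyps(2) by auto
  moreover have "supp z \<inter> D = {}" "z \<in> P"
    using z e Suc.prems in_P by auto
  ultimately obtain y where "(z, y) \<in> r \<and> supp y \<inter> D = {} \<and> card (supp y) = card (supp b)"
    using Suc.hyps(1) Suc.prems by blast
  then show ?case
    using z trans by blast
qed

text \<open>A join of v and y' has exactly one face that is a join of v and y, its restriction to
  their labels. The fibre over such a face x is \<open>joins x y'\<close>.\<close>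

lemma joins_disjoint_union:
  assumes vw: "(w, v) \<in> r" and wy: "(w, y) \<in> r" and yy: "(y, y') \<in> r"
    and w: "supp w = supp v \<inter> supp y'"
  shows "joins v y' = (\<Union>x\<in>joins v y. joins x y')"
    and "x \<in> joins v y \<Longrightarrow> x' \<in> joins v y \<Longrightarrow> x \<noteq> x' \<Longrightarrow> joins x y' \<inter> joins x' y' = {}"
proof -
  have s: "supp y \<subseteq> supp y'"
    using yy supp_mono by blast
  show "joins v y' = (\<Union>x\<in>joins v y. joins x y')"
  proof (intro equalityI subsetI)
    fix c assume c: "c \<in> joins v y'"
    let ?x = "res c (supp v \<union> supp y)"
    have c': "(v, c) \<in> r" "(y', c) \<in> r" "supp c = supp v \<union> supp y'" "(y, c) \<in> r"
      using c yy trans by (auto simp: joins_def)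
    then have x: "(?x, c) \<in> r" "supp ?x = supp v \<union> supp y"
      using res[of c "supp v \<union> supp y"] s in_P by auto
    have "(v, ?x) \<in> r" "(y, ?x) \<in> r"
      using x c' by (auto intro: le_in_cell)
    then have "?x \<in> joins v y" "c \<in> joins ?x y'"
      using x c' s by (auto simp: joins_def)
    then show "c \<in> (\<Union>x\<in>joins v y. joins x y')"
      by blast
  next
    fix c assume "c \<in> (\<Union>x\<in>joins v y. joins x y')"
    then show "c \<in> joins v y'"
      using trans s by (fastforce simp: joins_def)
  qed
  show "joins x y' \<inter> joins x' y' = {}" if "x \<in> joins v y" "x' \<in> joins v y" "x \<noteq> x'"
  proof -
    have "supp x = supp x'"
      using that by (simp add: joins_def)
    then have eq: "res c (supp x) = res c (supp x')" for c
      by (rule arg_cong)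
    have "x = x'" if "(x, c) \<in> r" "(x', c) \<in> r" for c
      using eq[of c] unfolding res_eq[OF that(1)] res_eq[OF that(2)] .
    then show ?thesis
      using that(3) unfolding joins_def by blast
  qed
qed

text \<open>All fibres in \<open>joins_disjoint_union\<close> have the same size by
  \<open>joins_uniform\<close>.\<close>

lemma card_joins_mult:
  assumes vw: "(w, v) \<in> r" and wy: "(w, y) \<in> r" and yy: "(y, y') \<in> r"
    and w: "supp w = supp v \<inter> supp y'" and a: "a \<in> joins v y"
    and z: "z \<in> P" "supp z = supp v \<union> supp y'"
  shows "card (joins v y') = card (joins v y) * card (joins a y')"
proof -
  have s: "supp y \<subseteq> supp y'"
    using yy supp_mono by blast
  have fin: "finite (joins x y)" for x y
    by (rule finite_subset[OF _ finite_V]) (use in_P in \<open>auto simp: joins_def\<close>)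
  have c: "card (joins x y') = card (joins a y')" if x: "x \<in> joins v y" for x
    unfolding joins_def
  proof (rule joins_uniform[OF _ yy _ _ yy])
    have i: "supp v \<inter> supp y' \<subseteq> supp y"
      using w supp_mono[OF wy] by simp
    show "(y, x) \<in> r" "(y, a) \<in> r" "supp x = supp a" "supp y' = supp y'"
      using x a by (auto simp: joins_def)
    show "supp y = supp x \<inter> supp y'" "supp y = supp a \<inter> supp y'" "supp z = supp x \<union> supp y'"
      using x a i z s by (auto simp: joins_def)
  qed (rule z)
  have "card (joins v y') = (\<Sum>x\<in>joins v y. card (joins x y'))"
    unfolding joins_disjoint_union(1)[OF assms(1-4)]
    using fin joins_disjoint_union(2)[OF assms(1-4)] by (intro card_UN_disjoint) auto
  then show ?thesis
    using c by simp
qed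

end

lemma (in finite_order) simplex_max:
  assumes "\<sigma> \<in> order_complex A r" "\<sigma> \<noteq> {}"
  shows "\<exists>m\<in>\<sigma>. \<forall>x\<in>\<sigma>. (x, m) \<in> r"
proof -
  have "finite \<sigma>"
    using assms by (simp add: order_complex_iff)
  then show ?thesis
    using assms(2,1)
  proof (induction rule: finite_ne_induct)
    case (singleton x)
    then show ?case
      by (auto simp: order_complex_iff)
  next
    case (insert x \<sigma>)
    then obtain m where m: "m \<in> \<sigma>" "\<forall>y\<in>\<sigma>. (y, m) \<in> r"
      using order_complex_subset by blast
    then have "(x, m) \<in> r \<or> (m, x) \<in> r" "(x, x) \<in> r"
      using insert.prems by (auto simp: order_complex_iff)
    then show ?case
      using m trans by blast
  qed
qed

section \<open>The coloop case\<close>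

context labelled_cells
begin

text \<open>The label \<open>e\<close> is a coloop above \<open>p\<close>. Collapsing the cells above \<open>v\<close> onto pairs
  \<open>(y, True)\<close>, with \<open>y\<close> free of \<open>e\<close>, gives a cone; averaging over the \<open>joins v y\<close> lifts its
  chains back.\<close>
lemma coloop_bounds:
  assumes p: "p \<in> P" and e: "e \<notin> supp p" "e \<notin> D" "supp p \<inter> D = {}"
    and v: "(p, v) \<in> r" "supp v = insert e (supp p)"
    and ext: "\<And>y. y \<in> insert p (upper p (insert e D)) \<Longrightarrow> \<exists>z. (y, z) \<in> r \<and> supp z = insert e (supp y)"
  shows "bounds (upper p (insert e D)) (upper p D) n"
proof -
  define Q where "Q = upper p (insert e D)"
  \<comment> \<open>One atom v labelled e suffices, so cells with label e that are not above v are
    left out.\<close>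
  define A where "A = Q \<union> {x. (v, x) \<in> r \<and> supp x \<inter> D = {}}"
  define f where "f = (\<lambda>x. res x (supp x - {e}))"
  \<comment> \<open>(y, True) stands for y with e added, (y, False) for y itself. The pair (p,
    False) is removed because p is no cell of \<open>upper p D\<close>, while (p, True) is the image
    of v.\<close>
  define V' where "V' = insert p Q \<times> (UNIV :: bool set) - {(p, False)}"
  define r' where "r' = {(a, b) \<in> V' \<times> V'. (fst a, fst b) \<in> r \<and> (snd a \<longrightarrow> snd b)}"
  define q where "q = (\<lambda>x. if e \<in> supp x then (f x, True) else (x, False))"
  \<comment> \<open>By \<open>joins_uniform\<close> the number depends on the label set alone, so
    any representative will do.\<close>
  define \<nu> where "\<nu> = (\<lambda>Z. of_nat (card (joins v (SOME y. y \<in> insert p Q \<and> supp y = Z))) :: 'k)"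
  \<comment> \<open>A chain that meets the cells above v is weighted by its top cell: labels grow
    along a chain, so their union is the label set of the top.\<close>
  define w where "w = (\<lambda>\<sigma>. if \<sigma> \<subseteq> Q then 1 else inverse (\<nu> (\<Union>(supp ` \<sigma>) - {e})))"
  have QP: "Q \<subseteq> P"
    unfolding Q_def by (rule upper_subset)
  have Q: "(p, y) \<in> r" "e \<notin> supp y" "supp y \<inter> D = {}" "y \<in> P" if "y \<in> insert p Q" for y
    using that e p refl QP by (auto simp: Q_def upper_def)
  have QI: "y \<in> insert p Q" if "(p, y) \<in> r" "e \<notin> supp y" "supp y \<inter> D = {}" for y
    using that by (auto simp: Q_def upper_def)
  have pQ: "p \<notin> Q"
    by (simp add: Q_def upper_def)
  have cap: "supp v \<inter> supp y = supp p" if "y \<in> insert p Q" for y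
    using Q[OF that] v supp_mono[of p y] by auto
  have pv: "supp p \<subseteq> supp v"
    using v by auto
  have cup: "supp v \<union> supp y = insert e (supp y)" if "y \<in> insert p Q" for y
    using Q[OF that] v supp_mono[of p y] by auto
  have AP: "A \<subseteq> P"
    using QP in_P by (auto simp: A_def)
  have Av: "(v, x) \<in> r" "supp x \<inter> D = {}" "x \<in> P" "insert e (supp p) \<subseteq> supp x" if "x \<in> A" "e \<in> supp x" for x
    using that Q in_P supp_mono[of v x] v by (auto simp: A_def)
  have AQ: "x \<in> Q" if "x \<in> A" "e \<notin> supp x" for x
    using that supp_mono[of v x] v by (auto simp: A_def)
  have f: "(f x, x) \<in> r" "supp (f x) = supp x - {e}" if "x \<in> P" for x
    using res[OF that] unfolding f_def by auto
  have fQ: "f x \<in> insert p Q" "supp x = insert e (supp (f x))" if "x \<in> A" "e \<in> supp x" for x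
  proof -
    show "supp x = insert e (supp (f x))"
      using f(2)[of x] Av[OF that] that by auto
    have "(p, f x) \<in> r"
      using f Av[OF that] v(1) trans e(1) by (intro le_in_cell[of p x "f x"]) blast+
    then show "f x \<in> insert p Q"
      using f Av[OF that] by (intro QI) auto
  qed
  have f_eq: "f x = y" if "(y, x) \<in> r" "supp x = insert e (supp y)" "e \<notin> supp y" for x y
    using res_eq[OF that(1)] that by (simp add: f_def)
  have le_f: "(y, f x) \<in> r" if "(y, x) \<in> r" "e \<notin> supp y" for x y
    using that f[of x] supp_mono[of y x] in_P[of y x] by (intro le_in_cell[of y x "f x"]) auto
  have joinsD: "u \<in> A" "e \<in> supp u" "f u = y" "supp u = insert e (supp y)" "(y, u) \<in> r" "(v, u) \<in> r"
    if "u \<in> joins v y" "y \<in> insert p Q" for u y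
  proof -
    show u: "supp u = insert e (supp y)" "(y, u) \<in> r" "(v, u) \<in> r" "e \<in> supp u"
      using that(1) cup[OF that(2)] by (auto simp: joins_def)
    show "u \<in> A"
      using u Q[OF that(2)] e by (auto simp: A_def)
    show "f u = y"
      using u Q[OF that(2)] by (intro f_eq) auto
  qed
  have joinsI: "x \<in> joins v (f x)" if "x \<in> A" "e \<in> supp x" for x
  proof -
    have "supp x = supp v \<union> supp (f x)"
      unfolding cup[OF fQ(1)[OF that]] by (rule fQ(2)[OF that])
    then show ?thesis
      using Av(1)[OF that] f(1)[OF Av(3)[OF that]] unfolding joins_def by blast
  qed
  have \<nu>: "\<nu> (supp y) = of_nat (card (joins v y))" "\<nu> (supp y) \<noteq> 0" if y: "y \<in> insert p Q" for y
  proof -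
    define y' where "y' = (SOME y'. y' \<in> insert p Q \<and> supp y' = supp y)"
    have y': "y' \<in> insert p Q" "supp y' = supp y"
      using someI[of "\<lambda>y'. y' \<in> insert p Q \<and> supp y' = supp y" y] y by (auto simp: y'_def)
    obtain z where z: "(y, z) \<in> r" "supp z = insert e (supp y)"
      using ext y by (auto simp: Q_def)
    have zP: "z \<in> P" "supp z = supp v \<union> supp y"
      using z in_P cup[OF y] by auto
    have "card (joins v y') = card (joins v y)"
      unfolding joins_def
      by (rule joins_uniform[OF v(1) Q(1)[OF y'(1)] _ v(1) Q(1)[OF y] _ _ _ zP(1)])
        (use cap[OF y] cap[OF y'(1)] y' zP in auto)
    then show "\<nu> (supp y) = of_nat (card (joins v y))"
      by (simp add: \<nu>_def y'_def)
    moreover have "of_nat (card (joins v y)) \<noteq> (0::'k)"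
      unfolding joins_def
      by (rule joins_nonzero[OF v(1) Q(1)[OF y] _ zP]) (use cap[OF y] in auto)
    ultimately show "\<nu> (supp y) \<noteq> 0"
      by simp
  qed
  have V': "finite V'" "partial_order_on V' r'"
  proof -
    show "finite V'"
      using finite_subset[OF QP finite_V] by (simp add: V'_def)
    have "fst a \<in> P" if "a \<in> V'" for a
      using that p QP by (auto simp: V'_def)
    then have "refl_on V' r'"
      using refl by (simp add: refl_on_def r'_def)
    moreover have "r' \<subseteq> V' \<times> V'"
      by (auto simp: r'_def)
    moreover have "antisym r'"
    proof (rule antisymI)
      fix a b assume "(a, b) \<in> r'" "(b, a) \<in> r'"
      then show "a = b"
        using antisym[of "fst a" "fst b"] by (auto simp: r'_def prod_eq_iff)
    qed
    moreover have "Relation.trans r'"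
    proof (rule transI)
      fix a b c assume "(a, b) \<in> r'" "(b, c) \<in> r'"
      then show "(a, c) \<in> r'"
        using trans[of "fst a" "fst b" "fst c"] by (auto simp: r'_def)
    qed
    ultimately show "partial_order_on V' r'"
      by (simp add: partial_order_on_def preorder_on_def)
  qed
  interpret C: finite_order V' r' F
    by standard (rule V')+
  have r'I: "((a, s), (b, t)) \<in> r' \<longleftrightarrow> (a, s) \<in> V' \<and> (b, t) \<in> V' \<and> (a, b) \<in> r \<and> (s \<longrightarrow> t)" for a b s t
    by (simp add: r'_def)
  have V'I: "(a, s) \<in> V' \<longleftrightarrow> a \<in> insert p Q \<and> (a = p \<longrightarrow> s)" for a s
    using pQ by (cases s) (auto simp: V'_def)
  have cone: "C.bounds ((\<lambda>y. (y, False)) ` Q) V' n"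
  proof -
    \<comment> \<open>\<open>?T\<close> is a cone with apex (p, True), but this vertex is not
      comparable with those of \<open>?F\<close>. So \<open>?F\<close> is glued in by pushing (y,
      False) to (y, True), the largest y last.\<close>
    let ?T = "(\<lambda>y. (y, True)) ` insert p Q"
    let ?F = "(\<lambda>y. (y, False)) ` Q"
    have TF: "?T \<union> ?F \<subseteq> V'"
      using pQ by (auto simp: V'I)
    have "C.bounds ?T ?T n"
      by (rule C.cone_bounds[of _ "(p, True)"]) (use TF Q in \<open>auto simp: r'I V'I\<close>)
    then have T: "C.bounds ?T V' n"
      by (rule C.bounds_mono) (use TF in auto)
    have "C.bounds (?T \<union> ?F) V' n"
    proof (rule C.retract_bounds[where f = "\<lambda>a. (fst a, True)" and key = "\<lambda>a. - int (card (supp (fst a)))"])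
      show "finite ?F"
        using finite_subset[OF QP finite_V] by simp
      show "(fst x, True) \<in> ?T \<and> C.comparable (fst x, True) x" if "x \<in> ?F" for x
        using that Q pQ by (auto simp: r'I V'I intro!: refl)
      show "C.comparable y (fst x, True)" if "x \<in> ?F" "y \<in> ?T" "C.comparable y x" for x y
        using that by (auto simp: r'I V'I)
      show "C.comparable y (fst x, True)"
        if xy: "x \<in> ?F" "y \<in> ?F" "x \<noteq> y" "C.comparable y x"
          and key: "- int (card (supp (fst x))) \<le> - int (card (supp (fst y)))" for x y
      proof -
        obtain a b where ab: "x = (a, False)" "y = (b, False)" "a \<in> Q" "b \<in> Q" "a \<noteq> b"
          using xy by auto
        have "(b, a) \<in> r"
        proof (rule ccontr)
          assume "(b, a) \<notin> r"
          then have "(a, b) \<in> r"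
            using xy ab by (auto simp: r'I)
          then have "supp a = supp b"
            using key ab supp_mono[of a b] finite_supp[of b] Q(4)[of b] by (intro card_seteq) auto
          then show False
            using \<open>(a, b) \<in> r\<close> eq_of_supp_eq ab by blast
        qed
        then show ?thesis
          using ab pQ by (auto simp: r'I V'I)
      qed
    qed (use T TF in auto)
    then show ?thesis
      by (rule C.bounds_mono) auto
  qed
  have qA: "q x \<in> V'" if "x \<in> A" for x
    using that fQ(1)[OF that] AQ[OF that] pQ by (cases "e \<in> supp x") (auto simp: q_def V'I)
  have "order_transfer P r V' r' A V' q w"
  proof (intro order_transfer.intro order_transfer_axioms.intro)
    show "finite_order P r" "finite_order V' r'"
      by (rule finite_order_axioms C.finite_order_axioms)+
    show "A \<subseteq> P" "V' \<subseteq> V'" "q ` A \<subseteq> V'"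
      using AP qA by auto
    show "(q a, q b) \<in> r' \<and> q a \<noteq> q b" if ab: "a \<in> A" "b \<in> A" "a \<noteq> b" "(a, b) \<in> r" for a b
    proof (cases "e \<in> supp a")
      case True
      then have b: "e \<in> supp b"
        using ab supp_mono by blast
      have "(f a, f b) \<in> r"
        using le_f[of "f a" b] f[of a] Av[OF ab(1) True] ab trans by auto
      moreover have "f a \<noteq> f b"
        using fQ(2)[OF ab(1) True] fQ(2)[OF ab(2) b] eq_of_supp_eq[OF ab(4)] ab(3) by auto
      ultimately show ?thesis
        using True b qA[OF ab(1)] qA[OF ab(2)] by (simp add: q_def r'I)
    next
      case False
      then show ?thesis
        using ab le_f[of a b] qA[OF ab(1)] qA[OF ab(2)] by (auto simp: q_def r'I)
    qed
    fix \<tau> b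
    assume \<tau>: "\<tau> \<in> order_complex A r" and b: "b \<in> V'" "b \<notin> q ` \<tau>"
      and b\<tau>: "insert b (q ` \<tau>) \<in> order_complex V' r'"
    let ?S = "{u \<in> A. q u = b \<and> insert u \<tau> \<in> order_complex A r}"
    have \<tau>A: "\<tau> \<subseteq> A"
      using \<tau> by (auto simp: order_complex_iff)
    have insI: "insert u \<tau> \<in> order_complex A r" if "u \<in> A" "\<And>c. c \<in> \<tau> \<Longrightarrow> comparable c u" for u
      using that \<tau> refl AP unfolding order_complex_iff by blast
    have bq: "C.comparable (q c) b" if "c \<in> \<tau>" for c
      using b\<tau> that by (auto simp: order_complex_iff)
    obtain y t where yt: "b = (y, t)"
      by force
    have y: "y \<in> insert p Q"
      using b yt by (auto simp: V'I)
    note y' = Q[OF y]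
    \<comment> \<open>A vertex whose labels lie below those of an e-labelled vertex of \<tau> does
      not change the union of labels, hence not the weight.\<close>
    have w_same: "w (insert u \<tau>) = w \<tau>" if "u \<in> A" "a \<in> \<tau>" "e \<in> supp a" "supp u \<subseteq> supp a" for u a
    proof -
      have "a \<notin> Q"
        using that Q by auto
      moreover have "\<Union>(supp ` insert u \<tau>) = \<Union>(supp ` \<tau>)"
        using that by auto
      ultimately show ?thesis
        using that(2) unfolding w_def by auto
    qed
    show "(\<Sum>u\<in>?S. w (insert u \<tau>)) = w \<tau>"
    proof (cases t)
      \<comment> \<open>The only lift of (y, False) is y itself.\<close>
      case False
      then have yQ: "y \<in> Q"
        using b yt by (auto simp: V'I)
      then have yA: "y \<in> A" "q y = b"
        using y' False yt by (auto simp: A_def q_def)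
      have cmp: "comparable c y \<and> (e \<in> supp c \<longrightarrow> (y, c) \<in> r)" if c: "c \<in> \<tau>" for c
      proof (cases "e \<in> supp c")
        case True
        then have "(y, f c) \<in> r"
          using bq[OF c] yt False by (auto simp: q_def r'I)
        then show ?thesis
          using f(1)[of c] c \<tau>A AP trans by blast
      next
        case ec: False
        then show ?thesis
          using bq[OF c] yt False by (auto simp: q_def r'I)
      qed
      have "u = y" if "u \<in> A" "q u = b" for u
        using that yt False by (auto simp: q_def split: if_splits)
      moreover have "insert y \<tau> \<in> order_complex A r"
        using cmp by (intro insI[OF yA(1)]) blast
      ultimately have S: "?S = {y}"
        using yA by blast
      have "w (insert y \<tau>) = w \<tau>"
      proof (cases "\<tau> \<subseteq> Q")
        case True
        then show ?thesis
          using yQ by (simp add: w_def)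
      next
        case nQ: False
        then obtain a where a: "a \<in> \<tau>" "a \<notin> Q"
          by auto
        then have "e \<in> supp a"
          using \<tau>A AQ by blast
        then show ?thesis
          using a cmp[OF a(1)] supp_mono[of y a] yA by (intro w_same) auto
      qed
      then show ?thesis
        by (simp add: S)
    next
      case t: True
      have qu: "q u = b \<longleftrightarrow> e \<in> supp u \<and> f u = y" for u
        using yt t by (auto simp: q_def)
      have cQ: "(c, y) \<in> r" if "c \<in> \<tau>" "e \<notin> supp c" for c
        using bq[OF that(1)] that(2) yt t by (auto simp: q_def r'I)
      have ce: "(f c, y) \<in> r \<or> (y, f c) \<in> r" if "c \<in> \<tau>" "e \<in> supp c" for c
        using bq[OF that(1)] that(2) yt t by (auto simp: q_def r'I)
      show ?thesis
      \<comment> \<open>If the projection of some e-labelled vertex a of \<tau> is above y, the lift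
        must be the face of a with labels \<open>insert e (supp y)\<close>, so it is unique.
        Otherwise the new vertex is the top of the chain and its lifts are joins.\<close>
      proof (cases "\<exists>a\<in>\<tau>. e \<in> supp a \<and> (y, f a) \<in> r")
        case True
        then obtain a where a: "a \<in> \<tau>" "e \<in> supp a" "(y, f a) \<in> r"
          by blast
        then have aA: "a \<in> A" "a \<in> P" "(y, a) \<in> r"
          using \<tau>A AP f(1) trans by blast+
        define u where "u = res a (insert e (supp y))"
        have sy: "supp y \<subseteq> supp a"
          using aA supp_mono by blast
        have u: "(u, a) \<in> r" "supp u = insert e (supp y)"
          using res[of a "insert e (supp y)"] aA sy a by (auto simp: u_def)
        have yu: "(y, u) \<in> r"
          using u aA by (intro le_in_cell[of y a u]) auto
        have "(v, u) \<in> r"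
          using u Av[OF aA(1) a(2)] v supp_mono[OF y'(1)] by (intro le_in_cell[of v a u]) auto
        then have uA: "u \<in> A"
          using u y' e by (auto simp: A_def)
        have "f u = y"
          using u yu y' by (intro f_eq) auto
        have cmp: "comparable c u" if c: "c \<in> \<tau>" for c
        proof (cases "e \<in> supp c")
          case False
          then show ?thesis
            using cQ[OF c] yu trans by blast
        next
          case True
          note sc = fQ(2)[OF subsetD[OF \<tau>A c] True]
          have "comparable c a"
            using \<tau> c a by (auto simp: order_complex_iff)
          then show ?thesis
          proof
            assume ca: "(c, a) \<in> r"
            show ?thesis
              using ce[OF c True]
            proof
              assume "(f c, y) \<in> r"
              then have "supp c \<subseteq> supp u"
                using sc u(2) supp_mono[of "f c" y] by blast
              then show ?thesis
                using ca u le_in_cell by blast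
            next
              assume "(y, f c) \<in> r"
              then have "supp u \<subseteq> supp c"
                using sc u(2) supp_mono[of y "f c"] by blast
              then show ?thesis
                using ca u le_in_cell by blast
            qed
          next
            assume "(a, c) \<in> r"
            then show ?thesis
              using u trans by blast
          qed
        qed
        have uniq: "u' = u" if u': "u' \<in> A" "q u' = b" "insert u' \<tau> \<in> order_complex A r" for u'
        proof -
          have s: "supp u' = insert e (supp y)"
            using u' fQ(2)[of u'] qu[of u'] by auto
          have "comparable u' a"
            using u' a by (auto simp: order_complex_iff)
          moreover have False if "(a, u') \<in> r"
          proof -
            have "supp a = supp u'"
              using supp_mono[OF that] s sy a by auto
            then have "a = u'"
              using that eq_of_supp_eq by blast
            then show False
              using b u' a by auto
          qed
          ultimately have "(u', a) \<in> r"
            by blast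
          then show ?thesis
            using res_eq[of u' a] s by (simp add: u_def)
        qed
        have "insert u \<tau> \<in> order_complex A r"
          using cmp by (intro insI[OF uA]) blast
        moreover have "q u = b"
          using \<open>f u = y\<close> u(2) by (simp add: qu)
        ultimately have "?S = {u}"
          using uniq uA by blast
        moreover have "w (insert u \<tau>) = w \<tau>"
          using uA a u supp_mono by (intro w_same[of u a]) auto
        ultimately show ?thesis
          by simp
      next
        case False
        then have ce': "(f c, y) \<in> r" if "c \<in> \<tau>" "e \<in> supp c" for c
          using ce that by blast
        have sc: "supp c \<subseteq> insert e (supp y)" if "c \<in> \<tau>" for c
          using that cQ[OF that] ce'[OF that] fQ(2)[of c] \<tau>A supp_mono[of c y] supp_mono[of "f c" y]
          by (cases "e \<in> supp c") auto
        have w_u: "w (insert u \<tau>) = inverse (of_nat (card (joins v y)))"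
          if "u \<in> joins v y" for u
        proof -
          note u = joinsD[OF that y]
          have "u \<notin> Q"
            using u Q by blast
          moreover have "\<Union>(supp ` insert u \<tau>) - {e} = supp y"
            using u(4) sc y' by auto
          ultimately show ?thesis
            using \<nu>(1)[OF y] by (simp add: w_def)
        qed
        show ?thesis
        \<comment> \<open>If no vertex of \<tau> has label e, the lifts are all of
          \<open>joins v y\<close> and their weights add up to 1. Otherwise, with a the top of
          \<tau>, they are \<open>joins a y\<close>, and \<open>card_joins_mult\<close> turns the
          quotient of the two numbers into the weight of \<tau>.\<close>
        proof (cases "\<exists>a\<in>\<tau>. e \<in> supp a")
          case ne: False
          have "?S = joins v y"
          proof (intro equalityI subsetI)
            fix u assume "u \<in> ?S"
            then show "u \<in> joins v y"
              using joinsI[of u] qu by auto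
          next
            fix u assume u: "u \<in> joins v y"
            note u' = joinsD[OF u y]
            have "comparable c u" if "c \<in> \<tau>" for c
              using cQ[OF that] ne that u' trans by blast
            then have "insert u \<tau> \<in> order_complex A r"
              by (intro insI[OF u'(1)]) blast
            then show "u \<in> ?S"
              using u' by (simp add: qu)
          qed
          then have "(\<Sum>u\<in>?S. w (insert u \<tau>)) = of_nat (card (joins v y)) * inverse (of_nat (card (joins v y)))"
            using w_u by simp
          also have "\<dots> = 1"
            using \<nu>[OF y] by simp
          also have "\<tau> \<subseteq> Q"
          proof
            fix c assume c: "c \<in> \<tau>"
            then show "c \<in> Q"
              using \<tau>A ne AQ by blast
          qed
          then have "1 = w \<tau>"
            by (simp add: w_def)
          finally show ?thesis .
        next
          case True
          then obtain a0 where a0: "a0 \<in> \<tau>" "e \<in> supp a0"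
            by blast
          then obtain a where a: "a \<in> \<tau>" "\<And>c. c \<in> \<tau> \<Longrightarrow> (c, a) \<in> r"
            using simplex_max[OF \<tau>] by blast
          have ea: "e \<in> supp a"
            using a(2)[OF a0(1)] a0 supp_mono by blast
          have aA: "a \<in> A"
            using a \<tau>A by blast
          note fa = fQ[OF aA ea] and av = Av[OF aA ea]
          have fy: "(f a, y) \<in> r"
            using ce'[OF a(1) ea] .
          have nya: "(y, f a) \<notin> r"
            using False a(1) ea by blast
          have sfa: "supp (f a) \<subseteq> supp y"
            using fy supp_mono by blast
          have sau: "supp a \<union> supp y = insert e (supp y)"
            using fa sfa by auto
          have S: "?S = joins a y"
          proof (intro equalityI subsetI)
            fix u assume u: "u \<in> ?S"
            then have u': "u \<in> A" "e \<in> supp u" "f u = y"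
              by (auto simp: qu)
            have "supp u = insert e (supp y)" "(y, u) \<in> r"
              using fQ(2)[OF u'(1,2)] u' f(1)[of u] AP by auto
            moreover have "(a, u) \<in> r"
            proof -
              have "comparable a u"
                using u a by (auto simp: order_complex_iff)
              moreover have "(u, a) \<notin> r"
                using nya le_f[of y a] \<open>(y, u) \<in> r\<close> y' trans by blast
              ultimately show ?thesis
                by blast
            qed
            ultimately show "u \<in> joins a y"
              using sau by (auto simp: joins_def)
          next
            fix u assume "u \<in> joins a y"
            then have u: "(a, u) \<in> r" "(y, u) \<in> r" "supp u = insert e (supp y)"
              using sau by (auto simp: joins_def)
            have "u \<in> A"
              using u av trans y' e by (auto simp: A_def)
            moreover have "f u = y"
              using u y' by (intro f_eq) auto
            moreover have "comparable c u" if "c \<in> \<tau>" for c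
              using a(2)[OF that] u trans by blast
            ultimately have "u \<in> A" "f u = y" "insert u \<tau> \<in> order_complex A r"
              using insI[of u] by blast+
            then show "u \<in> ?S"
              using u by (simp add: qu)
          qed
          have "joins a y \<subseteq> joins v y"
          proof
            fix u assume "u \<in> joins a y"
            then show "u \<in> joins v y"
              using av trans sau cup[OF y] by (auto simp: joins_def)
          qed
          then have "(\<Sum>u\<in>?S. w (insert u \<tau>)) = of_nat (card (joins a y)) * inverse (of_nat (card (joins v y)))"
            unfolding S using w_u by (simp add: subset_iff)
          moreover have "card (joins v y) = card (joins v (f a)) * card (joins a y)"
          proof -
            obtain z where z: "(y, z) \<in> r" "supp z = insert e (supp y)"
              using ext y by (auto simp: Q_def)
            have "supp p = supp v \<inter> supp y"
              using cap[OF y] by simp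
            then show ?thesis
              using joinsI[OF aA ea] z in_P cup[OF y]
              by (intro card_joins_mult[OF v(1) Q(1)[OF fa(1)] fy]) auto
          qed
          moreover have "of_nat (card (joins v y)) \<noteq> (0::'k)"
            using \<nu>[OF y] by simp
          moreover have "w \<tau> = inverse (of_nat (card (joins v (f a))))"
          proof -
            have "\<Union>(supp ` \<tau>) = supp a"
              using a supp_mono by blast
            moreover have "supp a - {e} = supp (f a)"
              using f av by simp
            moreover have "\<not> \<tau> \<subseteq> Q"
              using a ea Q by blast
            ultimately show ?thesis
              using \<nu>(1)[OF fa(1)] by (simp add: w_def)
          qed
          ultimately show ?thesis
            by (simp add: mult.left_commute[of "of_nat (card (joins a y))"])
        qed
      qed
    qed
  qed
  \<comment> \<open>\<open>Q\<close> is embedded as the copy marked False, over which no other cell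
    of \<open>A\<close> lies.\<close>
  then have "bounds Q A n"
  proof (rule transfer_bounds[where s = "\<lambda>y. (y, False)"])
    show "(\<And>a. a \<in> A \<Longrightarrow> q a \<in> (\<lambda>y. (y, False)) ` Q \<Longrightarrow> a \<in> Q)"
      by (auto simp: q_def split: if_splits)
    show "q a = (a, False)" if "a \<in> Q" for a
      using Q[of a] that by (simp add: q_def)
    show "((a, False), (b, False)) \<in> r' \<longleftrightarrow> (a, b) \<in> r" if "a \<in> Q" "b \<in> Q" for a b
      using that pQ by (auto simp: r'I V'I)
  qed (use cone in \<open>auto simp: A_def w_def inj_on_def\<close>)
  moreover have "A \<subseteq> upper p D"
  proof
    fix x assume "x \<in> A"
    then consider "x \<in> Q" | "(v, x) \<in> r" "supp x \<inter> D = {}"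
      by (auto simp: A_def)
    then show "x \<in> upper p D"
    proof cases
      case 1
      then show ?thesis
        by (auto simp: Q_def upper_def)
    next
      case 2
      then show ?thesis
        using v e(1) trans supp_mono[of v x] by (auto simp: upper_def)
    qed
  qed
  ultimately show ?thesis
    unfolding Q_def using bounds_mono by blast
qed

end

lemma (in finite_order) simplex_min:
  assumes "\<sigma> \<in> order_complex A r" "\<sigma> \<noteq> {}"
  shows "\<exists>m\<in>\<sigma>. \<forall>x\<in>\<sigma>. (m, x) \<in> r"
proof -
  have "finite \<sigma>"
    using assms by (simp add: order_complex_iff)
  then show ?thesis
    using assms(2,1)
  proof (induction rule: finite_ne_induct)
    case (singleton x)
    then show ?case
      by (auto simp: order_complex_iff)
  next
    case (insert x \<sigma>)
    then obtain m where m: "m \<in> \<sigma>" "\<forall>y\<in>\<sigma>. (m, y) \<in> r"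
      using order_complex_subset by blast
    then have "(x, m) \<in> r \<or> (m, x) \<in> r" "(x, x) \<in> r"
      using insert.prems by (auto simp: order_complex_iff)
    then show ?case
      using m trans by blast
  qed
qed

section \<open>Acyclicity of the cells above a given cell\<close>

context labelled_cells
begin

lemma card_supp_less: "(x, y) \<in> r \<Longrightarrow> x \<noteq> y \<Longrightarrow> card (supp x) < card (supp y)"
  using eq_of_supp_eq supp_mono finite_supp in_P by (metis psubsetI psubset_card_mono)

lemma remove_label:
  assumes "x \<in> P" and f: "f = res x (supp x - {e})"
  shows "(f, x) \<in> r" "supp f = supp x - {e}"
    and "(y, x) \<in> r \<Longrightarrow> e \<notin> supp y \<Longrightarrow> (y, f) \<in> r"
proof -
  show *: "(f, x) \<in> r" "supp f = supp x - {e}"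
    using res[of x "supp x - {e}"] assms by auto
  show "(y, f) \<in> r" if "(y, x) \<in> r" "e \<notin> supp y"
    using that * supp_mono[of y x] by (intro le_in_cell[of y x f]) auto
qed

text \<open>The cell b shows that d labels can be added to p while avoiding \<open>D\<close>. The
  measure counts the labels neither in p nor in \<open>D\<close>; it drops both when e joins
  \<open>D\<close> and when an atom v labelled e replaces p.\<close>

lemma upper_acyclic:
  assumes "p \<in> P" "supp p \<inter> D = {}" "b \<in> P" "supp b \<inter> D = {}" "card (supp b) = card (supp p) + d"
  shows "acyclic_below (upper p D) d"
  using assms
proof (induction "card (\<Union>(supp ` P) - supp p - D)" arbitrary: p D d b rule: less_induct)
  case less
  note p = less.prems(1,2) and b = less.prems(3-5)
  have finE: "finite (\<Union>(supp ` P) - X - Y)" for X Y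
    using finite_V finite_supp by auto
  show ?case
  proof (cases d)
    case 0
    then show ?thesis
      by (simp add: acyclic_below_def)
  next
    case (Suc d')
    then have "card (supp p) < card (supp b)"
      using b by simp
    then obtain e v0 where e: "e \<in> supp b" "e \<notin> supp p" and v0: "(p, v0) \<in> r" "supp v0 = insert e (supp p)"
      using exchange[OF p(1) b(1)] by blast
    then have eD: "e \<notin> D" and eE: "e \<in> \<Union>(supp ` P)"
      using b by auto
    define R where "R = upper p D"
    \<comment> \<open>\<open>Q\<close> is the deletion of e, \<open>X\<close> the atoms labelled e,
      \<open>U\<close> the larger cells containing e.\<close>
    define Q where "Q = upper p (insert e D)"
    define X where "X = {v. (p, v) \<in> r \<and> supp v = insert e (supp p)}"
    define U where "U = R - Q - X"
    have RP: "R \<subseteq> P"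
      unfolding R_def by (rule upper_subset)
    have QR: "Q \<subseteq> R"
      by (auto simp: Q_def R_def upper_def)
    have XR: "X \<subseteq> R"
      using e eD p by (auto simp: X_def R_def upper_def)
    have eQ: "e \<notin> supp y" if "y \<in> Q" for y
      using that by (auto simp: Q_def upper_def)
    have eU: "e \<in> supp y" "y \<in> R" "y \<notin> X" if "y \<in> U" for y
      using that by (auto simp: U_def Q_def R_def upper_def)
    have R: "R = Q \<union> U \<union> X"
      using QR XR by (auto simp: U_def)
    have QX: "Q \<inter> X = {}"
      using eQ by (auto simp: X_def)
    have "bounds Q R n" if n: "n < d" for n
    \<comment> \<open>The condition says that the deletion of e still has rank at least d, i.e. that
      e does not act as a coloop.\<close>
    proof (cases "\<exists>c\<in>P. supp c \<inter> insert e D = {} \<and> card (supp c) = card (supp p) + d")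
      case True
      then obtain c where c: "c \<in> P" "supp c \<inter> insert e D = {}" "card (supp c) = card (supp p) + d"
        by blast
      have "\<Union>(supp ` P) - supp p - insert e D \<subset> \<Union>(supp ` P) - supp p - D"
        using eE e eD by blast
      then have "card (\<Union>(supp ` P) - supp p - insert e D) < card (\<Union>(supp ` P) - supp p - D)"
        by (rule psubset_card_mono[OF finE])
      then have "acyclic_below Q d"
        unfolding Q_def by (rule less.hyps) (use p e c in auto)
      then show ?thesis
        using n QR bounds_mono unfolding acyclic_below_def by blast
    next
      case False
      show ?thesis
        unfolding Q_def R_def
      proof (rule coloop_bounds[OF p(1) e(2) eD p(2) v0])
        fix y assume y: "y \<in> insert p (upper p (insert e D))"
        then have yP: "y \<in> P" "supp y \<inter> insert e D = {}"
          using p e upper_subset by (auto simp: upper_def)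
        \<comment> \<open>Otherwise a face of y with as many labels as b would contradict the
          negated condition. So y extends to a cell with as many labels as b; this cell must contain
          e, and its face on the labels of y and e is the one sought.\<close>
        have "card (supp y) < card (supp b)"
        proof (rule ccontr)
          assume "\<not> card (supp y) < card (supp b)"
          then obtain Y where Y: "Y \<subseteq> supp y" "card Y = card (supp b)"
            by (meson not_less obtain_subset_with_card_n)
          note resY = res[OF yP(1) Y(1)]
          have "supp (res y Y) \<inter> insert e D = {}" "card (supp (res y Y)) = card (supp p) + d"
            unfolding resY(2) using Y yP(2) b(3) by auto
          then show False
            using False in_P(1)[OF resY(1)] by blast
        qed
        then obtain y' where y': "(y, y') \<in> r" "supp y' \<inter> D = {}" "card (supp y') = card (supp b)"
          using extend[OF yP(1) b(1), of D] yP b by auto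
        then have ey: "e \<in> supp y'"
          using False b(3) in_P(2)[OF y'(1)] by auto
        let ?z = "res y' (insert e (supp y))"
        have z: "(?z, y') \<in> r" "supp ?z = insert e (supp y)"
          using res[of y' "insert e (supp y)"] ey supp_mono[OF y'(1)] in_P(2)[OF y'(1)] by auto
        have "(y, ?z) \<in> r"
          by (rule le_in_cell[OF y'(1) z(1)]) (auto simp: z(2))
        then show "\<exists>z. (y, z) \<in> r \<and> supp z = insert e (supp y)"
          using z(2) by blast
      qed
    qed
    note Q_bounds = this
    have QU: "bounds (Q \<union> U) R n" if n: "n < d" for n
    \<comment> \<open>With the number of labels as \<open>key\<close>, x comes after the cells of
      \<open>U\<close> above it, and these are also above x with e removed.\<close>
    proof (rule retract_bounds[where f = "\<lambda>x. res x (supp x - {e})" and key = "\<lambda>x. int (card (supp x))"])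
      show "finite U"
        using finite_subset[OF RP finite_V] by (simp add: U_def)
      fix x assume x: "x \<in> U"
      then have xP: "x \<in> P"
        using eU RP by blast
      note f = remove_label[OF xP HOL.refl, where e = e]
      have px: "(p, x) \<in> r" "supp x \<inter> D = {}"
        using eU[OF x] by (auto simp: R_def upper_def)
      have "res x (supp x - {e}) \<noteq> p"
      proof
        assume "res x (supp x - {e}) = p"
        then have "supp x = insert e (supp p)"
          using f(2) eU(1)[OF x] by auto
        then show False
          using eU(3)[OF x] px by (simp add: X_def)
      qed
      then show "res x (supp x - {e}) \<in> Q \<and> comparable (res x (supp x - {e})) x"
        using f px e by (auto simp: Q_def upper_def)
      show "comparable y (res x (supp x - {e}))" if "y \<in> Q" "comparable y x" for y
        using that eQ[of y] eU(1)[OF x] supp_mono[of x y] f(3) by blast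
      show "comparable y (res x (supp x - {e}))"
        if "y \<in> U" "x \<noteq> y" "comparable y x" "int (card (supp x)) \<le> int (card (supp y))" for y
        using that card_supp_less[of y x] f(1) trans by force
    qed (use QR RP n Q_bounds in \<open>auto simp: U_def\<close>)
    have "bounds (Q \<union> U \<union> X) R n" if n: "n < d" for n
    proof (rule add_vertices_bounds[OF _ QU[OF n]])
      show "finite X"
        using finite_subset[OF _ finite_V] XR RP by blast
      show "\<not> comparable x y" if "x \<in> X" "y \<in> X" "x \<noteq> y" for x y
        using that eq_of_supp_eq unfolding X_def by (metis (mono_tags, lifting) mem_Collect_eq)
      fix v m assume v: "v \<in> X" and m: "n = Suc m"
      have v': "(p, v) \<in> r" "supp v = insert e (supp p)"
        using v by (auto simp: X_def)
      have vP: "v \<in> P"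
        using v' in_P by blast
      \<comment> \<open>The link of v contains only cells above v, because p is excluded and v has
        just one label more than p.\<close>
      have link: "{a \<in> Q \<union> U. comparable a v} = upper v D"
      proof (intro equalityI subsetI)
        fix a assume a: "a \<in> {a \<in> Q \<union> U. comparable a v}"
        then have aR: "a \<in> R" "a \<notin> X"
          using R QX eU by auto
        then have pa: "(p, a) \<in> r" "a \<noteq> p" "supp a \<inter> D = {}"
          by (auto simp: R_def upper_def)
        have "(a, v) \<notin> r"
        proof
          assume av: "(a, v) \<in> r"
          then have "supp p \<subseteq> supp a" "supp a \<subseteq> insert e (supp p)" "supp a \<noteq> supp p"
            using supp_mono[OF av] supp_mono[OF pa(1)] v' pa eq_of_supp_eq[OF pa(1)] by auto
          then have "supp a = insert e (supp p)"
            by blast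
          then show False
            using aR pa by (simp add: X_def)
        qed
        moreover have "a \<noteq> v"
          using aR v by blast
        ultimately show "a \<in> upper v D"
          using a pa by (auto simp: upper_def)
      next
        fix a assume "a \<in> upper v D"
        then have a: "(v, a) \<in> r" "a \<noteq> v" "supp a \<inter> D = {}"
          by (auto simp: upper_def)
        have "e \<in> supp a"
          using supp_mono[OF a(1)] v' by auto
        then have "a \<noteq> p"
          using e by auto
        then have "a \<in> R"
          using a v' trans by (auto simp: R_def upper_def)
        moreover have "a \<notin> X"
          using eq_of_supp_eq[OF a(1)] a v' by (auto simp: X_def)
        ultimately show "a \<in> {a \<in> Q \<union> U. comparable a v}"
          using R a by auto
      qed
      have "\<Union>(supp ` P) - supp v - D \<subset> \<Union>(supp ` P) - supp p - D"
        using eE e eD v' by auto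
      then have "card (\<Union>(supp ` P) - supp v - D) < card (\<Union>(supp ` P) - supp p - D)"
        by (rule psubset_card_mono[OF finE])
      \<comment> \<open>Passing to v lowers the bound d by one, which matches the shift from n to m
        in the link.\<close>
      moreover have "card (supp b) = card (supp v) + d'"
        using v' b e finite_supp[OF p(1)] Suc by simp
      ultimately have "acyclic_below (upper v D) d'"
        using less.hyps[of v D b d'] vP v' p b eD by auto
      then show "bounds {a \<in> Q \<union> U. comparable a v} {a \<in> Q \<union> U. comparable a v} m"
        unfolding link using m n Suc by (simp add: acyclic_below_def)
    qed (use R QX RP in \<open>auto simp: U_def\<close>)
    then show ?thesis
      using R unfolding acyclic_below_def R_def by simp
  qed
qed

section \<open>Open intervals and links of chains\<close>

definition interval :: "'a \<Rightarrow> 'a \<Rightarrow> 'a set" where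
  "interval x y = {z. (x, z) \<in> r \<and> z \<noteq> x \<and> (z, y) \<in> r \<and> z \<noteq> y}"

text \<open>Open intervals are subdivided boundaries of simplices, so a join with one raises the
  connectivity as a join with a sphere does.\<close>
lemma interval_join_acyclic:
  assumes "(x, y) \<in> r" "T \<subseteq> P" and T: "\<And>t. t \<in> T \<Longrightarrow> (y, t) \<in> r \<and> t \<noteq> y"
    and d: "acyclic_below T d" and "card (supp y) = card (supp x) + Suc k"
  shows "acyclic_below (interval x y \<union> T) (d + k)"
  using assms(1,5)
proof (induction k arbitrary: x)
  case 0
  have "z \<notin> interval x y" for z
  proof
    assume "z \<in> interval x y"
    then have "card (supp x) < card (supp z)" "card (supp z) < card (supp y)"
      by (auto simp: interval_def intro!: card_supp_less)
    then show False
      using 0(2) by simp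
  qed
  then have "interval x y = {}"
    by blast
  then show ?case
    using d by simp
next
  case (Suc k)
  have xP: "x \<in> P" and yP: "y \<in> P"
    using in_P[OF Suc.prems(1)] by auto
  have "\<not> supp y \<subseteq> supp x"
    using Suc.prems card_mono[OF finite_supp[OF xP], of "supp y"] by auto
  then obtain e where e: "e \<in> supp y" "e \<notin> supp x"
    by blast
  have sxy: "supp x \<subseteq> supp y"
    using Suc.prems supp_mono by blast
  \<comment> \<open>v is the atom of the interval labelled e, and t the coatom without e. The cells
    without e together with \<open>T\<close> form a cone with apex t. The cells of \<open>U\<close>
    retract by dropping e; for v this would give x, which lies outside, so v is glued in last along
    a shorter interval joined with \<open>T\<close>.\<close>
  define v where "v = res y (insert e (supp x))"
  define t where "t = res y (supp y - {e})"
  define Q where "Q = {z \<in> interval x y. e \<notin> supp z}"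
  define U where "U = {z \<in> interval x y. e \<in> supp z \<and> z \<noteq> v}"
  let ?R = "interval x y \<union> T"
  have v: "(v, y) \<in> r" "supp v = insert e (supp x)"
    using res[of y "insert e (supp x)"] yP e sxy by (auto simp: v_def)
  then have cv: "card (supp v) = Suc (card (supp x))"
    using finite_supp[OF xP] e by simp
  have xv: "(x, v) \<in> r"
    using Suc.prems v by (intro le_in_cell[of x y v]) auto
  have v_int: "v \<in> interval x y"
    using v xv cv Suc.prems by (auto simp: interval_def)
  have t: "(t, y) \<in> r" "supp t = supp y - {e}" "\<And>z. (z, y) \<in> r \<Longrightarrow> e \<notin> supp z \<Longrightarrow> (z, t) \<in> r"
    using remove_label[OF yP t_def] by auto
  have "card (supp t) = Suc (card (supp x) + k)"
    using t e Suc.prems finite_supp[OF yP] by simp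
  then have tQ: "t \<in> Q"
    using t e Suc.prems(1) by (auto simp: Q_def interval_def)
  have RP: "?R \<subseteq> P"
    using assms(2) in_P(1) unfolding interval_def by blast
  have R: "?R = insert v (Q \<union> T \<union> U)"
    using v_int v by (auto simp: Q_def U_def)
  have vn: "v \<notin> Q \<union> T \<union> U"
    using v T[of v] antisym[of v y] by (auto simp: Q_def U_def)
  have TI: "T \<inter> interval x y = {}"
    using T antisym by (auto simp: interval_def)
  show ?case
    unfolding acyclic_below_def
  proof (intro allI impI)
    fix n assume n: "n < d + Suc k"
    have "bounds (Q \<union> T) (Q \<union> T) n"
    proof (rule cone_bounds)
      show "Q \<union> T \<subseteq> P"
        using RP R by auto
      show "t \<in> Q \<union> T"
        using tQ by simp
      show "comparable a t" if "a \<in> Q \<union> T" for a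
        using that t T trans by (auto simp: Q_def interval_def)
    qed
    then have QT: "bounds (Q \<union> T) ?R n"
      by (rule bounds_mono) (use R in auto)
    have "bounds (Q \<union> T \<union> U) ?R n"
    proof (rule retract_bounds[where f = "\<lambda>x. res x (supp x - {e})" and key = "\<lambda>x. int (card (supp x))", OF _ QT])
      show "finite U"
        using finite_subset[OF RP finite_V] R by (metis finite_Un finite_insert)
      fix z assume z: "z \<in> U"
      then have z': "(x, z) \<in> r" "(z, y) \<in> r" "z \<noteq> v" "e \<in> supp z"
        by (auto simp: U_def interval_def)
      then have zP: "z \<in> P"
        using in_P by blast
      note f = remove_label[OF zP HOL.refl, where e = e]
      have fx: "res z (supp z - {e}) \<noteq> x"
      proof
        assume "res z (supp z - {e}) = x"
        then have "supp z = supp v"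
          using f(2) z' v by auto
        then have "z = v"
          using le_in_cell[OF z'(2) v(1)] eq_of_supp_eq by blast
        then show False
          using z' by simp
      qed
      have fy: "(res z (supp z - {e}), y) \<in> r"
        using f(1) z' trans by blast
      show "res z (supp z - {e}) \<in> Q \<union> T \<and> comparable (res z (supp z - {e})) z"
        using f fx fy z' e by (auto simp: Q_def interval_def)
      show "comparable a (res z (supp z - {e}))" if a: "a \<in> Q \<union> T" "comparable a z" for a
      proof (cases "a \<in> T")
        case True
        then show ?thesis
          using fy T trans by blast
      next
        case False
        then have "e \<notin> supp a"
          using a by (auto simp: Q_def)
        then show ?thesis
          using a f(3) z' supp_mono by blast
      qed
      show "comparable a (res z (supp z - {e}))"
        if "a \<in> U" "z \<noteq> a" "comparable a z" "int (card (supp z)) \<le> int (card (supp a))" for a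
        using that card_supp_less[of a z] f(1) trans by force
    qed (use R RP TI in \<open>auto simp: U_def Q_def\<close>)
    then have "bounds (insert v (Q \<union> T \<union> U)) ?R n"
    proof (rule add_vertex_bounds)
      fix m assume m: "n = Suc m"
      have link: "{a \<in> Q \<union> T \<union> U. comparable a v} = interval v y \<union> T"
      proof (intro equalityI subsetI)
        fix a assume a: "a \<in> {a \<in> Q \<union> T \<union> U. comparable a v}"
        show "a \<in> interval v y \<union> T"
        proof (cases "a \<in> T")
          case False
          then have ai: "a \<in> interval x y" "a \<noteq> v"
            using a by (auto simp: Q_def U_def v(2))
          then have pa: "(x, a) \<in> r" "a \<noteq> x" "(a, y) \<in> r" "a \<noteq> y"
            by (auto simp: interval_def)
          have "(a, v) \<notin> r"
            using card_supp_less[OF pa(1)] card_supp_less[of a v] cv pa(2) ai(2) by auto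
          then show ?thesis
            using a ai pa by (auto simp: interval_def)
        qed simp
      next
        fix a assume "a \<in> interval v y \<union> T"
        then consider "a \<in> T" | "a \<in> interval v y"
          by blast
        then show "a \<in> {a \<in> Q \<union> T \<union> U. comparable a v}"
        proof cases
          case 1
          then show ?thesis
            using T v trans by blast
        next
          case 2
          then have a: "(v, a) \<in> r" "a \<noteq> v" "(a, y) \<in> r" "a \<noteq> y"
            by (auto simp: interval_def)
          moreover have "e \<in> supp a"
            using supp_mono[OF a(1)] v by auto
          moreover have "(x, a) \<in> r"
            using xv a trans by blast
          ultimately show ?thesis
            using e by (auto simp: U_def interval_def)
        qed
      qed
      have "acyclic_below (interval v y \<union> T) (d + k)"
        using v cv Suc.prems by (intro Suc.IH) auto
      then show "bounds {a \<in> Q \<union> T \<union> U. comparable a v} {a \<in> Q \<union> T \<union> U. comparable a v} m"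
        unfolding link using m n by (simp add: acyclic_below_def)
    qed (use R RP vn v_int in auto)
    then show "bounds ?R ?R n"
      using R by simp
  qed
qed

text \<open>If x is the least vertex of \<sigma>, the link splits into the interval between p and x
  and the link of the remaining vertices above x.\<close>

lemma link_acyclic:
  assumes "p \<in> P" and "\<sigma> \<in> order_complex {x. (p, x) \<in> r \<and> x \<noteq> p} r"
    and b: "b \<in> P" "\<And>x. x \<in> P \<Longrightarrow> card (supp x) \<le> card (supp b)"
  shows "acyclic_below {y. (p, y) \<in> r \<and> y \<noteq> p \<and> y \<notin> \<sigma> \<and> (\<forall>s\<in>\<sigma>. comparable y s)}
    (card (supp b) - card (supp p) - card \<sigma>)"
  using assms(1,2)
proof (induction "card \<sigma>" arbitrary: p \<sigma>)
  case 0
  then have "\<sigma> = {}"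
    by (simp add: order_complex_iff)
  moreover have "acyclic_below (upper p {}) (card (supp b) - card (supp p))"
    using 0 b by (intro upper_acyclic[of p "{}" b]) auto
  ultimately show ?case
    by (simp add: upper_def)
next
  case (Suc k)
  then have "\<sigma> \<noteq> {}"
    by auto
  then obtain x where x: "x \<in> \<sigma>" "\<And>s. s \<in> \<sigma> \<Longrightarrow> (x, s) \<in> r"
    using simplex_min[OF Suc.prems(2)] by blast
  define \<sigma>' where "\<sigma>' = \<sigma> - {x}"
  have fin: "finite \<sigma>" and px: "(p, x) \<in> r" "p \<noteq> x"
    using Suc.prems(2) x by (auto simp: order_complex_iff)
  have xP: "x \<in> P"
    using px in_P by blast
  have k: "k = card \<sigma>'"
    using Suc.hyps(2) fin x by (simp add: \<sigma>'_def)
  let ?T = "{y. (x, y) \<in> r \<and> y \<noteq> x \<and> y \<notin> \<sigma>' \<and> (\<forall>s\<in>\<sigma>'. comparable y s)}"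
  have "\<sigma>' \<in> order_complex {y. (x, y) \<in> r \<and> y \<noteq> x} r"
    using Suc.prems(2) x by (auto simp: order_complex_iff \<sigma>'_def)
  then have T: "acyclic_below ?T (card (supp b) - card (supp x) - k)"
    using Suc.hyps(1)[OF k xP] k by simp
  obtain j where j: "card (supp x) = card (supp p) + Suc j"
    using less_imp_Suc_add[OF card_supp_less[OF px]] by auto
  have "acyclic_below (interval p x \<union> ?T) (card (supp b) - card (supp x) - k + j)"
  proof (rule interval_join_acyclic[OF px(1) _ _ T j])
    show "?T \<subseteq> P"
      using in_P(2)[of x] by blast
  qed simp
  moreover have "interval p x \<union> ?T = {y. (p, y) \<in> r \<and> y \<noteq> p \<and> y \<notin> \<sigma> \<and> (\<forall>s\<in>\<sigma>. comparable y s)}"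
    (is "_ = ?R")
  proof (intro equalityI subsetI)
    fix y assume "y \<in> interval p x \<union> ?T"
    then consider "y \<in> interval p x" | "y \<in> ?T"
      by blast
    then show "y \<in> ?R"
    proof cases
      case 1
      then have y: "(p, y) \<in> r" "y \<noteq> p" "(y, x) \<in> r" "y \<noteq> x"
        by (auto simp: interval_def)
      then have "y \<notin> \<sigma>"
        using x antisym by blast
      then show ?thesis
        using y x trans by blast
    next
      case 2
      then have y: "(x, y) \<in> r" "y \<noteq> x" "y \<notin> \<sigma>" "\<forall>s\<in>\<sigma>. comparable y s"
        by (auto simp: \<sigma>'_def)
      then show ?thesis
        using px trans antisym by blast
    qed
  next
    fix y assume y: "y \<in> ?R"
    then have "comparable y x" "y \<noteq> x"
      using x by auto
    then show "y \<in> interval p x \<union> ?T"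
      using y by (auto simp: interval_def \<sigma>'_def)
  qed
  \<comment> \<open>An equality, except where truncated subtraction enlarges the right side.\<close>
  moreover have "card (supp b) - card (supp p) - card \<sigma> \<le> card (supp b) - card (supp x) - k + j"
    using j Suc.hyps(2) by simp
  ultimately show ?case
    using acyclic_below_mono by simp
qed

text \<open>Label numbers increase strictly along a chain. This bounds the dimension of links from
  above.\<close>

lemma card_simplex_le:
  assumes "p \<in> P" and \<sigma>: "\<sigma> \<in> order_complex {x. (p, x) \<in> r \<and> x \<noteq> p} r"
    and b: "\<And>x. x \<in> P \<Longrightarrow> card (supp x) \<le> card (supp b)"
  shows "card \<sigma> \<le> card (supp b) - card (supp p)"
proof -
  have s: "(p, x) \<in> r" "p \<noteq> x" if "x \<in> \<sigma>" for x
    using that \<sigma> by (auto simp: order_complex_iff)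
  have sP: "x \<in> P" if "x \<in> \<sigma>" for x
    using s(1)[OF that] in_P by blast
  have "inj_on (\<lambda>x. card (supp x)) \<sigma>"
  proof (rule inj_onI)
    fix x y assume xy: "x \<in> \<sigma>" "y \<in> \<sigma>" "card (supp x) = card (supp y)"
    then have "comparable x y"
      using \<sigma> by (auto simp: order_complex_iff)
    then show "x = y"
      using xy card_supp_less by force
  qed
  then have "card \<sigma> = card ((\<lambda>x. card (supp x)) ` \<sigma>)"
    by (simp add: card_image)
  also have "\<dots> \<le> card {card (supp p)<..card (supp b)}"
    using s sP b card_supp_less by (intro card_mono) auto
  finally show ?thesis
    by simp
qed

end

subsection \<open>Cohen--Macaulayness of the face poset\<close>

lemma trivial_group_Mod_self:
  assumes "comm_group C" "subgroup Z C"
  shows "trivial_group (subgroup_generated C Z Mod Z)"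
proof -
  interpret C: comm_group C
    by (rule assms(1))
  interpret Z: subgroup Z C
    by (rule assms(2))
  let ?H = "subgroup_generated C Z"
  have H: "comm_group ?H" "carrier ?H = Z"
    using C.abelian_subgroup_generated assms by auto
  interpret H: comm_group ?H
    by (rule H(1))
  have Z: "subgroup Z ?H"
    using H.subgroup_self H(2) by simp
  have "carrier (?H Mod Z) = (\<lambda>x. Z) ` Z"
    unfolding carrier_FactGroup H(2) using H.coset_join2[OF _ Z] H(2) by (intro image_cong) auto
  also have "\<dots> = {Z}"
    using Z.one_closed by blast
  finally show ?thesis
    using normal.factorgroup_is_group[OF H.subgroup_imp_normal[OF Z]] by (simp add: trivial_group_def)
qed

lemma comm_group_chain_group: "comm_group (simplicial_chain_group \<Delta> i)"
proof (rule comm_groupI)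
  let ?C = "simplicial_chain_group \<Delta> i :: ('a set \<Rightarrow>\<^sub>0 'b::field) monoid"
  show "x \<otimes>\<^bsub>?C\<^esub> y \<in> carrier ?C" if "x \<in> carrier ?C" "y \<in> carrier ?C" for x y
    using that Poly_Mapping.keys_add[of x y] by (auto simp: simplicial_chain_group_def)
  show "\<exists>y\<in>carrier ?C. y \<otimes>\<^bsub>?C\<^esub> x = \<one>\<^bsub>?C\<^esub>" if "x \<in> carrier ?C" for x
    using that by (intro bexI[of _ "- x"]) (auto simp: simplicial_chain_group_def)
qed (auto simp: simplicial_chain_group_def algebra_simps)

section \<open>From coefficient functions to reduced homology groups\<close>

context finite_order
begin

text \<open>Both sides run over pairs of a simplex and a vertex v whose removal leaves \<tau>. The
  sign in the definition skips v explicitly; in \<open>pos_sign\<close> this is automatic, as v is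
  not in \<tau>.\<close>

lemma lookup_simplicial_boundary:
  fixes c :: "'a set \<Rightarrow>\<^sub>0 'k"
  assumes c: "Poly_Mapping.keys c \<subseteq> order_complex A r" and A: "A \<subseteq> V"
  shows "Poly_Mapping.lookup (simplicial_boundary r c) \<tau> = bd (Poly_Mapping.lookup c) \<tau>"
proof -
  let ?c = "Poly_Mapping.lookup c" and ?K = "Poly_Mapping.keys c"
  let ?g = "\<lambda>\<sigma> v. (-1) ^ card {u \<in> \<sigma>. u \<noteq> v \<and> (u, v) \<in> r} * ?c \<sigma>"
  let ?P = "{(\<sigma>, v). \<sigma> \<in> ?K \<and> v \<in> \<sigma> \<and> \<sigma> - {v} = \<tau>}"
  let ?S = "{v \<in> V - \<tau>. insert v \<tau> \<in> ?K}"
  have K: "finite \<sigma>" "\<sigma> \<subseteq> V" if "\<sigma> \<in> ?K" for \<sigma>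
    using subsetD[OF c that] A by (auto simp: order_complex_iff)
  have fin: "finite (Sigma ?K (\<lambda>\<sigma>. \<sigma>))"
    using K by (intro finite_SigmaI) auto
  have "Poly_Mapping.lookup (simplicial_boundary r c) \<tau> = (\<Sum>\<sigma>\<in>?K. \<Sum>v\<in>\<sigma>. if \<sigma> - {v} = \<tau> then ?g \<sigma> v else 0)"
    unfolding simplicial_boundary_def Poly_Mapping.lookup_sum by (simp add: Poly_Mapping.lookup_single when_def)
  also have "\<dots> = (\<Sum>(\<sigma>, v)\<in>Sigma ?K (\<lambda>\<sigma>. \<sigma>). if \<sigma> - {v} = \<tau> then ?g \<sigma> v else 0)"
    using K by (intro sum.Sigma) auto
  also have "\<dots> = (\<Sum>(\<sigma>, v)\<in>?P. ?g \<sigma> v)"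
    by (rule sum.mono_neutral_cong_right[OF fin]) (auto split: if_splits)
  also have "\<dots> = (\<Sum>v\<in>?S. pos_sign \<tau> v * ?c (insert v \<tau>))"
  proof (rule sum.reindex_bij_witness[where i = "\<lambda>v. (insert v \<tau>, v)" and j = snd])
    fix a assume a: "a \<in> ?P"
    then obtain \<sigma> v where \<sigma>: "a = (\<sigma>, v)" "\<sigma> \<in> ?K" "v \<in> \<sigma>" "\<tau> = \<sigma> - {v}"
      by auto
    then have ins: "insert v \<tau> = \<sigma>" "v \<notin> \<tau>"
      by auto
    show "(insert (snd a) \<tau>, snd a) = a" "snd a \<in> ?S"
      using \<sigma> ins K[OF \<sigma>(2)] by auto
    have "{u \<in> \<sigma>. u \<noteq> v \<and> (u, v) \<in> r} = {u \<in> \<tau>. (u, v) \<in> r}"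
      using \<sigma>(4) by auto
    then show "pos_sign \<tau> (snd a) * ?c (insert (snd a) \<tau>) = (case a of (\<sigma>, v) \<Rightarrow> ?g \<sigma> v)"
      using \<sigma>(1) ins by (simp add: pos_sign_def)
  qed auto
  also have "\<dots> = bd ?c \<tau>"
    unfolding bd_def using finite_V
    by (intro sum.mono_neutral_left) (auto simp: Poly_Mapping.in_keys_iff)
  finally show ?thesis .
qed

text \<open>Used in contrapositive: a nonzero coefficient of a boundary exhibits a coface of \<tau>,
  so boundaries are again supported on the complex.\<close>

lemma bd_outside:
  assumes "chain_on A n c" "\<not> (\<exists>v\<in>V - \<tau>. insert v \<tau> \<in> order_complex A r \<and> Suc (card \<tau>) = n)"
  shows "bd c \<tau> = 0"
  unfolding bd_def
proof (rule sum.neutral, rule ballI)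
  fix v assume v: "v \<in> V - \<tau>"
  have "c (insert v \<tau>) = 0"
  proof (rule ccontr)
    assume "c (insert v \<tau>) \<noteq> 0"
    then have "insert v \<tau> \<in> order_complex A r" "card (insert v \<tau>) = n"
      using chain_onD[OF assms(1)] by blast+
    then show False
      using assms(2) v by (auto simp: order_complex_iff)
  qed
  then show "pos_sign \<tau> v * c (insert v \<tau>) = 0"
    by simp
qed

lemma trivial_reduced_homology:
  assumes A: "A \<subseteq> V" and bounds: "\<And>n. int n = i + 1 \<Longrightarrow> bounds A A n"
  shows "trivial_group (reduced_homology_group r (order_complex A r) i :: ('a set \<Rightarrow>\<^sub>0 'k) set monoid)"
proof -
  let ?\<Delta> = "order_complex A r"
  let ?C = "\<lambda>i. simplicial_chain_group ?\<Delta> i :: ('a set \<Rightarrow>\<^sub>0 'k) monoid"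
  let ?Z = "simplicial_cycles r ?\<Delta> i :: ('a set \<Rightarrow>\<^sub>0 'k) set"
  let ?lookup = "Poly_Mapping.lookup :: ('a set \<Rightarrow>\<^sub>0 'k) \<Rightarrow> 'a set \<Rightarrow> 'k"
  have C: "c \<in> carrier (?C j) \<longleftrightarrow> (\<forall>\<sigma>. ?lookup c \<sigma> \<noteq> 0 \<longrightarrow> \<sigma> \<in> ?\<Delta> \<and> int (card \<sigma>) = j + 1)" for c j
    by (auto simp: simplicial_chain_group_def Poly_Mapping.in_keys_iff)
  have C_chain: "c \<in> carrier (?C j) \<longleftrightarrow> chain_on A n (?lookup c)" if "int n = j + 1" for c j n
    using that by (auto simp: C chain_on_def simp flip: that)
  have lookup_bd: "?lookup (simplicial_boundary r c) \<tau> = bd (?lookup c) \<tau>" if "c \<in> carrier (?C j)" for c j \<tau>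
    using that by (intro lookup_simplicial_boundary[OF _ A]) (auto simp: simplicial_chain_group_def)
  have Z: "c \<in> ?Z \<longleftrightarrow> c \<in> carrier (?C i) \<and> (\<forall>\<tau>. bd (?lookup c) \<tau> = 0)" for c
    using lookup_bd[of c i] by (auto simp: simplicial_cycles_def poly_mapping_eq_iff fun_eq_iff)
  interpret C: comm_group "?C i"
    by (rule comm_group_chain_group)
  have inv: "inv\<^bsub>?C i\<^esub> c = - c" if "c \<in> carrier (?C i)" for c
    using that by (intro C.inv_equality) (auto simp: simplicial_chain_group_def)
  have sub: "subgroup ?Z (?C i)"
  proof (rule C.subgroupI)
    show "?Z \<subseteq> carrier (?C i)"
      using Z by blast
    have "0 \<in> ?Z"
      by (auto simp: Z C bd_def)
    then show "?Z \<noteq> {}"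
      by blast
    show "inv\<^bsub>?C i\<^esub> a \<in> ?Z" if "a \<in> ?Z" for a
      using that inv[of a] by (auto simp: Z C bd_def sum_negf)
    show "a \<otimes>\<^bsub>?C i\<^esub> b \<in> ?Z" if "a \<in> ?Z" "b \<in> ?Z" for a b
    proof -
      have "a \<otimes>\<^bsub>?C i\<^esub> b = a + b"
        by (simp add: simplicial_chain_group_def)
      moreover have "a \<otimes>\<^bsub>?C i\<^esub> b \<in> carrier (?C i)"
        using that Z by blast
      moreover have "?lookup (a + b) = (\<lambda>\<sigma>. ?lookup a \<sigma> + ?lookup b \<sigma>)"
        by (simp add: fun_eq_iff Poly_Mapping.lookup_add)
      ultimately show ?thesis
        using that bd_add unfolding Z by simp
    qed
  qed
  have "(simplicial_boundaries r ?\<Delta> i :: ('a set \<Rightarrow>\<^sub>0 'k) set) = ?Z"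
  proof (intro equalityI subsetI)
    fix z :: "'a set \<Rightarrow>\<^sub>0 'k" assume "z \<in> simplicial_boundaries r ?\<Delta> i"
    then obtain c where c: "c \<in> carrier (?C (i + 1))" "z = simplicial_boundary r c"
      by (auto simp: simplicial_boundaries_def)
    have z: "?lookup z = bd (?lookup c)"
      using lookup_bd[OF c(1)] c(2) by (simp add: fun_eq_iff)
    show "z \<in> ?Z"
    \<comment> \<open>\<open>bd_bd\<close> speaks of natural numbers of vertices; for smaller i
      there are no chains of degree i + 1 but 0.\<close>
    proof (cases "i + 1 + 1 \<ge> 0")
      case True
      then obtain n where n: "int n = i + 1 + 1"
        using nonneg_int_cases by metis
      then have cc: "chain_on A n (?lookup c)"
        using C_chain c by blast
      have "bd (?lookup z) \<tau> = 0" for \<tau>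
      \<comment> \<open>An infinite \<tau> has no coface in the complex, so every coefficient
        vanishes.\<close>
      proof (cases "finite \<tau>")
        case True
        then show ?thesis
          unfolding z using bd_bd[OF cc] by blast
      next
        case False
        then have "?lookup c (insert v (insert w \<tau>)) = 0" for v w
          using chain_onD[OF cc, of "insert v (insert w \<tau>)"] by (auto simp: order_complex_iff)
        then show ?thesis
          unfolding z by (simp add: bd_def)
      qed
      moreover have "\<sigma> \<in> ?\<Delta> \<and> int (card \<sigma>) = i + 1" if nz: "?lookup z \<sigma> \<noteq> 0" for \<sigma>
      proof -
        obtain v where "insert v \<sigma> \<in> ?\<Delta>" "Suc (card \<sigma>) = n"
          using bd_outside[OF cc, of \<sigma>] nz unfolding z by blast
        then show ?thesis
          using n order_complex_subset[of "insert v \<sigma>" A r \<sigma>] by auto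
      qed
      ultimately show ?thesis
        by (auto simp: Z C)
    next
      case False
      have "?lookup c \<sigma> = 0" for \<sigma>
        using C[of c "i + 1"] c(1) False by fastforce
      then have "?lookup z \<sigma> = 0" for \<sigma>
        unfolding z by (simp add: bd_def)
      then show ?thesis
        by (simp add: Z C bd_def)
    qed
  next
    fix z assume z: "z \<in> ?Z"
    show "z \<in> simplicial_boundaries r ?\<Delta> i"
    proof (cases "i + 1 \<ge> 0")
      case True
      then obtain n where n: "int n = i + 1"
        using nonneg_int_cases by metis
      then have "chain_on A n (?lookup z)"
        using C_chain z Z by blast
      then obtain y where y: "chain_on A (Suc n) y" "\<And>\<tau>. bd y \<tau> = ?lookup z \<tau>"
        using bounds[OF n] z unfolding bounds_def Z by blast
      \<comment> \<open>Finite support turns the filling into a \<open>poly_mapping\<close>.\<close>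
      have "finite {\<sigma>. y \<sigma> \<noteq> 0}"
      proof (rule finite_subset)
        show "{\<sigma>. y \<sigma> \<noteq> 0} \<subseteq> Pow V"
        proof
          fix \<sigma> assume "\<sigma> \<in> {\<sigma>. y \<sigma> \<noteq> 0}"
          then show "\<sigma> \<in> Pow V"
            using chain_onD[OF y(1), of \<sigma>] A by (auto simp: order_complex_iff)
        qed
      qed (simp add: finite_V)
      then have y': "?lookup (Abs_poly_mapping y) = y"
        by (simp add: Abs_poly_mapping_inverse)
      then have c: "Abs_poly_mapping y \<in> carrier (?C (i + 1))"
        using y(1) n by (subst C_chain[of "Suc n"]) auto
      have "simplicial_boundary r (Abs_poly_mapping y) = z"
        by (rule poly_mapping_eqI) (simp add: lookup_bd[OF c] y' y(2))
      then show ?thesis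
        using c by (auto simp: simplicial_boundaries_def)
    next
      case False
      then have "?lookup z \<sigma> = 0" for \<sigma>
        using z C[of z i] Z[of z] by fastforce
      then have "z = 0"
        by (simp add: poly_mapping_eqI)
      moreover have "simplicial_boundary r (0 :: 'a set \<Rightarrow>\<^sub>0 'k) = 0"
        by (simp add: simplicial_boundary_def)
      moreover have "(0 :: 'a set \<Rightarrow>\<^sub>0 'k) \<in> carrier (?C (i + 1))"
        by (simp add: C)
      ultimately show ?thesis
        unfolding simplicial_boundaries_def by (metis image_eqI)
    qed
  qed
  then show ?thesis
    using trivial_group_Mod_self[OF comm_group_chain_group sub] by (simp add: reduced_homology_group_def)
qed

end

lemma simplicial_boundary_cong:
  assumes "Poly_Mapping.keys c \<subseteq> \<Delta>" "\<And>\<sigma> u v. \<sigma> \<in> \<Delta> \<Longrightarrow> u \<in> \<sigma> \<Longrightarrow> v \<in> \<sigma> \<Longrightarrow> (u, v) \<in> r \<longleftrightarrow> (u, v) \<in> r'"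
  shows "simplicial_boundary r c = simplicial_boundary r' c"
  unfolding simplicial_boundary_def
proof (intro sum.cong HOL.refl)
  fix \<sigma> v assume "\<sigma> \<in> Poly_Mapping.keys c" "v \<in> \<sigma>"
  then have "{u \<in> \<sigma>. u \<noteq> v \<and> (u, v) \<in> r} = {u \<in> \<sigma>. u \<noteq> v \<and> (u, v) \<in> r'}"
    using assms by blast
  then show "Poly_Mapping.single (\<sigma> - {v}) ((- 1) ^ card {u \<in> \<sigma>. u \<noteq> v \<and> (u, v) \<in> r} * Poly_Mapping.lookup c \<sigma>) =
    Poly_Mapping.single (\<sigma> - {v}) ((- 1) ^ card {u \<in> \<sigma>. u \<noteq> v \<and> (u, v) \<in> r'} * Poly_Mapping.lookup c \<sigma>)"
    by simp
qed

text \<open>Signs only compare vertices of one face. This passes between the order of the whole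
  poset and its restriction to the proper part.\<close>

lemma reduced_homology_group_cong:
  assumes "\<And>\<sigma> u v. \<sigma> \<in> \<Delta> \<Longrightarrow> u \<in> \<sigma> \<Longrightarrow> v \<in> \<sigma> \<Longrightarrow> (u, v) \<in> r \<longleftrightarrow> (u, v) \<in> r'"
  shows "reduced_homology_group r \<Delta> i = reduced_homology_group r' \<Delta> i"
proof -
  have "simplicial_boundary r c = simplicial_boundary r' c" if "c \<in> carrier (simplicial_chain_group \<Delta> j)"
    for c :: "'a set \<Rightarrow>\<^sub>0 'b::field" and j
    using that assms by (intro simplicial_boundary_cong[of c \<Delta>]) (auto simp: simplicial_chain_group_def)
  then have "(simplicial_cycles r \<Delta> i :: ('a set \<Rightarrow>\<^sub>0 'b) set) = simplicial_cycles r' \<Delta> i"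
    "(simplicial_boundaries r \<Delta> i :: ('a set \<Rightarrow>\<^sub>0 'b) set) = simplicial_boundaries r' \<Delta> i"
    by (auto simp: simplicial_cycles_def simplicial_boundaries_def cong: image_cong)
  then show ?thesis
    by (simp add: reduced_homology_group_def)
qed

text \<open>The link of a chain is the order complex of the cells outside it that are comparable
  with all its vertices, so \<open>link_acyclic\<close> applies with the bottom cell as p.\<close>

theorem (in labelled_cells) cohen_macaulay_proper_part:
  assumes bot: "z \<in> P" "\<And>x. x \<in> P \<Longrightarrow> (z, x) \<in> r" "supp z = {}"
    and r': "r' = r \<inter> (P - {z}) \<times> (P - {z})"
  shows "cohen_macaulay F (P - {z}) r'"
proof -
  let ?P = "P - {z}"
  obtain b where b: "b \<in> P" "\<And>x. x \<in> P \<Longrightarrow> card (supp x) \<le> card (supp b)"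
  proof -
    have "finite ((\<lambda>x. card (supp x)) ` P)" "(\<lambda>x. card (supp x)) ` P \<noteq> {}"
      using finite_V bot by auto
    then show thesis
      using that Max_in[of "(\<lambda>x. card (supp x)) ` P"] Max_ge[of "(\<lambda>x. card (supp x)) ` P"] by fastforce
  qed
  have above: "{x. (z, x) \<in> r \<and> x \<noteq> z} = ?P"
    using bot in_P by blast
  have OC: "order_complex ?P r' = order_complex ?P r"
  proof (rule Set.set_eqI)
    show "\<sigma> \<in> order_complex ?P r' \<longleftrightarrow> \<sigma> \<in> order_complex ?P r" for \<sigma>
      unfolding order_complex_iff r' by blast
  qed
  have card_le: "card \<sigma> \<le> card (supp b)" if "\<sigma> \<in> order_complex ?P r" for \<sigma>
    using card_simplex_le[of z \<sigma> b] that b bot above by simp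
  have "partial_order_on ?P r'"
    using po unfolding r' partial_order_on_def preorder_on_def refl_on_def trans_def antisym_def by blast
  then have fl: "finite_length_poset ?P r'"
    using card_le by (auto simp: finite_length_poset_def OC)
  have "trivial_group (reduced_homology_group r' (link (order_complex ?P r') \<sigma>) i :: ('a set \<Rightarrow>\<^sub>0 'k) set monoid)"
    if \<sigma>: "\<sigma> \<in> order_complex ?P r'" and i: "i < complex_dim (link (order_complex ?P r') \<sigma>)" for \<sigma> i
  proof -
    let ?T = "{y. (z, y) \<in> r \<and> y \<noteq> z \<and> y \<notin> \<sigma> \<and> (\<forall>s\<in>\<sigma>. comparable y s)}"
    let ?L = "link (order_complex ?P r) \<sigma>"
    have \<sigma>': "\<sigma> \<in> order_complex ?P r"
      using \<sigma> OC by simp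
    have TP: "?T \<subseteq> ?P"
      using above by blast
    have L: "?L = order_complex ?T r"
    proof (intro equalityI subsetI)
      fix \<tau> assume "\<tau> \<in> ?L"
      then have \<tau>: "\<tau> \<inter> \<sigma> = {}" "\<tau> \<union> \<sigma> \<in> order_complex ?P r" "\<tau> \<in> order_complex ?P r"
        by (auto simp: link_def)
      have "\<tau> \<subseteq> ?T"
      proof
        fix y assume y: "y \<in> \<tau>"
        then have "y \<in> ?P" "y \<notin> \<sigma>"
          using \<tau> by (auto simp: order_complex_iff)
        moreover have "comparable y s" if "s \<in> \<sigma>" for s
          using \<tau>(2) y that unfolding order_complex_iff by blast
        ultimately show "y \<in> ?T"
          using above by blast
      qed
      then show "\<tau> \<in> order_complex ?T r"
        using \<tau>(3) by (simp add: order_complex_iff)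
    next
      fix \<tau> assume \<tau>: "\<tau> \<in> order_complex ?T r"
      then have "\<tau> \<in> order_complex ?P r"
        using order_complex_mono[OF TP] by blast
      moreover have "\<tau> \<inter> \<sigma> = {}"
        using \<tau> by (auto simp: order_complex_iff)
      moreover have "\<tau> \<union> \<sigma> \<in> order_complex ?P r"
      proof -
        have "comparable y s" if "y \<in> \<tau>" "s \<in> \<sigma>" for y s
          using \<tau> that by (auto simp: order_complex_iff)
        then show ?thesis
          using \<sigma>' \<open>\<tau> \<in> order_complex ?P r\<close> unfolding order_complex_iff by blast
      qed
      ultimately show "\<tau> \<in> ?L"
        by (simp add: link_def)
    qed
    have "finite ?L" "?L \<noteq> {}"
    proof -
      have "?L \<subseteq> Pow P"
        by (auto simp: link_def order_complex_iff)
      then show "finite ?L"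
        using finite_V finite_subset by blast
      have "{} \<in> ?L"
        using \<sigma>' by (simp add: link_def order_complex_iff)
      then show "?L \<noteq> {}"
        by blast
    qed
    then have "complex_dim ?L \<in> (\<lambda>\<tau>. int (card \<tau>) - 1) ` ?L"
      unfolding complex_dim_def by (intro Max_in) auto
    then obtain \<tau> where \<tau>: "\<tau> \<in> ?L" "complex_dim ?L = int (card \<tau>) - 1"
      by blast
    \<comment> \<open>A largest face of the link forms a chain together with \<sigma>, so the
      degrees below the dimension of the link are within the range of
      \<open>link_acyclic\<close>.\<close>
    have "card \<tau> + card \<sigma> = card (\<tau> \<union> \<sigma>)"
      using \<tau>(1) \<sigma>' by (subst card_Un_disjoint) (auto simp: link_def order_complex_iff)
    also have "\<dots> \<le> card (supp b)"
      using \<tau>(1) card_le by (simp add: link_def)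
    finally have n: "n < card (supp b) - card \<sigma>" if "int n = i + 1" for n
      using i \<tau>(2) that by (simp add: OC)
    have "acyclic_below ?T (card (supp b) - card (supp z) - card \<sigma>)"
      using \<sigma>' b bot above by (intro link_acyclic) auto
    then have "trivial_group (reduced_homology_group r ?L i :: ('a set \<Rightarrow>\<^sub>0 'k) set monoid)"
      unfolding L using n TP bot by (intro trivial_reduced_homology) (auto simp: acyclic_below_def)
    moreover have "reduced_homology_group r' ?L i = (reduced_homology_group r ?L i :: ('a set \<Rightarrow>\<^sub>0 'k) set monoid)"
    proof (rule reduced_homology_group_cong)
      fix \<tau> u v assume "\<tau> \<in> ?L" "u \<in> \<tau>" "v \<in> \<tau>"
      then have "u \<in> ?P" "v \<in> ?P"
        by (auto simp: link_def order_complex_iff)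
      then show "(u, v) \<in> r' \<longleftrightarrow> (u, v) \<in> r"
        by (simp add: r')
    qed
    ultimately show ?thesis
      by (simp add: OC)
  qed
  then show ?thesis
    using fl by (simp add: cohen_macaulay_def)
qed

subsection \<open>Independent sets of translative semimatroids\<close>

lemma (in group) prime_dvd_exponent:
  fixes n :: nat
  assumes "finite (carrier G)" "prime p" "p dvd order G" and n: "\<And>x. x \<in> carrier G \<Longrightarrow> x [^] n = \<one>"
  shows "p dvd n"
proof -
  \<comment> \<open>Sylow's theorem with exponent 1 is Cauchy's theorem. A nontrivial element of the
    subgroup has order p, and this order divides n.\<close>
  obtain m where "order G = p ^ 1 * m"
    using assms(3) by auto
  then obtain H where H: "subgroup H G" "card H = p"
    using sylow_thm[OF assms(2) group_axioms _ assms(1)] by (metis power_one_right)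
  have "H \<noteq> {\<one>}"
    using H assms(2) not_prime_1 by fastforce
  then obtain h where h: "h \<in> H" "h \<noteq> \<one>"
    using subgroup.one_closed[OF H(1)] by blast
  have hG: "h \<in> carrier G"
    using subgroup.mem_carrier[OF H(1) h(1)] .
  have "h [^] p = \<one>"
    using group.pow_order_eq_1[OF subgroup_imp_group[OF H(1)], of h] h(1) H(2)
    by (simp add: order_def flip: nat_pow_consistent)
  then have "ord h dvd p" "ord h dvd n"
    using pow_eq_id[OF hG] n[OF hG] by auto
  moreover have "ord h \<noteq> 1"
    using ord_eq_1[OF hG] h by simp
  ultimately show ?thesis
    using assms(2) by (metis prime_nat_iff)
qed

lemma (in comm_group) prime_dvd_index:
  fixes n :: nat
  assumes M: "subgroup M G" and N: "subgroup N G" "N \<subseteq> M"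
    and fin: "finite ((\<lambda>g. N #> g) ` M)" and p: "prime p" "p dvd card ((\<lambda>g. N #> g) ` M)"
    and n: "\<And>g. g \<in> M \<Longrightarrow> g [^] n \<in> N"
  shows "p dvd n"
proof -
  let ?H = "G\<lparr>carrier := M\<rparr>"
  interpret H: comm_group ?H
    using subgroup.mem_carrier[OF M] m_comm
    by (intro group.group_comm_groupI[OF subgroup_imp_group[OF M]]) auto
  have N': "subgroup N ?H"
    using subgroup_incl[OF N(1) M N(2)] .
  interpret N: normal N ?H
    using H.subgroup_imp_normal[OF N'] .
  have Q: "carrier (?H Mod N) = (\<lambda>g. N #> g) ` M"
    by (simp add: carrier_FactGroup r_coset_def)
  show ?thesis
  proof (rule group.prime_dvd_exponent[OF N.factorgroup_is_group _ p(1)])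
    show "finite (carrier (?H Mod N))" "p dvd order (?H Mod N)"
      using fin p(2) by (simp_all add: Q order_def)
    fix x assume "x \<in> carrier (?H Mod N)"
    then obtain g where g: "g \<in> M" "x = N #>\<^bsub>?H\<^esub> g"
      by (auto simp: carrier_FactGroup)
    have "x [^]\<^bsub>?H Mod N\<^esub> n = N #>\<^bsub>?H\<^esub> (g [^]\<^bsub>?H\<^esub> n)"
      using N.FactGroup_pow[of g n] g by simp
    also have "\<dots> = N"
      using n[OF g(1)] N(2) by (intro H.coset_join2[OF _ N']) (auto simp flip: nat_pow_consistent)
    finally show "x [^]\<^bsub>?H Mod N\<^esub> n = \<one>\<^bsub>?H Mod N\<^esub>"
      by simp
  qed
qed

text \<open>\<open>card\<close> is 0 on infinite sets, so the last hypothesis says that the index is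
  finite.\<close>

lemma (in comm_group) pow_index_closed:
  assumes T: "subgroup T G" and q: "q \<in> carrier G" and fin: "card (rcosets T) \<noteq> 0"
  shows "q [^] card (rcosets T) \<in> T"
proof -
  interpret T: normal T G
    using subgroup_imp_normal[OF T] .
  have "(T #> q) [^]\<^bsub>G Mod T\<^esub> order (G Mod T) = \<one>\<^bsub>G Mod T\<^esub>"
    using q by (intro group.pow_order_eq_1[OF T.factorgroup_is_group]) (auto simp: carrier_FactGroup)
  moreover have "order (G Mod T) = card (rcosets T)"
    by (simp add: order_def FactGroup_def)
  ultimately have "T #> (q [^] card (rcosets T)) = T"
    using T.FactGroup_pow[OF q] by simp
  then show ?thesis
    using coset_join1[OF _ _ T] q by simp
qed

lemma card_image_eq_of_same_kernel:
  assumes "\<And>g h. g \<in> A \<Longrightarrow> h \<in> A \<Longrightarrow> f g = f h \<longleftrightarrow> f' g = f' h"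
  shows "card (f ` A) = card (f' ` A)" "finite (f ` A) \<Longrightarrow> finite (f' ` A)"
proof -
  have "bij_betw (\<lambda>y. f' (inv_into A f y)) (f ` A) (f' ` A)"
  proof (rule bij_betw_imageI)
    show "inj_on (\<lambda>y. f' (inv_into A f y)) (f ` A)"
      using assms by (intro inj_onI) (metis f_inv_into_f inv_into_into)
    have "f' (inv_into A f (f a)) = f' a" if "a \<in> A" for a
      using assms that by (metis f_inv_into_f imageI inv_into_into)
    then show "(\<lambda>y. f' (inv_into A f y)) ` f ` A = f' ` A"
      by (force simp: image_iff)
  qed
  then show "card (f ` A) = card (f' ` A)" "finite (f ` A) \<Longrightarrow> finite (f' ` A)"
    by (auto dest: bij_betw_same_card bij_betw_finite)
qed

section \<open>Independence depends only on the orbits\<close>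

context translative_G_semimatroid
begin

abbreviation indep where
  "indep \<equiv> independent_sets K \<rho>"

lemma K_finite: "X \<in> K \<Longrightarrow> finite X"
  using complex by (auto simp: simplicial_complex_def)

lemma K_carrier: "X \<in> K \<Longrightarrow> X \<subseteq> S"
  using complex by (auto simp: simplicial_complex_def)

lemma K_subset: "X \<in> K \<Longrightarrow> Y \<subseteq> X \<Longrightarrow> Y \<in> K"
  using complex by (auto simp: simplicial_complex_def)

lemma indep_K: "X \<in> indep \<Longrightarrow> X \<in> K"
  by (simp add: independent_sets_def)

lemma rank_empty: "\<rho> {} = 0"
proof -
  have "{} \<in> K"
    using nonempty K_subset by blast
  then show ?thesis
    using R1 by fastforce
qed

lemma indep_empty: "{} \<in> indep"
  using nonempty K_subset rank_empty by (auto simp: independent_sets_def)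

lemma indep_subset:
  assumes "X \<in> indep" "Y \<subseteq> X"
  shows "Y \<in> indep"
proof -
  have X: "X \<in> K" "\<rho> X = card X" "finite X"
    using assms K_finite by (auto simp: independent_sets_def)
  then have Y: "Y \<in> K" "X - Y \<in> K"
    using assms K_subset by auto
  have "Y \<union> (X - Y) = X"
    using assms by auto
  then have "\<rho> X \<le> \<rho> Y + \<rho> (X - Y)"
    using R3[OF Y] X rank_empty by simp
  moreover have "card X = card Y + card (X - Y)"
    using X assms by (metis card_Diff_subset card_mono finite_subset le_add_diff_inverse)
  ultimately show ?thesis
    using R1[OF Y(1)] R1[OF Y(2)] X Y by (auto simp: independent_sets_def)
qed

text \<open>CR2 alone may add an element that does not raise the rank. By CR1 and R3 all such
  elements \<open>A\<close> of \<open>Y\<close> can be added to \<open>X\<close> together at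
  constant rank, so CR2 for \<open>X \<union> A\<close> finds an element outside \<open>A\<close>.
  Submodularity bounds the increase by 1.\<close>

lemma rank_augment:
  assumes X: "X \<in> K" and Y: "Y \<in> K" and less: "\<rho> X < \<rho> Y"
  shows "\<exists>y\<in>Y - X. insert y X \<in> K \<and> \<rho> (insert y X) = Suc (\<rho> X)"
proof -
  define A where "A = {y \<in> Y - X. insert y X \<in> K \<and> \<rho> (insert y X) = \<rho> X}"
  have "finite A"
    using K_finite[OF Y] by (simp add: A_def)
  moreover have "B \<subseteq> A \<Longrightarrow> X \<union> B \<in> K \<and> \<rho> (X \<union> B) = \<rho> X" if "finite B" for B
    using that
  proof (induction B)
    case empty
    then show ?case
      using X by simp
  next
    case (insert y B)
    then have B: "X \<union> B \<in> K" "\<rho> (X \<union> B) = \<rho> X" and y: "insert y X \<in> K" "\<rho> (insert y X) = \<rho> X" "y \<notin> X"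
      by (auto simp: A_def)
    have int: "insert y X \<inter> (X \<union> B) = X" and un: "insert y X \<union> (X \<union> B) = X \<union> insert y B"
      using insert.hyps y(3) by auto
    have U: "X \<union> insert y B \<in> K"
      using CR1[OF y(1) B(1)] y(2) unfolding int un by simp
    have "\<rho> (X \<union> insert y B) + \<rho> X \<le> \<rho> X + \<rho> X"
      using R3[OF y(1) B(1)] U y(2) B(2) unfolding int un by simp
    moreover have "\<rho> X \<le> \<rho> (X \<union> insert y B)"
      using R2[OF X U] by auto
    ultimately show ?case
      using U by simp
  qed
  ultimately have A: "X \<union> A \<in> K" "\<rho> (X \<union> A) = \<rho> X"
    by auto
  then obtain y where y: "y \<in> Y - (X \<union> A)" "X \<union> A \<union> {y} \<in> K"
    using CR2[OF A(1) Y] less by auto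
  have yX: "insert y X \<in> K"
    by (rule K_subset[OF y(2)]) auto
  then have "\<rho> (insert y X) \<noteq> \<rho> X"
    using y(1) by (auto simp: A_def)
  moreover have "\<rho> X \<le> \<rho> (insert y X)"
    using R2[OF X yX] by auto
  moreover have "\<rho> (insert y X) \<le> \<rho> X + 1"
  proof -
    have s: "{y} \<in> K"
      by (rule K_subset[OF yX]) auto
    have "\<rho> {y} \<le> 1"
      using R1[OF s] by simp
    moreover have "{y} \<inter> X = {}"
      using y(1) by auto
    ultimately show ?thesis
      using R3[OF s X] yX rank_empty by simp
  qed
  ultimately show ?thesis
    using y(1) yX by (intro bexI[of _ y]) auto
qed

lemma act_mult: "s \<in> S \<Longrightarrow> g \<in> carrier G \<Longrightarrow> h \<in> carrier G \<Longrightarrow> \<phi> (g \<otimes> h) s = \<phi> g (\<phi> h s)"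
  by (rule composition_rule)

lemma act_closed: "g \<in> carrier G \<Longrightarrow> s \<in> S \<Longrightarrow> \<phi> g s \<in> S"
  using element_image by blast

lemma act_one: "s \<in> S \<Longrightarrow> \<phi> \<one> s = s"
  using id_eq_one by (metis restrict_apply')

lemma orbit_iff: "t \<in> orbit G \<phi> s \<longleftrightarrow> (\<exists>g\<in>carrier G. t = \<phi> g s)"
  by (auto simp: orbit_def)

lemma orbit_eq_iff:
  assumes "s \<in> S" "t \<in> S"
  shows "orbit G \<phi> s = orbit G \<phi> t \<longleftrightarrow> (\<exists>g\<in>carrier G. t = \<phi> g s)"
proof
  assume "orbit G \<phi> s = orbit G \<phi> t"
  then show "\<exists>g\<in>carrier G. t = \<phi> g s"
    using orbit_refl[OF assms(2)] orbit_iff by blast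
next
  assume "\<exists>g\<in>carrier G. t = \<phi> g s"
  then have t: "t \<in> orbit G \<phi> s"
    using orbit_iff by blast
  then have s: "s \<in> orbit G \<phi> t"
    using orbit_sym assms by blast
  have sub: "orbit G \<phi> x \<subseteq> S" if "x \<in> S" for x
    using act_closed that by (auto simp: orbit_def)
  show "orbit G \<phi> s = orbit G \<phi> t"
    using orbit_trans s t assms sub by blast
qed

lemma orbit_act: "g \<in> carrier G \<Longrightarrow> s \<in> S \<Longrightarrow> orbit G \<phi> (\<phi> g s) = orbit G \<phi> s"
  using orbit_eq_iff[of s "\<phi> g s"] act_closed by metis

lemma simplex_fixed:
  assumes "X \<in> K" "s \<in> X" "\<phi> g s \<in> X" "g \<in> carrier G"
  shows "\<phi> g s = s"
proof (rule translative)
  show "s \<in> S"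
    using assms K_carrier by blast
  show "{s, \<phi> g s} \<in> K"
    by (rule K_subset[OF assms(1)]) (use assms in auto)
qed (rule assms(4))

lemma orbit_inj: "X \<in> K \<Longrightarrow> inj_on (orbit G \<phi>) X"
proof (rule inj_onI)
  fix s t assume X: "X \<in> K" and st: "s \<in> X" "t \<in> X" "orbit G \<phi> s = orbit G \<phi> t"
  then obtain g where "g \<in> carrier G" "t = \<phi> g s"
    using orbit_eq_iff[of s t] K_carrier[OF X] by blast
  then show "s = t"
    using simplex_fixed[OF X st(1), of g] st(2) by simp
qed

lemma indep_act:
  assumes "g \<in> carrier G" "X \<in> indep"
  shows "\<phi> g ` X \<in> indep"
proof -
  have "card (\<phi> g ` X) = card X"
    using inj_prop[OF assms(1)] K_carrier[OF indep_K[OF assms(2)]] by (meson card_image inj_on_subset)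
  then show ?thesis
    using assms action_complex action_rank by (auto simp: independent_sets_def)
qed

lemma indep_exchange:
  assumes X: "X \<in> indep" and Y: "Y \<in> indep" and less: "card X < card Y"
  shows "\<exists>y\<in>Y - X. insert y X \<in> indep \<and> orbit G \<phi> y \<notin> orbit G \<phi> ` X"
proof -
  have "\<rho> X < \<rho> Y"
    using assms by (auto simp: independent_sets_def)
  then obtain y where y: "y \<in> Y - X" "insert y X \<in> K" "\<rho> (insert y X) = Suc (\<rho> X)"
    using rank_augment X Y indep_K by blast
  have "insert y X \<in> indep"
    using y X K_finite[OF indep_K[OF X]] by (auto simp: independent_sets_def)
  moreover have "orbit G \<phi> y \<notin> orbit G \<phi> ` X"
  proof
    assume "orbit G \<phi> y \<in> orbit G \<phi> ` X"
    then obtain x where "x \<in> X" "orbit G \<phi> y = orbit G \<phi> x"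
      by blast
    then show False
      using inj_onD[OF orbit_inj[OF y(2)], of y x] y(1) by auto
  qed
  ultimately show ?thesis
    using y(1) by blast
qed

text \<open>Exchanging \<open>X - {s}\<close> against \<open>g X\<close> can only bring in \<open>g s\<close>, all other orbits being
  occupied.\<close>
lemma indep_swap:
  assumes X: "X \<in> indep" and s: "s \<in> X" and g: "g \<in> carrier G"
  shows "insert (\<phi> g s) (X - {s}) \<in> indep"
proof -
  have gX: "\<phi> g ` X \<in> indep"
    using indep_act[OF g X] .
  have XS: "X \<subseteq> S" and fin: "finite X"
    using K_carrier K_finite indep_K[OF X] by auto
  have "card (\<phi> g ` X) = card X"
    using inj_prop[OF g] XS by (meson card_image inj_on_subset)
  then have "card (X - {s}) < card (\<phi> g ` X)"
    using card_Diff1_less[OF fin s] by simp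
  then obtain y where y: "y \<in> \<phi> g ` X" "insert y (X - {s}) \<in> indep" "orbit G \<phi> y \<notin> orbit G \<phi> ` (X - {s})"
    using indep_exchange[OF indep_subset[OF X] gX, of "X - {s}"] by auto
  then obtain t where t: "t \<in> X" "y = \<phi> g t"
    by blast
  then have "t = s"
    using y(3) orbit_act[OF g, of t] XS by auto
  then show ?thesis
    using y t by simp
qed

lemma indep_swaps:
  assumes X: "X \<in> indep" and h: "\<And>s. s \<in> X \<Longrightarrow> h s \<in> carrier G" and B: "B \<subseteq> X"
  shows "(\<lambda>s. \<phi> (h s) s) ` B \<union> (X - B) \<in> indep"
proof -
  have XS: "X \<subseteq> S" and fin: "finite X"
    using K_carrier K_finite indep_K[OF X] by auto
  have "finite B"
    using B fin finite_subset by blast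
  then show ?thesis
    using B
  proof (induction B)
    case empty
    then show ?case
      using X by simp
  next
    case (insert s B)
    let ?Y = "(\<lambda>s. \<phi> (h s) s) ` B \<union> (X - B)"
    have "?Y \<in> indep" "s \<in> ?Y"
      using insert by auto
    then have "insert (\<phi> (h s) s) (?Y - {s}) \<in> indep"
      using h insert.prems by (intro indep_swap) auto
    \<comment> \<open>A translate of t that lies in X together with t is t itself, so no earlier
      swap has produced s.\<close>
    moreover have "s \<notin> (\<lambda>s. \<phi> (h s) s) ` B"
    proof
      assume "s \<in> (\<lambda>s. \<phi> (h s) s) ` B"
      then obtain t where t: "t \<in> B" "s = \<phi> (h t) t"
        by blast
      then have "s = t"
        using simplex_fixed[OF indep_K[OF X], of t "h t"] insert.prems h by auto
      then show False
        using t insert.hyps by simp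
    qed
    then have "?Y - {s} = (\<lambda>s. \<phi> (h s) s) ` B \<union> (X - insert s B)"
      by (simp add: Un_Diff Diff_insert[of X s B])
    then have "insert (\<phi> (h s) s) (?Y - {s}) = (\<lambda>s. \<phi> (h s) s) ` insert s B \<union> (X - insert s B)"
      by simp
    ultimately show ?case
      by (simp only:)
  qed
qed

text \<open>Choose for each element of \<open>X\<close> a translation into \<open>Y\<close> and
  swap. That \<open>Y\<close> belongs to \<open>K\<close> is part of the conclusion; this is how
  joins of cells are shown to exist.\<close>

lemma indep_of_same_orbits:
  assumes X: "X \<in> indep" and Y: "Y \<subseteq> S" "inj_on (orbit G \<phi>) Y" and XY: "orbit G \<phi> ` X = orbit G \<phi> ` Y"
  shows "Y \<in> indep"
proof -
  have XS: "X \<subseteq> S"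
    using K_carrier indep_K[OF X] by auto
  have "\<exists>g. g \<in> carrier G \<and> \<phi> g s \<in> Y" if s: "s \<in> X" for s
  proof -
    obtain t where t: "t \<in> Y" "orbit G \<phi> s = orbit G \<phi> t"
      using XY s by (metis (no_types, lifting) image_iff)
    then show ?thesis
      using orbit_eq_iff[of s t] s XS Y by auto
  qed
  then obtain h where h: "\<And>s. s \<in> X \<Longrightarrow> h s \<in> carrier G \<and> \<phi> (h s) s \<in> Y"
    by metis
  have "(\<lambda>s. \<phi> (h s) s) ` X \<union> (X - X) \<in> indep"
    using h by (intro indep_swaps[OF X]) auto
  moreover have "(\<lambda>s. \<phi> (h s) s) ` X = Y"
  proof (intro equalityI subsetI)
    fix t assume t: "t \<in> Y"
    then obtain s where s: "s \<in> X" "orbit G \<phi> s = orbit G \<phi> t"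
      using XY by (metis (no_types, lifting) image_iff)
    then have "orbit G \<phi> (\<phi> (h s) s) = orbit G \<phi> t"
      using orbit_act h XS by auto
    then have "\<phi> (h s) s = t"
      using inj_onD[OF Y(2)] h s t by blast
    then show "t \<in> (\<lambda>s. \<phi> (h s) s) ` X"
      using s by blast
  qed (use h in auto)
  ultimately show ?thesis
    by simp
qed

subsection \<open>The poset of orbits of independent sets\<close>

abbreviation cell where
  "cell X \<equiv> orbit G (set_action \<phi>) X"

abbreviation cells where
  "cells \<equiv> independent_orbits G K \<rho> \<phi>"

abbreviation cell_le where
  "cell_le \<equiv> orbit_order G \<phi> cells"

text \<open>Taken over all members of the orbit, so that no representative is chosen. For
  \<open>X \<subseteq> S\<close> the value on \<open>cell X\<close> is
  \<open>Supp G \<phi> X\<close>.\<close>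

definition labels where
  "labels A = orbit G \<phi> ` \<Union>A"

lemma indep_carrier: "X \<in> indep \<Longrightarrow> X \<subseteq> S"
  using K_carrier indep_K by blast

lemma indep_finite: "X \<in> indep \<Longrightarrow> finite X"
  using K_finite indep_K by blast

lemma indep_orbit_inj: "X \<in> indep \<Longrightarrow> inj_on (orbit G \<phi>) X"
  using orbit_inj indep_K by blast

lemma cells_iff: "A \<in> cells \<longleftrightarrow> (\<exists>X\<in>indep. A = cell X)"
  by (auto simp: independent_orbits_def orbits_def)

lemma mem_cell: "Y \<in> cell X \<longleftrightarrow> (\<exists>g\<in>carrier G. Y = \<phi> g ` X)"
  by (auto simp: orbit_def)

lemma group_G: "group G"
  using group_hom by (simp add: group_hom_def)

lemma image_act: "X \<subseteq> S \<Longrightarrow> g \<in> carrier G \<Longrightarrow> h \<in> carrier G \<Longrightarrow> \<phi> g ` \<phi> h ` X = \<phi> (g \<otimes> h) ` X"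
  unfolding image_image by (rule image_cong) (auto simp: act_mult)

lemma image_act_one: "X \<subseteq> S \<Longrightarrow> \<phi> \<one> ` X = X"
  using act_one by force

lemma cell_self: "X \<subseteq> S \<Longrightarrow> X \<in> cell X"
  unfolding mem_cell using image_act_one group.is_monoid[OF group_G] monoid.one_closed by metis

lemma cell_act:
  assumes "g \<in> carrier G" "X \<subseteq> S"
  shows "cell (\<phi> g ` X) = cell X"
proof -
  interpret group G
    by (rule group_G)
  show ?thesis
  proof (intro equalityI subsetI)
    fix Y assume "Y \<in> cell (\<phi> g ` X)"
    then obtain h where "h \<in> carrier G" "Y = \<phi> h ` \<phi> g ` X"
      by (auto simp only: mem_cell)
    then show "Y \<in> cell X"
      using image_act[OF assms(2) _ assms(1), of h] assms(1) m_closed by (auto simp only: mem_cell)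
  next
    fix Y assume "Y \<in> cell X"
    then obtain h where h: "h \<in> carrier G" "Y = \<phi> h ` X"
      by (auto simp only: mem_cell)
    have "\<phi> (h \<otimes> inv g) ` \<phi> g ` X = Y"
      using image_act[OF assms(2) _ assms(1), of "h \<otimes> inv g"] h assms(1) by (simp add: m_assoc)
    then show "Y \<in> cell (\<phi> g ` X)"
      using h assms(1) unfolding mem_cell by (metis inv_closed m_closed)
  qed
qed

lemma labels_cell:
  assumes "X \<subseteq> S"
  shows "labels (cell X) = orbit G \<phi> ` X"
proof (intro equalityI subsetI)
  fix e assume "e \<in> labels (cell X)"
  then obtain Y s where Y: "Y \<in> cell X" "s \<in> Y" "e = orbit G \<phi> s"
    by (auto simp: labels_def)
  then obtain g where "g \<in> carrier G" "Y = \<phi> g ` X"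
    by (auto simp only: mem_cell)
  then show "e \<in> orbit G \<phi> ` X"
    using Y assms orbit_act by auto
next
  fix e assume "e \<in> orbit G \<phi> ` X"
  then show "e \<in> labels (cell X)"
    using cell_self[OF assms] by (auto simp: labels_def)
qed

text \<open>The upper representative can be prescribed, because the translation in the order can be
  moved to the lower one. \<open>cell_le_above\<close> prescribes the lower one instead.\<close>

lemma cell_le_iff:
  assumes Y: "Y \<in> indep"
  shows "(A, cell Y) \<in> cell_le \<longleftrightarrow> (\<exists>X\<subseteq>Y. A = cell X)"
proof
  interpret group G
    by (rule group_G)
  assume "(A, cell Y) \<in> cell_le"
  then obtain x y g where A: "A \<in> cells" "x \<in> A" "y \<in> cell Y" "g \<in> carrier G" "\<phi> g ` x \<subseteq> y"
    by (auto simp: orbit_order_def)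
  then obtain X where X: "X \<in> indep" "A = cell X"
    by (auto simp: cells_iff)
  obtain h where h: "h \<in> carrier G" "x = \<phi> h ` X"
    using A(2) unfolding X(2) mem_cell by blast
  obtain k where k: "k \<in> carrier G" "y = \<phi> k ` Y"
    using A(3) unfolding mem_cell by blast
  have XS: "X \<subseteq> S" and YS: "Y \<subseteq> S"
    using X Y indep_carrier by auto
  let ?f = "inv k \<otimes> (g \<otimes> h)"
  have "\<phi> ?f ` X = \<phi> (inv k) ` \<phi> g ` x"
    using XS A(4) h k image_act[of X "inv k" "g \<otimes> h"] image_act[of X g h] by simp
  also have "\<dots> \<subseteq> \<phi> (inv k) ` \<phi> k ` Y"
    using A(5) k by blast
  also have "\<dots> = Y"
    using image_act[OF YS, of "inv k" k] k image_act_one[OF YS] by simp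
  finally have "\<phi> ?f ` X \<subseteq> Y" .
  moreover have "cell (\<phi> ?f ` X) = A"
    using cell_act[of ?f X] XS A(4) h k X(2) by simp
  ultimately show "\<exists>X\<subseteq>Y. A = cell X"
    by blast
next
  interpret group G
    by (rule group_G)
  assume "\<exists>X\<subseteq>Y. A = cell X"
  then obtain X where X: "X \<subseteq> Y" "A = cell X"
    by blast
  then have "A \<in> cells" "cell Y \<in> cells" "X \<in> A" "Y \<in> cell Y" "\<phi> \<one> ` X \<subseteq> Y"
    using Y indep_subset indep_carrier[OF Y] cell_self image_act_one[of X] by (auto simp: cells_iff)
  then show "(A, cell Y) \<in> cell_le"
    unfolding orbit_order_def using one_closed by blast
qed

lemma cell_le_above:
  assumes X: "X \<in> indep" and le: "(cell X, B) \<in> cell_le"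
  shows "\<exists>Y\<in>indep. X \<subseteq> Y \<and> B = cell Y"
proof -
  interpret group G
    by (rule group_G)
  obtain Y where Y: "Y \<in> indep" "B = cell Y"
    using le by (auto simp: orbit_order_def cells_iff)
  then obtain X' where X': "X' \<subseteq> Y" "cell X = cell X'"
    using le cell_le_iff by blast
  have YS: "Y \<subseteq> S"
    using Y indep_carrier by blast
  then have "X \<in> cell X'"
    using X' cell_self indep_carrier[OF X] by auto
  then obtain g where g: "g \<in> carrier G" "X = \<phi> g ` X'"
    using mem_cell by auto
  then have "X \<subseteq> \<phi> g ` Y" "\<phi> g ` Y \<in> indep" "B = cell (\<phi> g ` Y)"
    using X'(1) indep_act Y cell_act YS by auto
  then show ?thesis
    by blast
qed

lemma cell_eqD:
  assumes "X \<subseteq> S" "Y \<subseteq> S" "cell X = cell Y"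
  shows "\<exists>g\<in>carrier G. Y = \<phi> g ` X"
  using cell_self[OF assms(2)] unfolding assms(3)[symmetric] by (auto simp only: mem_cell)

lemma finite_cells: "finite cells"
proof (rule finite_subset[OF _ finite_orbits])
  show "cells \<subseteq> orbits G K (set_action \<phi>)"
    using indep_K by (auto simp: independent_orbits_def orbits_def)
qed

lemma indep_card_labels: "X \<in> indep \<Longrightarrow> card (labels (cell X)) = card X"
  by (simp add: labels_cell indep_carrier card_image indep_orbit_inj)

lemma partial_order_cells: "partial_order_on cells cell_le"
proof -
  have "refl_on cells cell_le"
  proof (rule refl_onI)
    fix A assume "A \<in> cells"
    then show "(A, A) \<in> cell_le"
      using cell_le_iff by (auto simp: cells_iff)
  qed
  moreover have "cell_le \<subseteq> cells \<times> cells"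
    by (auto simp: orbit_order_def)
  moreover have "antisym cell_le"
  proof (rule antisymI)
    fix A B assume AB: "(A, B) \<in> cell_le" and BA: "(B, A) \<in> cell_le"
    then obtain Y where Y: "Y \<in> indep" "B = cell Y"
      by (auto simp: orbit_order_def cells_iff)
    then obtain X where X: "X \<subseteq> Y" "A = cell X"
      using AB cell_le_iff by blast
    then have Xi: "X \<in> indep"
      using Y indep_subset by blast
    then obtain Z where Z: "Z \<subseteq> X" "cell Y = cell Z"
      using BA X Y cell_le_iff by blast
    \<comment> \<open>Equal cells have equally many labels, so the inclusions Z \<subseteq> X
      \<subseteq> Y are equalities.\<close>
    have "card Y = card Z"
      using indep_card_labels[OF Y(1)] indep_card_labels[of Z] Z indep_subset[OF Xi] by simp
    also have "\<dots> \<le> card X"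
      using Z indep_finite[OF Xi] by (simp add: card_mono)
    finally have "X = Y"
      using X indep_finite[OF Y(1)] card_seteq by blast
    then show "A = B"
      using X Y by simp
  qed
  moreover have "Relation.trans cell_le"
  proof (rule transI)
    fix A B C assume AB: "(A, B) \<in> cell_le" and BC: "(B, C) \<in> cell_le"
    then obtain Z where Z: "Z \<in> indep" "C = cell Z"
      by (auto simp: orbit_order_def cells_iff)
    then obtain Y where Y: "Y \<subseteq> Z" "B = cell Y"
      using BC cell_le_iff by blast
    then obtain X where "X \<subseteq> Y" "A = cell X"
      using AB cell_le_iff[OF indep_subset[OF Z(1) Y(1)]] by blast
    then show "(A, C) \<in> cell_le"
      using Y Z cell_le_iff by blast
  qed
  ultimately show ?thesis
    by (simp add: partial_order_on_def preorder_on_def)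
qed

text \<open>The orbit map is injective on a representative, so its subsets correspond to sets of
  labels.\<close>

lemma cell_face:
  assumes B: "B \<in> cells" and Z: "Z \<subseteq> labels B"
  shows "\<exists>!A. (A, B) \<in> cell_le \<and> labels A = Z"
proof -
  obtain Y where Y: "Y \<in> indep" "B = cell Y"
    using B by (auto simp: cells_iff)
  have YS: "Y \<subseteq> S"
    using Y indep_carrier by blast
  define X where "X = {s \<in> Y. orbit G \<phi> s \<in> Z}"
  have X: "X \<subseteq> Y" "orbit G \<phi> ` X = Z"
    using Z Y labels_cell[OF YS] by (auto simp: X_def)
  show ?thesis
  proof (rule ex1I)
    show "(cell X, B) \<in> cell_le \<and> labels (cell X) = Z"
      unfolding Y(2) cell_le_iff[OF Y(1)] labels_cell[OF subset_trans[OF X(1) YS]] using X by blast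
    fix A assume A: "(A, B) \<in> cell_le \<and> labels A = Z"
    then obtain X' where X': "X' \<subseteq> Y" "A = cell X'"
      unfolding Y(2) cell_le_iff[OF Y(1)] by blast
    then have "orbit G \<phi> ` X' = Z"
      using A labels_cell[OF subset_trans[OF X'(1) YS]] by simp
    then have "X' = X"
      using inj_on_image_eq_iff[OF indep_orbit_inj[OF Y(1)] X'(1) X(1)] X(2) by simp
    then show "A = cell X"
      using X' by simp
  qed
qed

lemma cell_exchange:
  assumes "A \<in> cells" "B \<in> cells" "card (labels A) < card (labels B)"
  shows "\<exists>e\<in>labels B - labels A. \<exists>C. (A, C) \<in> cell_le \<and> labels C = insert e (labels A)"
proof -
  obtain X Y where X: "X \<in> indep" "A = cell X" and Y: "Y \<in> indep" "B = cell Y"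
    using assms by (auto simp: cells_iff)
  then obtain y where y: "y \<in> Y - X" "insert y X \<in> indep" "orbit G \<phi> y \<notin> orbit G \<phi> ` X"
    using indep_exchange[OF X(1) Y(1)] assms(3) indep_card_labels by auto
  have "(A, cell (insert y X)) \<in> cell_le"
    unfolding cell_le_iff[OF y(2)] X(2) by blast
  moreover have "labels (cell (insert y X)) = insert (orbit G \<phi> y) (labels A)"
    unfolding X(2) labels_cell[OF indep_carrier[OF X(1)]] labels_cell[OF indep_carrier[OF y(2)]] by simp
  moreover have "orbit G \<phi> y \<in> labels B - labels A"
    unfolding X(2) Y(2) labels_cell[OF indep_carrier[OF X(1)]] labels_cell[OF indep_carrier[OF Y(1)]]
    using y by blast
  ultimately show ?thesis
    by blast
qed

lemma stab_iff: "g \<in> pointwise_stabilizer G \<phi> X \<longleftrightarrow> g \<in> carrier G \<and> (\<forall>s\<in>X. \<phi> g s = s)"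
  by (auto simp: pointwise_stabilizer_def stabilizer_def)

lemma stab_subgroup:
  assumes "X \<subseteq> S"
  shows "subgroup (pointwise_stabilizer G \<phi> X) G"
proof -
  interpret group G
    by (rule group_G)
  show ?thesis
  proof (rule subgroupI)
    have "\<one> \<in> pointwise_stabilizer G \<phi> X"
      using assms act_one by (auto simp: stab_iff)
    then show "pointwise_stabilizer G \<phi> X \<noteq> {}"
      by blast
    show "inv g \<in> pointwise_stabilizer G \<phi> X" if g: "g \<in> pointwise_stabilizer G \<phi> X" for g
      unfolding stab_iff
    proof (intro conjI ballI)
      show "inv g \<in> carrier G"
        using g by (simp add: stab_iff)
      fix s assume "s \<in> X"
      then have "\<phi> g s = s" "s \<in> S" "g \<in> carrier G"
        using g assms by (auto simp: stab_iff)
      then show "\<phi> (inv g) s = s"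
        using act_mult[of s "inv g" g] act_one[of s] by simp
    qed
  qed (use assms act_mult in \<open>auto simp: stab_iff subset_iff\<close>)
qed

end

subsection \<open>Counting joins by subgroup indices\<close>

text \<open>Commutativity makes stabilizers constant on orbits and products of stabilizers
  subgroups; the counting rests on both.\<close>

locale abelian_G_semimatroid = translative_G_semimatroid G S K \<rho> \<phi> + comm_group G
  for G (structure) and S and K and \<rho> and \<phi>
begin

abbreviation stab where
  "stab \<equiv> pointwise_stabilizer G \<phi>"

lemma stab_cong:
  assumes "X \<in> K" "Y \<in> K" "orbit G \<phi> ` X = orbit G \<phi> ` Y"
  shows "stab X = stab Y"
  using pointwise_stabilizer_Supp[OF m_comm] assms by (metis Supp_def subset_antisym)

lemma support_stabilizer_Supp:
  assumes "X \<in> K"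
  shows "support_stabilizer G K \<phi> (Supp G \<phi> X) = stab X"
proof -
  let ?Y = "SOME Y. Y \<in> K \<and> Supp G \<phi> Y = Supp G \<phi> X"
  have Y: "?Y \<in> K \<and> Supp G \<phi> ?Y = Supp G \<phi> X"
    by (rule someI[where x = X]) (simp add: assms)
  then have "stab ?Y = stab X"
    using assms by (intro stab_cong) (auto simp: Supp_def)
  then show ?thesis
    by (simp add: support_stabilizer_def)
qed

lemma stab_closed: "g \<in> stab X \<Longrightarrow> g \<in> carrier G"
  by (simp add: stab_iff)

lemma cancel_inv:
  assumes "u \<in> carrier G" "v \<in> carrier G"
  shows "u \<otimes> (inv u \<otimes> v) = v" "inv u \<otimes> (u \<otimes> v) = v"
  using assms by (simp_all flip: m_assoc)

text \<open>Both cells are represented above one representative of \<open>W\<close>, so common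
  labels become common elements.\<close>

lemma compatible_representatives:
  assumes "(W, A) \<in> cell_le" "(W, B) \<in> cell_le" "labels W = labels A \<inter> labels B"
  shows "\<exists>X\<in>indep. \<exists>Y\<in>indep. A = cell X \<and> B = cell Y \<and> orbit G \<phi> ` (X \<inter> Y) = orbit G \<phi> ` X \<inter> orbit G \<phi> ` Y"
proof -
  obtain Z where Z: "Z \<in> indep" "W = cell Z"
    using assms(1) by (auto simp: orbit_order_def cells_iff)
  obtain X where X: "X \<in> indep" "Z \<subseteq> X" "A = cell X"
    using cell_le_above[OF Z(1)] assms(1) Z(2) by blast
  obtain Y where Y: "Y \<in> indep" "Z \<subseteq> Y" "B = cell Y"
    using cell_le_above[OF Z(1)] assms(2) Z(2) by blast
  have eq: "orbit G \<phi> ` Z = orbit G \<phi> ` X \<inter> orbit G \<phi> ` Y"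
    using assms(3) unfolding Z(2) X(3) Y(3) labels_cell[OF indep_carrier[OF Z(1)]]
      labels_cell[OF indep_carrier[OF X(1)]] labels_cell[OF indep_carrier[OF Y(1)]] .
  have "orbit G \<phi> ` Z \<subseteq> orbit G \<phi> ` (X \<inter> Y)"
    using X(2) Y(2) by (intro image_mono) simp
  then have "orbit G \<phi> ` (X \<inter> Y) = orbit G \<phi> ` X \<inter> orbit G \<phi> ` Y"
    unfolding eq by (intro equalityI image_Int_subset)
  then show ?thesis
    using X Y by blast
qed

text \<open>As g fixes the common elements, each orbit meets the union at most once. The union thus
  has the orbits of the independent set \<open>Z\<close>.\<close>

lemma join_indep:
  assumes X: "X \<in> indep" and Y: "Y \<in> indep"
    and XY: "orbit G \<phi> ` (X \<inter> Y) = orbit G \<phi> ` X \<inter> orbit G \<phi> ` Y"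
    and Z: "Z \<in> indep" "orbit G \<phi> ` Z = orbit G \<phi> ` X \<union> orbit G \<phi> ` Y"
    and g: "g \<in> stab (X \<inter> Y)"
  shows "X \<union> \<phi> g ` Y \<in> indep"
proof (rule indep_of_same_orbits[OF Z(1)])
  have gG: "g \<in> carrier G"
    using g stab_closed by blast
  have XS: "X \<subseteq> S" and YS: "Y \<subseteq> S"
    using X Y indep_carrier by auto
  have gY: "\<phi> g ` Y \<in> indep"
    using indep_act[OF gG Y] .
  show "X \<union> \<phi> g ` Y \<subseteq> S"
    using XS indep_carrier[OF gY] by blast
  show "orbit G \<phi> ` Z = orbit G \<phi> ` (X \<union> \<phi> g ` Y)"
  proof -
    have "orbit G \<phi> ` \<phi> g ` Y = orbit G \<phi> ` Y"
      unfolding image_image by (rule image_cong) (use gG YS orbit_act in auto)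
    then show ?thesis
      using Z(2) by (simp add: image_Un)
  qed
  have eq: "s = \<phi> g t" if st: "s \<in> X" "t \<in> Y" "orbit G \<phi> s = orbit G \<phi> t" for s t
  proof -
    obtain c where c: "c \<in> X \<inter> Y" "orbit G \<phi> s = orbit G \<phi> c"
      using XY st by (metis (no_types, lifting) IntI image_iff)
    then have "s = c" "t = c"
      using inj_onD[OF indep_orbit_inj[OF X], of s c] inj_onD[OF indep_orbit_inj[OF Y], of t c] st by auto
    then show ?thesis
      using g c(1) by (simp add: stab_iff)
  qed
  show "inj_on (orbit G \<phi>) (X \<union> \<phi> g ` Y)"
  proof (rule inj_onI)
    fix s t assume st: "s \<in> X \<union> \<phi> g ` Y" "t \<in> X \<union> \<phi> g ` Y" "orbit G \<phi> s = orbit G \<phi> t"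
    consider "s \<in> X" "t \<in> X" | "s \<in> \<phi> g ` Y" "t \<in> \<phi> g ` Y"
      | y where "s \<in> X" "y \<in> Y" "t = \<phi> g y" | y where "t \<in> X" "y \<in> Y" "s = \<phi> g y"
      using st by blast
    then show "s = t"
    proof cases
      case 1
      then show ?thesis
        using inj_onD[OF indep_orbit_inj[OF X]] st(3) by blast
    next
      case 2
      then show ?thesis
        using inj_onD[OF indep_orbit_inj[OF gY]] st(3) by blast
    next
      case 3
      then show ?thesis
        using eq[of s y] st(3) orbit_act[OF gG, of y] YS by auto
    next
      case 4
      then show ?thesis
        using eq[of t y] st(3) orbit_act[OF gG, of y] YS by auto
    qed
  qed
qed

definition joins where
  "joins A B = {C. (A, C) \<in> cell_le \<and> (B, C) \<in> cell_le \<and> labels C = labels A \<union> labels B}"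

text \<open>Represent a join by a set containing \<open>X\<close>. It also contains a translate of
  \<open>Y\<close>, and translativity forces the translating element to fix the common
  elements.\<close>

lemma joins_eq_image:
  assumes X: "X \<in> indep" and Y: "Y \<in> indep"
    and XY: "orbit G \<phi> ` (X \<inter> Y) = orbit G \<phi> ` X \<inter> orbit G \<phi> ` Y"
    and Z: "Z \<in> indep" "orbit G \<phi> ` Z = orbit G \<phi> ` X \<union> orbit G \<phi> ` Y"
  shows "joins (cell X) (cell Y) = (\<lambda>g. cell (X \<union> \<phi> g ` Y)) ` stab (X \<inter> Y)"
proof (intro equalityI subsetI)
  have XS: "X \<subseteq> S" and YS: "Y \<subseteq> S"
    using X Y indep_carrier by auto
  note lab = labels_cell[OF XS] labels_cell[OF YS]
  fix C assume "C \<in> joins (cell X) (cell Y)"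
  then have C: "(cell X, C) \<in> cell_le" "(cell Y, C) \<in> cell_le" "labels C = orbit G \<phi> ` X \<union> orbit G \<phi> ` Y"
    by (auto simp: joins_def lab)
  obtain D where D: "D \<in> indep" "X \<subseteq> D" "C = cell D"
    using cell_le_above[OF X C(1)] by blast
  obtain Y' where Y': "Y' \<subseteq> D" "cell Y = cell Y'"
    using C(2) cell_le_iff[OF D(1)] D(3) by blast
  have DS: "D \<subseteq> S"
    using indep_carrier[OF D(1)] .
  obtain g where g: "g \<in> carrier G" "Y' = \<phi> g ` Y"
    using cell_eqD[OF YS _ Y'(2)] Y'(1) DS by blast
  have "orbit G \<phi> ` \<phi> g ` Y = orbit G \<phi> ` Y"
    unfolding image_image by (rule image_cong) (use g YS orbit_act in auto)
  then have "orbit G \<phi> ` (X \<union> \<phi> g ` Y) = orbit G \<phi> ` D"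
    using C(3) labels_cell[OF DS] D(3) by (simp add: image_Un)
  then have "X \<union> \<phi> g ` Y = D"
    using inj_on_image_eq_iff[OF indep_orbit_inj[OF D(1)], of "X \<union> \<phi> g ` Y" D] D(2) Y'(1) g(2) by simp
  moreover have "g \<in> stab (X \<inter> Y)"
    unfolding stab_iff
  proof (intro conjI ballI)
    fix s assume "s \<in> X \<inter> Y"
    then show "\<phi> g s = s"
      using simplex_fixed[OF indep_K[OF D(1)], of s g] D(2) Y'(1) g by auto
  qed (rule g(1))
  ultimately show "C \<in> (\<lambda>g. cell (X \<union> \<phi> g ` Y)) ` stab (X \<inter> Y)"
    using D(3) by blast
next
  have XS: "X \<subseteq> S" and YS: "Y \<subseteq> S"
    using X Y indep_carrier by auto
  note lab = labels_cell[OF XS] labels_cell[OF YS]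
  fix C assume "C \<in> (\<lambda>g. cell (X \<union> \<phi> g ` Y)) ` stab (X \<inter> Y)"
  then obtain g where g: "g \<in> stab (X \<inter> Y)" "C = cell (X \<union> \<phi> g ` Y)"
    by blast
  have gG: "g \<in> carrier G"
    using g stab_closed by blast
  have D: "X \<union> \<phi> g ` Y \<in> indep"
    using join_indep[OF assms g(1)] .
  have "orbit G \<phi> ` \<phi> g ` Y = orbit G \<phi> ` Y"
    unfolding image_image by (rule image_cong) (use gG YS orbit_act in auto)
  then have "labels C = labels (cell X) \<union> labels (cell Y)"
    unfolding g(2) labels_cell[OF indep_carrier[OF D]] lab by (simp add: image_Un)
  moreover have "(cell X, C) \<in> cell_le" "(cell (\<phi> g ` Y), C) \<in> cell_le"
    unfolding g(2) cell_le_iff[OF D] by blast+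
  ultimately show "C \<in> joins (cell X) (cell Y)"
    using cell_act[OF gG YS] by (simp add: joins_def)
qed

text \<open>An element k carrying the union for h to the union for g fixes \<open>X\<close> by
  translativity, and k h agrees with g on \<open>Y\<close>. So (k h)^-1 g fixes \<open>Y\<close>,
  and commutativity puts g into the coset of h. Conversely, the factor in \<open>stab X\<close>
  translates one union to the other.\<close>

lemma join_eq_iff:
  assumes X: "X \<in> indep" and Y: "Y \<in> indep"
    and XY: "orbit G \<phi> ` (X \<inter> Y) = orbit G \<phi> ` X \<inter> orbit G \<phi> ` Y"
    and Z: "Z \<in> indep" "orbit G \<phi> ` Z = orbit G \<phi> ` X \<union> orbit G \<phi> ` Y"
    and g: "g \<in> stab (X \<inter> Y)" and h: "h \<in> stab (X \<inter> Y)"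
  shows "cell (X \<union> \<phi> g ` Y) = cell (X \<union> \<phi> h ` Y) \<longleftrightarrow> (stab X <#> stab Y) #> g = (stab X <#> stab Y) #> h"
proof -
  have XS: "X \<subseteq> S" and YS: "Y \<subseteq> S"
    using X Y indep_carrier by auto
  let ?N = "stab X <#> stab Y"
  have N: "subgroup ?N G"
    using mult_subgroups[OF stab_subgroup[OF XS] stab_subgroup[OF YS]] .
  have gh: "g \<in> carrier G" "h \<in> carrier G"
    using g h stab_closed by auto
  have Dg: "X \<union> \<phi> g ` Y \<in> indep" and Dh: "X \<union> \<phi> h ` Y \<in> indep"
    using join_indep[OF assms(1-5)] g h by auto
  have "cell (X \<union> \<phi> g ` Y) = cell (X \<union> \<phi> h ` Y) \<longleftrightarrow> g \<in> ?N #> h"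
  proof
    assume "cell (X \<union> \<phi> g ` Y) = cell (X \<union> \<phi> h ` Y)"
    then obtain k where k: "k \<in> carrier G" "X \<union> \<phi> g ` Y = \<phi> k ` (X \<union> \<phi> h ` Y)"
      using cell_eqD[OF indep_carrier[OF Dh] indep_carrier[OF Dg]] by metis
    have kX: "k \<in> stab X"
      unfolding stab_iff
    proof (intro conjI ballI)
      fix s assume s: "s \<in> X"
      then have "\<phi> k s \<in> X \<union> \<phi> g ` Y"
        using k(2) by blast
      then show "\<phi> k s = s"
        using simplex_fixed[OF indep_K[OF Dg], of s k] s k(1) by blast
    qed (rule k(1))
    let ?b = "inv (k \<otimes> h) \<otimes> g"
    have "?b \<in> stab Y"
      unfolding stab_iff
    proof (intro conjI ballI)
      fix t assume t: "t \<in> Y"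
      then have tS: "t \<in> S"
        using YS by blast
      have "\<phi> k (\<phi> h t) \<in> X \<union> \<phi> g ` Y" "\<phi> g t \<in> X \<union> \<phi> g ` Y"
        using k(2) t by blast+
      moreover have "orbit G \<phi> (\<phi> k (\<phi> h t)) = orbit G \<phi> (\<phi> g t)"
        using orbit_act[OF k(1), of "\<phi> h t"] orbit_act[OF gh(1) tS] orbit_act[OF gh(2) tS] act_closed[OF gh(2) tS] by simp
      ultimately have "\<phi> (k \<otimes> h) t = \<phi> g t"
        using inj_onD[OF indep_orbit_inj[OF Dg]] act_mult[OF tS k(1) gh(2)] by metis
      then have "\<phi> ?b t = \<phi> (inv (k \<otimes> h)) (\<phi> (k \<otimes> h) t)"
        using act_mult[OF tS, of "inv (k \<otimes> h)" g] gh k(1) by simp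
      also have "\<dots> = t"
        using act_mult[OF tS, of "inv (k \<otimes> h)" "k \<otimes> h"] gh k(1) act_one[OF tS] by simp
      finally show "\<phi> ?b t = t" .
    qed (use k gh in simp)
    then have "k \<otimes> ?b \<in> ?N"
      using kX by (auto simp: set_mult_def)
    moreover have "g = (k \<otimes> ?b) \<otimes> h"
    proof -
      have c: "(k \<otimes> b) \<otimes> h = (k \<otimes> h) \<otimes> b" if "b \<in> carrier G" for b
        using that k(1) gh by (simp add: m_ac)
      have "(k \<otimes> ?b) \<otimes> h = (k \<otimes> h) \<otimes> ?b"
        by (rule c) (use k(1) gh in simp)
      also have "\<dots> = g"
        using k(1) gh by (intro cancel_inv) auto
      finally show ?thesis
        by simp
    qed
    ultimately show "g \<in> ?N #> h"
      by (auto simp: r_coset_def)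
  next
    assume "g \<in> ?N #> h"
    then obtain a b where ab: "a \<in> stab X" "b \<in> stab Y" "g = (a \<otimes> b) \<otimes> h"
      by (auto simp: r_coset_def set_mult_def)
    have abG: "a \<in> carrier G" "b \<in> carrier G"
      using ab stab_closed by auto
    have "\<phi> g t = \<phi> a (\<phi> h t)" if "t \<in> Y" for t
    proof -
      have tS: "t \<in> S"
        using that YS by blast
      have "g = (a \<otimes> h) \<otimes> b"
        using ab(3) abG gh by (simp add: m_ac)
      then have "\<phi> g t = \<phi> (a \<otimes> h) (\<phi> b t)"
        using act_mult[OF tS, of "a \<otimes> h" b] abG gh by simp
      then show ?thesis
        using ab(2) that act_mult[OF tS abG(1) gh(2)] by (simp add: stab_iff)
    qed
    then have "\<phi> g ` Y = \<phi> a ` \<phi> h ` Y"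
      unfolding image_image by (intro image_cong) auto
    moreover have "\<phi> a ` X = X"
      using ab(1) by (force simp: stab_iff)
    ultimately have "\<phi> a ` (X \<union> \<phi> h ` Y) = X \<union> \<phi> g ` Y"
      by (simp add: image_Un)
    then show "cell (X \<union> \<phi> g ` Y) = cell (X \<union> \<phi> h ` Y)"
      using cell_act[OF abG(1) indep_carrier[OF Dh]] by simp
  qed
  also have "\<dots> \<longleftrightarrow> ?N #> g = ?N #> h"
    using repr_independence[OF _ gh(2) N] rcos_self[OF gh(1) N] by auto
  finally show ?thesis .
qed

text \<open>The two maps on \<open>stab (X \<inter> Y)\<close> have the same fibres; finiteness
  comes from the finite number of cells.\<close>

lemma card_joins:
  assumes "X \<in> indep" "Y \<in> indep" "orbit G \<phi> ` (X \<inter> Y) = orbit G \<phi> ` X \<inter> orbit G \<phi> ` Y"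
    "Z \<in> indep" "orbit G \<phi> ` Z = orbit G \<phi> ` X \<union> orbit G \<phi> ` Y"
  shows "card (joins (cell X) (cell Y)) = card ((\<lambda>g. (stab X <#> stab Y) #> g) ` stab (X \<inter> Y))"
    and "finite ((\<lambda>g. (stab X <#> stab Y) #> g) ` stab (X \<inter> Y))"
proof -
  have "joins (cell X) (cell Y) \<subseteq> cells"
    by (auto simp: joins_def orbit_order_def)
  then have fin: "finite ((\<lambda>g. cell (X \<union> \<phi> g ` Y)) ` stab (X \<inter> Y))"
    using finite_cells finite_subset unfolding joins_eq_image[OF assms] by blast
  have ker: "cell (X \<union> \<phi> g ` Y) = cell (X \<union> \<phi> h ` Y) \<longleftrightarrow> (stab X <#> stab Y) #> g = (stab X <#> stab Y) #> h"
    if "g \<in> stab (X \<inter> Y)" "h \<in> stab (X \<inter> Y)" for g h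
    using join_eq_iff[OF assms that] .
  show "card (joins (cell X) (cell Y)) = card ((\<lambda>g. (stab X <#> stab Y) #> g) ` stab (X \<inter> Y))"
    unfolding joins_eq_image[OF assms] by (rule card_image_eq_of_same_kernel(1)[OF ker])
  show "finite ((\<lambda>g. (stab X <#> stab Y) #> g) ` stab (X \<inter> Y))"
    by (rule card_image_eq_of_same_kernel(2)[OF ker fin])
qed

text \<open>An element of the sum of the \<open>stab (Z - {t})\<close>, where \<open>Z = X \<union> Y\<close>, splits into the summands
  with \<open>t \<notin> X\<close>, which fix \<open>X\<close>, and those with \<open>t \<in> X\<close>, which fix \<open>Y - X\<close>.\<close>
lemma pow_delta_support:
  assumes XY: "X \<union> Y \<in> indep" and g: "g \<in> stab (X \<inter> Y)"
    and d: "d = delta_support G K \<phi> (Supp G \<phi> (X \<union> Y))" "d \<noteq> 0"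
  shows "g [^] d \<in> stab X <#> stab Y"
proof -
  let ?Z = "X \<union> Y"
  define M where "M = stab ?Z"
  have ZK: "?Z \<in> K" and ZS: "?Z \<subseteq> S"
    using XY indep_K indep_carrier by auto
  have M: "subgroup M G"
    unfolding M_def using stab_subgroup[OF ZS] .
  interpret M: normal M G
    using subgroup_imp_normal[OF M] .
  let ?R = "G Mod M"
  interpret R: comm_group ?R
    using abelian_FactGroup[OF M] .
  have suppM: "support_stabilizer G K \<phi> (Supp G \<phi> ?Z) = M"
    unfolding M_def using support_stabilizer_Supp[OF ZK] .
  define U where "U = (\<Union>x\<in>Supp G \<phi> ?Z. support_factor G K \<phi> (Supp G \<phi> ?Z) x)"
  define T where "T = generate ?R U"
  have gG: "g \<in> carrier G"
    using g stab_closed by blast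
  have split: "\<exists>a\<in>stab X. \<exists>b\<in>stab (Y - X). q = M #> (a \<otimes> b)" if q: "q \<in> U" for q
  proof -
    obtain t h where t: "t \<in> ?Z" "q = M #> h" "h \<in> support_stabilizer G K \<phi> (Supp G \<phi> ?Z - {orbit G \<phi> t})"
      using q unfolding U_def support_factor_def suppM by (auto simp: Supp_def)
    \<comment> \<open>Distinct elements of \<open>?Z\<close> have distinct labels, so removing a
      label removes one element.\<close>
    have "Supp G \<phi> ?Z - {orbit G \<phi> t} = Supp G \<phi> (?Z - {t})"
      using inj_on_image_set_diff[OF orbit_inj[OF ZK], of ?Z "{t}"] t(1) by (auto simp: Supp_def)
    then have h: "h \<in> stab (?Z - {t})"
      using t(3) support_stabilizer_Supp[OF K_subset[OF ZK], of "?Z - {t}"] by auto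
    then have hG: "h \<in> carrier G"
      using stab_closed by blast
    show ?thesis
    proof (cases "t \<in> X")
      case True
      then have "h \<in> stab (Y - X)" "\<one> \<in> stab X"
        using h ZS act_one by (auto simp: stab_iff)
      then show ?thesis
        using t(2) hG by (intro bexI[of _ \<one>] bexI[of _ h]) auto
    next
      case False
      then have "h \<in> stab X" "\<one> \<in> stab (Y - X)"
        using h ZS act_one by (auto simp: stab_iff)
      then show ?thesis
        using t(2) hG by (intro bexI[of _ h] bexI[of _ \<one>]) auto
    qed
  qed
  have UR: "U \<subseteq> carrier ?R"
    using split stab_closed by (fastforce simp: carrier_FactGroup)
  have T: "subgroup T ?R"
    unfolding T_def using R.generate_is_subgroup[OF UR] .
  have X: "subgroup (stab X) G" and Y: "subgroup (stab (Y - X)) G"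
    using ZS by (auto intro!: stab_subgroup)
  have T_split: "\<exists>a\<in>stab X. \<exists>b\<in>stab (Y - X). q = M #> (a \<otimes> b)" if "q \<in> T" for q
    using that unfolding T_def
  proof (induction rule: generate.induct)
    case one
    then show ?case
      using subgroup.one_closed[OF X] subgroup.one_closed[OF Y]
      by (intro bexI[of _ \<one>]) (auto simp: M.subset)
  next
    case (incl h)
    then show ?case
      by (rule split)
  next
    case (inv h)
    then obtain a b where ab: "a \<in> stab X" "b \<in> stab (Y - X)" "h = M #> (a \<otimes> b)"
      using split by blast
    then have abG: "a \<in> carrier G" "b \<in> carrier G"
      using stab_closed by auto
    have "inv\<^bsub>?R\<^esub> h = M #> inv (a \<otimes> b)"
      using M.inv_FactGroup[of h] M.rcos_inv[of "a \<otimes> b"] ab(3) abG by (simp add: carrier_FactGroup)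
    also have "inv (a \<otimes> b) = inv a \<otimes> inv b"
      using abG by (simp add: inv_mult)
    finally show ?case
      using ab subgroup.m_inv_closed[OF X] subgroup.m_inv_closed[OF Y] by blast
  next
    case (eng h h')
    then obtain a b a' b' where ab: "a \<in> stab X" "b \<in> stab (Y - X)" "h = M #> (a \<otimes> b)"
      "a' \<in> stab X" "b' \<in> stab (Y - X)" "h' = M #> (a' \<otimes> b')"
      by blast
    then have abG: "a \<in> carrier G" "b \<in> carrier G" "a' \<in> carrier G" "b' \<in> carrier G"
      using stab_closed by auto
    have "h \<otimes>\<^bsub>?R\<^esub> h' = M #> ((a \<otimes> b) \<otimes> (a' \<otimes> b'))"
      using ab abG M.rcos_sum by simp
    also have "(a \<otimes> b) \<otimes> (a' \<otimes> b') = (a \<otimes> a') \<otimes> (b \<otimes> b')"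
      using abG by (simp add: m_ac)
    finally show ?case
      using ab subgroup.m_closed[OF X] subgroup.m_closed[OF Y] by blast
  qed
  have card_T: "card (rcosets\<^bsub>?R\<^esub> T) = d"
    unfolding d(1) delta_support_def support_sum_def support_quotient_def suppM T_def U_def ..
  have "(M #> g) [^]\<^bsub>?R\<^esub> d \<in> T"
    using R.pow_index_closed[OF T, of "M #> g"] card_T d(2) gG by (simp add: carrier_FactGroup)
  then have "M #> (g [^] d) \<in> T"
    using M.FactGroup_pow[OF gG] by simp
  then obtain a b where ab: "a \<in> stab X" "b \<in> stab (Y - X)" "M #> (g [^] d) = M #> (a \<otimes> b)"
    using T_split by blast
  have abG: "a \<in> carrier G" "b \<in> carrier G"
    using ab stab_closed by auto
  have "g [^] d \<in> M #> (a \<otimes> b)"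
    using rcos_self[OF _ M, of "g [^] d"] gG ab(3) by simp
  then obtain m where m: "m \<in> M" "g [^] d = m \<otimes> (a \<otimes> b)"
    by (auto simp: r_coset_def)
  have mG: "m \<in> carrier G"
    using m(1) M.subset by blast
  have ma: "m \<otimes> a \<in> stab X"
    using m(1) ab(1) ZS by (intro subgroup.m_closed[OF X]) (auto simp: M_def stab_iff)
  \<comment> \<open>So far b fixes only \<open>Y - X\<close>. It fixes \<open>X \<inter> Y\<close>
    because m, a and g do.\<close>
  have "b \<in> stab (X \<inter> Y)"
  proof -
    have I: "subgroup (stab (X \<inter> Y)) G"
      using ZS by (intro stab_subgroup) auto
    have "m \<otimes> a \<in> stab (X \<inter> Y)"
      using ma by (auto simp: stab_iff)
    moreover have "g [^] d \<in> stab (X \<inter> Y)"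
      using g subgroup.m_closed[OF I] subgroup.one_closed[OF I] by (induction d) auto
    ultimately have "inv (m \<otimes> a) \<otimes> g [^] d \<in> stab (X \<inter> Y)"
      using subgroup.m_closed[OF I] subgroup.m_inv_closed[OF I] by blast
    moreover have "inv (m \<otimes> a) \<otimes> g [^] d = b"
      unfolding m(2) using cancel_inv(2)[of "m \<otimes> a" b] mG abG by (simp add: m_assoc)
    ultimately show ?thesis
      by simp
  qed
  then have "b \<in> stab Y"
    using ab(2) by (auto simp: stab_iff)
  moreover have "g [^] d = (m \<otimes> a) \<otimes> b"
    using m(2) mG abG by (simp add: m_assoc)
  ultimately show ?thesis
    using ma by (auto simp: set_mult_def)
qed

end

text \<open>If the number vanished in the field, the characteristic would be a prime dividing the
  order of a group annihilated by \<delta>(X \<union> Y), and hence would divide \<delta>(X \<union>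
  Y).\<close>

lemma (in abelian_G_semimatroid) card_joins_nonzero:
  assumes char: "CHAR('k::field) = 0 \<or> \<not> CHAR('k) dvd delta G K \<rho> \<phi>"
    and X: "X \<in> indep" and Y: "Y \<in> indep"
    and XY: "orbit G \<phi> ` (X \<inter> Y) = orbit G \<phi> ` X \<inter> orbit G \<phi> ` Y"
    and Z: "Z \<in> indep" "orbit G \<phi> ` Z = orbit G \<phi> ` X \<union> orbit G \<phi> ` Y"
  shows "of_nat (card (joins (cell X) (cell Y))) \<noteq> (0::'k)"
proof
  let ?N = "stab X <#> stab Y"
  let ?C = "(\<lambda>g. ?N #> g) ` stab (X \<inter> Y)"
  let ?p = "CHAR('k)"
  assume "of_nat (card (joins (cell X) (cell Y))) = (0::'k)"
  then have p: "?p dvd card ?C"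
    using card_joins(1)[OF X Y XY Z] by (simp add: of_nat_eq_0_iff_char_dvd)
  have XS: "X \<subseteq> S" and YS: "Y \<subseteq> S"
    using X Y indep_carrier by auto
  have I: "subgroup (stab (X \<inter> Y)) G"
    using XS by (intro stab_subgroup) auto
  have N: "subgroup ?N G"
    using mult_subgroups[OF stab_subgroup[OF XS] stab_subgroup[OF YS]] .
  have NI: "?N \<subseteq> stab (X \<inter> Y)"
  proof
    fix g assume "g \<in> ?N"
    then obtain a b where ab: "a \<in> stab X" "b \<in> stab Y" "g = a \<otimes> b"
      by (auto simp: set_mult_def)
    then have "a \<in> stab (X \<inter> Y)" "b \<in> stab (X \<inter> Y)"
      by (auto simp: stab_iff)
    then show "g \<in> stab (X \<inter> Y)"
      using subgroup.m_closed[OF I] ab(3) by simp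
  qed
  have fin: "finite ?C"
    using card_joins(2)[OF X Y XY Z] .
  have one: "\<one> \<in> stab (X \<inter> Y)"
    using subgroup.one_closed[OF I] .
  then have "?C \<noteq> {}"
    by blast
  \<comment> \<open>A finite nonempty set of cosets has positive size, which rules out
    characteristic 0.\<close>
  then have "card ?C \<noteq> 0"
    using fin by simp
  then have "?p \<noteq> 0"
    using p by auto
  then have prime: "prime ?p" and ndvd: "\<not> ?p dvd delta G K \<rho> \<phi>"
    using char prime_CHAR_semidom[where 'a = 'k] by auto
  have U: "X \<union> Y \<in> indep"
    using join_indep[OF X Y XY Z one] image_act_one[OF YS] by simp
  define d where "d = delta_support G K \<phi> (Supp G \<phi> (X \<union> Y))"
  have "d dvd delta G K \<rho> \<phi>"
    unfolding delta_def d_def using U by (intro dvd_Lcm) blast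
  then have d: "\<not> ?p dvd d"
    using ndvd dvd_trans by blast
  \<comment> \<open>An infinite index would be recorded as 0, which the characteristic divides. So
    the index is finite.\<close>
  then have "d \<noteq> 0"
    by (metis dvd_0_right)
  then have "g [^] d \<in> ?N" if "g \<in> stab (X \<inter> Y)" for g
    using pow_delta_support[OF U that d_def] by simp
  then have "?p dvd d"
    using prime_dvd_index[OF I N NI fin prime p] by blast
  then show False
    using d by simp
qed

theorem (in abelian_G_semimatroid) cohen_macaulay_independent_orbits:
  assumes char: "CHAR('k::field) = 0 \<or> \<not> CHAR('k) dvd delta G K \<rho> \<phi>"
  shows "cohen_macaulay TYPE('k)
           (reduced_independent_orbits G K \<rho> \<phi>)
           (orbit_order G \<phi> (reduced_independent_orbits G K \<rho> \<phi>))"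
proof -
  have reps: "\<exists>X\<in>indep. \<exists>Y\<in>indep. \<exists>Z\<in>indep. A = cell X \<and> B = cell Y \<and>
      orbit G \<phi> ` (X \<inter> Y) = orbit G \<phi> ` X \<inter> orbit G \<phi> ` Y \<and>
      orbit G \<phi> ` Z = orbit G \<phi> ` X \<union> orbit G \<phi> ` Y"
    if AB: "(W, A) \<in> cell_le" "(W, B) \<in> cell_le" "labels W = labels A \<inter> labels B"
      and C: "C \<in> cells" "labels C = labels A \<union> labels B" for W A B C
  proof -
    obtain X Y where XY: "X \<in> indep" "Y \<in> indep" "A = cell X" "B = cell Y"
      "orbit G \<phi> ` (X \<inter> Y) = orbit G \<phi> ` X \<inter> orbit G \<phi> ` Y"
      using compatible_representatives[OF AB] by blast
    obtain Z where Z: "Z \<in> indep" "C = cell Z"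
      using C(1) by (auto simp: cells_iff)
    have "orbit G \<phi> ` Z = orbit G \<phi> ` X \<union> orbit G \<phi> ` Y"
      using C(2) unfolding Z(2) XY(3,4) labels_cell[OF indep_carrier[OF Z(1)]]
        labels_cell[OF indep_carrier[OF XY(1)]] labels_cell[OF indep_carrier[OF XY(2)]] .
    then show ?thesis
      using XY Z(1) by blast
  qed
  interpret L: labelled_cells cells cell_le "TYPE('k)" labels
  proof
    show "finite cells" "partial_order_on cells cell_le"
      by (rule finite_cells partial_order_cells)+
    fix A B assume A: "A \<in> cells"
    then obtain X where X: "X \<in> indep" "A = cell X"
      by (auto simp: cells_iff)
    show "finite (labels A)"
      unfolding X(2) labels_cell[OF indep_carrier[OF X(1)]] using indep_finite[OF X(1)] by simp
  next
    fix A B assume AB: "(A, B) \<in> cell_le"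
    then obtain Y where Y: "Y \<in> indep" "B = cell Y"
      by (auto simp: orbit_order_def cells_iff)
    then obtain X where X: "X \<subseteq> Y" "A = cell X"
      using AB cell_le_iff by blast
    show "labels A \<subseteq> labels B"
      unfolding X(2) Y(2) labels_cell[OF indep_carrier[OF Y(1)]]
        labels_cell[OF subset_trans[OF X(1) indep_carrier[OF Y(1)]]]
      by (rule image_mono[OF X(1)])
  next
    show "\<exists>!A. (A, B) \<in> cell_le \<and> labels A = Z" if "B \<in> cells" "Z \<subseteq> labels B" for B Z
      using cell_face[OF that] .
    show "\<exists>e\<in>labels B - labels A. \<exists>C. (A, C) \<in> cell_le \<and> labels C = insert e (labels A)"
      if "A \<in> cells" "B \<in> cells" "card (labels A) < card (labels B)" for A B
      using cell_exchange[OF that] .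
    show "of_nat (card {D. (A, D) \<in> cell_le \<and> (B, D) \<in> cell_le \<and> labels D = labels A \<union> labels B}) \<noteq> (0::'k)"
      if AB: "(W, A) \<in> cell_le" "(W, B) \<in> cell_le" "labels W = labels A \<inter> labels B"
        and C: "C \<in> cells" "labels C = labels A \<union> labels B" for W A B C
    proof -
      obtain X Y Z where XY: "X \<in> indep" "Y \<in> indep" "Z \<in> indep" "A = cell X" "B = cell Y"
        "orbit G \<phi> ` (X \<inter> Y) = orbit G \<phi> ` X \<inter> orbit G \<phi> ` Y"
        "orbit G \<phi> ` Z = orbit G \<phi> ` X \<union> orbit G \<phi> ` Y"
        using reps[OF AB C] by (elim bexE conjE) (rule that)
      show ?thesis
        using card_joins_nonzero[OF char XY(1,2,6,3,7)] unfolding joins_def XY(4,5) .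
    qed
    show "card {D. (A, D) \<in> cell_le \<and> (B, D) \<in> cell_le \<and> labels D = labels A \<union> labels B} =
        card {D. (A', D) \<in> cell_le \<and> (B', D) \<in> cell_le \<and> labels D = labels A' \<union> labels B'}"
      if 1: "(W, A) \<in> cell_le" "(W, B) \<in> cell_le" "labels W = labels A \<inter> labels B"
        and 2: "(W', A') \<in> cell_le" "(W', B') \<in> cell_le" "labels W' = labels A' \<inter> labels B'"
        and 3: "labels A = labels A'" "labels B = labels B'"
        and C: "C \<in> cells" "labels C = labels A \<union> labels B" for W A B W' A' B' C
    proof -
      obtain X Y Z where XY: "X \<in> indep" "Y \<in> indep" "Z \<in> indep" "A = cell X" "B = cell Y"
        "orbit G \<phi> ` (X \<inter> Y) = orbit G \<phi> ` X \<inter> orbit G \<phi> ` Y"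
        "orbit G \<phi> ` Z = orbit G \<phi> ` X \<union> orbit G \<phi> ` Y"
        using reps[OF 1 C] by (elim bexE conjE) (rule that)
      obtain X' Y' Z' where XY': "X' \<in> indep" "Y' \<in> indep" "Z' \<in> indep" "A' = cell X'" "B' = cell Y'"
        "orbit G \<phi> ` (X' \<inter> Y') = orbit G \<phi> ` X' \<inter> orbit G \<phi> ` Y'"
        "orbit G \<phi> ` Z' = orbit G \<phi> ` X' \<union> orbit G \<phi> ` Y'"
        using reps[OF 2 C(1) C(2)[unfolded 3]] by (elim bexE conjE) (rule that)
      have sX: "orbit G \<phi> ` X = orbit G \<phi> ` X'"
        using 3(1) unfolding XY(4) XY'(4) labels_cell[OF indep_carrier[OF XY(1)]] labels_cell[OF indep_carrier[OF XY'(1)]] .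
      have sY: "orbit G \<phi> ` Y = orbit G \<phi> ` Y'"
        using 3(2) unfolding XY(5) XY'(5) labels_cell[OF indep_carrier[OF XY(2)]] labels_cell[OF indep_carrier[OF XY'(2)]] .
      \<comment> \<open>Stabilizers depend only on labels, so both sides count cosets of the same
        subgroups.\<close>
      have "stab X = stab X'" "stab Y = stab Y'"
        using stab_cong[OF indep_K[OF XY(1)] indep_K[OF XY'(1)] sX]
          stab_cong[OF indep_K[OF XY(2)] indep_K[OF XY'(2)] sY] by auto
      moreover have "stab (X \<inter> Y) = stab (X' \<inter> Y')"
      proof (rule stab_cong)
        show "X \<inter> Y \<in> K" "X' \<inter> Y' \<in> K"
          using K_subset[OF indep_K[OF XY(1)]] K_subset[OF indep_K[OF XY'(1)]] by auto
        show "orbit G \<phi> ` (X \<inter> Y) = orbit G \<phi> ` (X' \<inter> Y')"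
          unfolding XY(6) XY'(6) sX sY ..
      qed
      ultimately have "card (joins A B) = card (joins A' B')"
        unfolding XY(4,5) XY'(4,5) card_joins(1)[OF XY(1,2,6,3,7)] card_joins(1)[OF XY'(1,2,6,3,7)] by simp
      then show ?thesis
        by (simp add: joins_def)
    qed
  qed
  have red: "reduced_independent_orbits G K \<rho> \<phi> = cells - {cell {}}"
    by (simp add: reduced_independent_orbits_def)
  show ?thesis
    unfolding red
  proof (rule L.cohen_macaulay_proper_part)
    show "cell {} \<in> cells"
      using indep_empty by (auto simp: cells_iff)
    show "(cell {}, A) \<in> cell_le" if A: "A \<in> cells" for A
    proof -
      obtain X where "X \<in> indep" "A = cell X"
        using A by (auto simp: cells_iff)
      then show ?thesis
        using cell_le_iff by blast
    qed
    show "labels (cell {}) = {}"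
      using labels_cell[of "{}"] by simp
    show "orbit_order G \<phi> (cells - {cell {}}) = cell_le \<inter> (cells - {cell {}}) \<times> (cells - {cell {}})"
      by (auto simp: orbit_order_def)
  qed
qed

theorem theorem4:
  fixes G :: "('g, 'm) monoid_scheme" and S :: "'s set" and K :: "'s set set"
    and \<rho> :: "'s set \<Rightarrow> nat" and \<phi> :: "'g \<Rightarrow> 's \<Rightarrow> 's"
  assumes "refined_G_semimatroid G S K \<rho> \<phi>"
    and "CHAR('k::field) = 0 \<or> \<not> CHAR('k) dvd delta G K \<rho> \<phi>"
  shows "cohen_macaulay TYPE('k)
           (reduced_independent_orbits G K \<rho> \<phi>)
           (orbit_order G \<phi> (reduced_independent_orbits G K \<rho> \<phi>))"
proof -
  interpret refined_G_semimatroid G S K \<rho> \<phi>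
    by (rule assms(1))
  have "group G"
    using group_hom by (simp add: group_hom_def)
  then have "comm_group G"
    by (rule group.group_comm_groupI) (rule refined_comm)
  then have "abelian_G_semimatroid G S K \<rho> \<phi>"
    using translative_G_semimatroid_axioms by (simp add: abelian_G_semimatroid_def)
  then show ?thesis
    using assms(2) by (rule abelian_G_semimatroid.cohen_macaulay_independent_orbits)
qed

end
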